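(* Let $G$ be an abelian group with a character $\sigma:G\to\mathbb C^\times$, let $|\sigma|$ be the order of the group $\sigma(G)$, and let $\gamma\in\mathbb Z_2^{[\nu/2]+1}$. Regard $V_\nu(\gamma)\otimes\mathcal S(\mathcal H^-)\subseteq M$ as a module over $\widehat{\mathfrak{eu}}_\nu(\mathcal R_\sigma,\bar{\ })$ by restriction. (1) If $|\sigma|=\infty$ or $|\sigma|$ is even, then $V_\nu(\gamma)\otimes\mathcal S(\mathcal H^-)$ is irreducible as an $\widehat{\mathfrak{eu}}_\nu(\mathcal R_\sigma,\bar{\ })$-module. (2) If $|\sigma|=N$ is a (finite) odd number, let $\mathcal H_0^-$ be the subspace of $\mathcal H^-$ spanned by $\epsilon_i(m)-\epsilon_j(m)$ and $\epsilon_i(n)$ for $1\le i\ne j\le\nu$, $m,n\in-(2\mathbb N+1)$, $n\notin N\mathbb Z$. Then $V_\nu(\gamma)\otimes\mathcal S(\mathcal H_0^-)$ is an irreducible $\widehat{\mathfrak{eu}}_\nu(\mathcal R_\sigma,\bar{\ })$-submodule of $V_\nu(\gamma)\otimes\mathcal S(\mathcal H^-)$. Moreover, $V_\nu(\gamma)\otimes\mathcal S(\mathcal H^-)$ is completely reducible as an $\widehat{\mathfrak{eu}}_\nu(\mathcal R_\sigma,\bar{\ })$-module.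
   Context: Fix an integer $\nu\ge2$; $\mathbb N=\{0,1,2,\dots\}$, $\mathbb Z_2=\{\pm1\}$. Fock space and vertex operators. Let $\Gamma=\bigoplus_{i=1}^{\nu}\mathbb{Z}\epsilon_i$ with $(\epsilon_i,\epsilon_j)=\delta_{ij}$. Let $\mathcal H$ be the complex Lie algebra spanned by $\epsilon_i(n)$ ($1\le i\le\nu$, $n\in2\mathbb Z+1$) and a central element $1$, with $[\alpha(m),\beta(n)]=\frac m2(\alpha,\beta)\delta_{m+n,0}\,1$, where $\alpha(n)=\sum_i c_i\epsilon_i(n)$ for $\alpha=\sum_i c_i\epsilon_i\in\Gamma$. Let $\varepsilon:\Gamma\times\Gamma\to\{\pm1\}$ be bimultiplicative with $\varepsilon(\epsilon_i,\epsilon_j)=1$ if $i\le j$ and $-1$ if $i>j$. Let $\bar\Gamma=\Gamma/2\Gamma$ and let $\mathbb C[\bar\Gamma]$ be the twisted group algebra with basis $e^{\bar\alpha}$ and product $e^{\bar\alpha}e^{\bar\beta}=\varepsilon(\alpha,\beta)e^{\overline{\alpha+\beta}}$. Let $\mathcal H^-$ be the span of $\epsilon_i(n)$, $n\in-(2\mathbb N+1)$, and $M=\mathbb C[\bar\Gamma]\otimes\mathcal S(\mathcal H^-)$: $e^{\bar\alpha}$ acts by left multiplication on the first factor; on the symmetric algebra $\mathcal S(\mathcal H^-)$, $\epsilon_i(n)$ acts by multiplication if $n<0$ and, if $n>0$, as the derivation with $\epsilon_i(n)\cdot\epsilon_j(m)=\frac n2\delta_{ij}\delta_{m+n,0}$;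 $1$ acts as identity. Put $E_{\pm}(\alpha,z)=\exp\big(-2\sum_{n\in\pm(2\mathbb N+1)}\frac{\alpha(n)}{n}z^{-n}\big)$, $\epsilon_i(z)=\sum_{n\in2\mathbb Z+1}\epsilon_i(n)z^{-n}$. For $a\in\mathbb C^\times$ define $X_{ij}(a,z)=\varepsilon(\epsilon_i,\epsilon_j)e^{\overline{\epsilon_i-\epsilon_j}}E_-(\epsilon_i,z)E_-(-\epsilon_j,az)E_+(\epsilon_i,z)E_+(-\epsilon_j,az)$ if $i\ne j$; $X_{ii}(1,z)=4\epsilon_i(z)$; $X_{ii}(a,z)=\frac{1+a}{1-a}\big(E_-(\epsilon_i,z)E_-(-\epsilon_i,az)E_+(\epsilon_i,z)E_+(-\epsilon_i,az)-1\big)$ if $a\ne1$. Operators $x_{ij}(a,n)$ on $M$ are defined by $X_{ij}(a,z)=\sum_{n\in\mathbb Z}x_{ij}(a,n)z^{-n}$. Lie algebras. Write $G$ additively and $\tilde\alpha=\sigma(\alpha)$. $\mathcal R_\sigma$ is the associative $\mathbb C$-algebra with basis $t^me^\alpha$ ($m\in\mathbb Z,\alpha\in G$), where $e^\alpha e^\beta=e^{\alpha+\beta}$ and $e^\alpha t^m=\tilde\alpha^m t^me^\alpha$. The anti-involution $\bar{\ }$ of $\mathcal R_\sigma$ is given by $\bar t=-t$, $\overline{e^\alpha}=e^{-\alpha}$. For $X\in M_\nu(\mathcal R_\sigma)$ put $X^*=\overline X^{\,t}$. $\mathfrak u_\nu(\mathcal R_\sigma,\bar{\ })=\{X\in M_\nu(\mathcal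 R_\sigma):X^*=-X\}$, a Lie algebra under the commutator, spanned by $e_{ij}(m,\alpha)=E_{ij}t^me^\alpha-E_{ji}\overline{t^me^\alpha}$. Let $\widehat{gl}_\nu(\mathcal R_\sigma)=gl_\nu(\mathcal R_\sigma)\oplus\mathbb Cc$ with $c$ central and $[E_{ij}t^me^\alpha,E_{kl}t^ne^\beta]=\delta_{jk}\tilde\alpha^nE_{il}t^{m+n}e^{\alpha+\beta}-\delta_{il}\tilde\beta^mE_{kj}t^{m+n}e^{\alpha+\beta}+m\delta_{il}\delta_{jk}\delta_{m+n,0}\delta_{\tilde\alpha\tilde\beta,1}\tilde\alpha^nc$; $\widehat{\mathfrak u}_\nu(\mathcal R_\sigma,\bar{\ })=\mathfrak u_\nu(\mathcal R_\sigma,\bar{\ })\oplus\mathbb Cc$ with the inherited bracket. It acts on $M$ by $2e_{ij}(m,\alpha)\mapsto x_{ij}(\tilde\alpha,m)+\delta_{m,0}\delta_{ij}(1-\delta_{\tilde\alpha,1})\frac{1+\tilde\alpha}{1-\tilde\alpha}$ (last term $0$ if $\tilde\alpha=1$), $c\mapsto\frac12$. $\widehat{\mathfrak{eu}}_\nu(\mathcal R_\sigma,\bar{\ })$ is the Lie subalgebra of $\widehat{\mathfrak u}_\nu(\mathcal R_\sigma,\bar{\ })$ generated by $e_{ij}(m,\alpha)$ for $1\le i\ne j\le\nu$, $m\in\mathbb Z$, $\alpha\in G$. The spaces $V_\nu(\gamma)$. For $\rho=\pm1$ let $w_{j}(\rho)=1+\sqrt{-1}\,\rho\, e^{\bar\epsilon_{j}}$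 for $j$ odd and $w_{j}(\rho)=1+\rho\, e^{\bar\epsilon_{j}}$ for $j$ even, and $w(\rho_1,\dots,\rho_\nu)=w_1(\rho_1)w_2(\rho_2)\cdots w_\nu(\rho_\nu)\in\mathbb C[\bar\Gamma]$. Let $d=[\nu/2]$ and $\gamma=(\gamma_1,\dots,\gamma_{d+1})\in\mathbb Z_2^{d+1}$. If $\nu=2d+1$, $V_\nu(\gamma)$ is the span of those $w(\rho_1,\dots,\rho_\nu)$ ($\rho_i=\pm1$) with $\rho_1=\gamma_1$ and $\rho_{2j}\rho_{2j+1}=\gamma_{j+1}$ for $1\le j\le d$. If $\nu=2d$, $V_\nu(\gamma)$ is the span of those $w(\rho_1,\dots,\rho_\nu)$ with $\rho_1=\gamma_1$, $\rho_{2j}\rho_{2j+1}=\gamma_{j+1}$ for $1\le j\le d-1$, and $\rho_{2d}=\gamma_{d+1}$. Each $V_\nu(\gamma)\otimes\mathcal S(\mathcal H^-)$ is a $\widehat{\mathfrak u}_\nu(\mathcal R_\sigma,\bar{\ })$-submodule of $M$. *)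

theory Defs
  imports Complex_Main "HOL-Library.Poly_Mapping" "HOL-Library.Z2" "HOL-Library.Product_Plus"
begin

section \<open>Free vector spaces\<close>

text \<open>
  A complex vector space with a distinguished basis indexed by \<open>'k\<close> is rendered as the type
  of finitely supported functions \<open>'k \<Rightarrow>\<^sub>0 complex\<close>, the basis vector of \<open>k\<close> being
  \<open>Poly_Mapping.single k 1\<close>.  Poly_Mapping's ring multiplication is used below only for the
  polynomial algebra \<open>S(H\<^sup>-)\<close>; twisted algebras get their own products.
\<close>

definition pscale :: "complex \<Rightarrow> ('k \<Rightarrow>\<^sub>0 complex) \<Rightarrow> ('k \<Rightarrow>\<^sub>0 complex)" where
  "pscale c = Poly_Mapping.map ((*) c)"

definition mscale :: "complex \<Rightarrow> ('l \<Rightarrow>\<^sub>0 ('k \<Rightarrow>\<^sub>0 complex)) \<Rightarrow> ('l \<Rightarrow>\<^sub>0 ('k \<Rightarrow>\<^sub>0 complex))" where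
  "mscale c = Poly_Mapping.map (pscale c)"

definition psum :: "('k \<Rightarrow>\<^sub>0 'a::zero) \<Rightarrow> ('k \<Rightarrow> 'a \<Rightarrow> 'b::comm_monoid_add) \<Rightarrow> 'b" where
  "psum x F = (\<Sum>k\<in>Poly_Mapping.keys x. F k (Poly_Mapping.lookup x k))"

lemma lookup_pscale [simp]: "Poly_Mapping.lookup (pscale c x) k = c * Poly_Mapping.lookup x k"
  by (simp add: pscale_def Poly_Mapping.map.rep_eq when_def)

lemma pscale_zero [simp]: "pscale c 0 = 0"
  by (rule poly_mapping_eqI) simp

lemma lookup_mscale [simp]: "Poly_Mapping.lookup (mscale c x) k = pscale c (Poly_Mapping.lookup x k)"
  by (simp add: mscale_def Poly_Mapping.map.rep_eq when_def)

interpretation pscale: vector_space pscale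
  by standard (auto intro!: poly_mapping_eqI simp: lookup_add algebra_simps)

interpretation mscale: vector_space mscale
  by standard (auto intro!: poly_mapping_eqI simp: lookup_add algebra_simps)

lemma psum_superset:
  assumes "finite A" "Poly_Mapping.keys x \<subseteq> A" "\<And>k. F k 0 = 0"
  shows "psum x F = (\<Sum>k\<in>A. F k (Poly_Mapping.lookup x k))"
  unfolding psum_def using assms
  by (intro sum.mono_neutral_left) (auto simp: in_keys_iff)

lemma psum_add:
  assumes "\<And>k. F k 0 = 0" "\<And>k a b. F k (a + b) = F k a + F k b"
  shows "psum (x + y) F = psum x F + psum y F"
proof -
  let ?A = "Poly_Mapping.keys x \<union> Poly_Mapping.keys y"
  have "psum z F = (\<Sum>k\<in>?A. F k (Poly_Mapping.lookup z k))" if "Poly_Mapping.keys z \<subseteq> ?A" for z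
    by (rule psum_superset) (use that assms in auto)
  then show ?thesis
    by (simp add: keys_add lookup_add assms sum.distrib)
qed

lemma psum_single: "F k 0 = 0 \<Longrightarrow> psum (Poly_Mapping.single k a) F = F k a"
  by (simp add: psum_def)

section \<open>The twisted group algebra of \<open>\<Gamma>/2\<Gamma>\<close>\<close>

text \<open>
  \<open>\<Gamma>\<close> consists of the finitely supported \<open>\<alpha> :: nat \<Rightarrow>\<^sub>0 int\<close> with support in \<open>{1..\<nu>}\<close>, and
  \<open>\<Gamma>/2\<Gamma>\<close> of the \<open>nat \<Rightarrow>\<^sub>0 bit\<close> with support in \<open>{1..\<nu>}\<close>; the projection is reduction mod 2.
\<close>

type_synonym lat = "nat \<Rightarrow>\<^sub>0 int"
type_synonym lat2 = "nat \<Rightarrow>\<^sub>0 bit"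

definition eps :: "nat \<Rightarrow> lat" where
  "eps i = Poly_Mapping.single i 1"

definition bar2 :: "lat \<Rightarrow> lat2" where
  "bar2 = Poly_Mapping.map of_int"

definition cocyc :: "lat \<Rightarrow> lat \<Rightarrow> complex" where
  "cocyc \<alpha> \<beta> = (-1) powi psum \<alpha> (\<lambda>i a. psum \<beta> (\<lambda>j b. if i > j then a * b else 0))"

text \<open>\<open>\<epsilon>\<close> takes the values \<open>\<plusminus>1\<close>, so it depends on classes mod \<open>2\<Gamma>\<close> only; it is evaluated
  on the representatives with coordinates in \<open>{0,1}\<close>.\<close>

definition rep2 :: "lat2 \<Rightarrow> lat" where
  "rep2 = Poly_Mapping.map of_bit"

definition cocyc2 :: "lat2 \<Rightarrow> lat2 \<Rightarrow> complex" where
  "cocyc2 A B = cocyc (rep2 A) (rep2 B)"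

definition ebar :: "lat \<Rightarrow> (lat2 \<Rightarrow>\<^sub>0 complex)" where
  "ebar \<alpha> = Poly_Mapping.single (bar2 \<alpha>) 1"

definition tmult :: "(lat2 \<Rightarrow>\<^sub>0 complex) \<Rightarrow> (lat2 \<Rightarrow>\<^sub>0 complex) \<Rightarrow> (lat2 \<Rightarrow>\<^sub>0 complex)" where
  "tmult u v = psum u (\<lambda>A a. psum v (\<lambda>B b. Poly_Mapping.single (A + B) (a * b * cocyc2 A B)))"

section \<open>The symmetric algebra and the Fock space\<close>

text \<open>
  \<open>S(H\<^sup>-)\<close> is the polynomial algebra in variables \<open>(i, n)\<close>, standing for \<open>\<epsilon>\<^sub>i(n)\<close> with
  \<open>1 \<le> i \<le> \<nu>\<close> and \<open>n\<close> odd negative.  An element of \<open>\<complex>[\<Gamma>/2\<Gamma>] \<otimes> S(H\<^sup>-)\<close> is the family of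
  its coefficients in \<open>S(H\<^sup>-)\<close> with respect to the basis \<open>e\<^sup>A\<close> of the first factor.
\<close>

type_synonym sym = "((nat \<times> int) \<Rightarrow>\<^sub>0 nat) \<Rightarrow>\<^sub>0 complex"
type_synonym fock = "lat2 \<Rightarrow>\<^sub>0 sym"

definition hvar :: "nat \<Rightarrow> int \<Rightarrow> sym" where
  "hvar i n = Poly_Mapping.single (Poly_Mapping.single (i, n) 1) 1"

definition H_minus :: "nat \<Rightarrow> sym set" where
  "H_minus \<nu> = pscale.span {hvar i n |i n. i \<in> {1..\<nu>} \<and> n < 0 \<and> odd n}"

definition H0_minus :: "nat \<Rightarrow> nat \<Rightarrow> sym set" where
  "H0_minus \<nu> N = pscale.span
     ({hvar i m - hvar j m |i j m. i \<in> {1..\<nu>} \<and> j \<in> {1..\<nu>} \<and> i \<noteq> j \<and> m < 0 \<and> odd m}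
      \<union> {hvar i n |i n. i \<in> {1..\<nu>} \<and> n < 0 \<and> odd n \<and> \<not> int N dvd n})"

text \<open>For a subspace \<open>W\<close> of \<open>H\<^sup>-\<close>, the symmetric algebra \<open>S(W)\<close> as a subalgebra of \<open>S(H\<^sup>-)\<close>.\<close>

definition Sym :: "sym set \<Rightarrow> sym set" where
  "Sym W = pscale.span {prod_list ws |ws. set ws \<subseteq> W}"

definition tens :: "(lat2 \<Rightarrow>\<^sub>0 complex) \<Rightarrow> sym \<Rightarrow> fock" where
  "tens u s = Poly_Mapping.map (\<lambda>c. pscale c s) u"

definition tensor_space :: "(lat2 \<Rightarrow>\<^sub>0 complex) set \<Rightarrow> sym set \<Rightarrow> fock set" where
  "tensor_space U W = mscale.span {tens u s |u s. u \<in> U \<and> s \<in> W}"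

definition pd :: "nat \<times> int \<Rightarrow> sym \<Rightarrow> sym" where
  "pd v p = psum p (\<lambda>m c. Poly_Mapping.single (m - Poly_Mapping.single v 1)
                             (of_nat (Poly_Mapping.lookup m v) * c))"

definition heis :: "nat \<Rightarrow> int \<Rightarrow> sym \<Rightarrow> sym" where
  "heis i n p = (if n < 0 then hvar i n * p else pscale (of_int n / 2) (pd (i, - n) p))"

definition heis_lat :: "lat \<Rightarrow> int \<Rightarrow> sym \<Rightarrow> sym" where
  "heis_lat \<alpha> n p = psum \<alpha> (\<lambda>i a. pscale (of_int a) (heis i n p))"

definition left_mult :: "lat \<Rightarrow> fock \<Rightarrow> fock" where
  "left_mult \<alpha> f = psum f (\<lambda>B s. Poly_Mapping.single (bar2 \<alpha> + B) (pscale (cocyc2 (bar2 \<alpha>) B) s))"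

section \<open>Vertex operators\<close>

text \<open>
  \<open>F :: ser\<close> stands for the formal series \<open>\<Sum>\<^sub>n F\<^sub>n z\<^bsup>-n\<^esup>\<close> of operators on \<open>S(H\<^sup>-)\<close> (note the
  sign convention of the exponent).  All sums below are locally finite, that is, finite when
  applied to a fixed vector, which is exactly the condition under which \<open>Sum_any\<close> is the sum.
\<close>

type_synonym ser = "int \<Rightarrow> sym \<Rightarrow> sym"

definition ser_one :: ser where
  "ser_one n v = (if n = 0 then v else 0)"

definition ser_mult :: "ser \<Rightarrow> ser \<Rightarrow> ser" where
  "ser_mult F G n v = Sum_any (\<lambda>s. F (n - s) (G s v))"

fun ser_pow :: "ser \<Rightarrow> nat \<Rightarrow> ser" where
  "ser_pow F 0 = ser_one"
| "ser_pow F (Suc k) = ser_mult F (ser_pow F k)"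

definition ser_exp :: "ser \<Rightarrow> ser" where
  "ser_exp F n v = Sum_any (\<lambda>k. pscale (1 / fact k) (ser_pow F k n v))"

text \<open>\<open>E_minus \<alpha> a\<close> and \<open>E_plus \<alpha> a\<close> are the series \<open>E\<^sub>\<plusminus>(\<alpha>, az)\<close>.\<close>

definition E_minus :: "lat \<Rightarrow> complex \<Rightarrow> ser" where
  "E_minus \<alpha> a = ser_exp (\<lambda>n v. if odd n \<and> n < 0
      then pscale (- 2 / of_int n * a powi (- n)) (heis_lat \<alpha> n v) else 0)"

definition E_plus :: "lat \<Rightarrow> complex \<Rightarrow> ser" where
  "E_plus \<alpha> a = ser_exp (\<lambda>n v. if odd n \<and> n > 0
      then pscale (- 2 / of_int n * a powi (- n)) (heis_lat \<alpha> n v) else 0)"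

definition E_prod :: "nat \<Rightarrow> nat \<Rightarrow> complex \<Rightarrow> ser" where
  "E_prod i j a = ser_mult (ser_mult (E_minus (eps i) 1) (E_minus (- eps j) a))
                           (ser_mult (E_plus (eps i) 1) (E_plus (- eps j) a))"

definition x_op :: "nat \<Rightarrow> nat \<Rightarrow> complex \<Rightarrow> int \<Rightarrow> fock \<Rightarrow> fock" where
  "x_op i j a n f =
    (if i \<noteq> j then
       mscale (cocyc (eps i) (eps j)) (left_mult (eps i - eps j) (Poly_Mapping.map (E_prod i j a n) f))
     else if a = 1 then
       (if odd n then mscale 4 (Poly_Mapping.map (heis i n) f) else 0)
     else
       mscale ((1 + a) / (1 - a)) (Poly_Mapping.map (E_prod i i a n) f - (if n = 0 then f else 0)))"

section \<open>The Lie algebras\<close>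

text \<open>\<open>'g rsig\<close> carries the algebra \<open>R\<^sub>\<sigma>\<close>, the basis element \<open>t\<^sup>m e\<^sup>\<alpha>\<close> being indexed by \<open>(m, \<alpha>)\<close>;
  the matrix with entry \<open>r\<close> at \<open>(i, j)\<close> and 0 elsewhere is \<open>Poly_Mapping.single (i, j) r\<close>.\<close>

type_synonym 'g rsig = "(int \<times> 'g) \<Rightarrow>\<^sub>0 complex"
type_synonym 'g rmat = "(nat \<times> nat) \<Rightarrow>\<^sub>0 'g rsig"

definition character :: "('g::ab_group_add \<Rightarrow> complex) \<Rightarrow> bool" where
  "character \<sigma> \<longleftrightarrow> (\<forall>\<alpha>. \<sigma> \<alpha> \<noteq> 0) \<and> (\<forall>\<alpha> \<beta>. \<sigma> (\<alpha> + \<beta>) = \<sigma> \<alpha> * \<sigma> \<beta>)"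

definition te :: "int \<Rightarrow> 'g \<Rightarrow> 'g rsig" where
  "te m \<alpha> = Poly_Mapping.single (m, \<alpha>) 1"

definition rmult :: "('g::ab_group_add \<Rightarrow> complex) \<Rightarrow> 'g rsig \<Rightarrow> 'g rsig \<Rightarrow> 'g rsig" where
  "rmult \<sigma> x y = psum x (\<lambda>(m, \<alpha>) a. psum y (\<lambda>(n, \<beta>) b.
     Poly_Mapping.single (m + n, \<alpha> + \<beta>) (a * b * \<sigma> \<alpha> powi n)))"

text \<open>The anti-involution: \<open>t\<^sup>m e\<^sup>\<alpha> \<mapsto> e\<^bsup>-\<alpha>\<^esup> (- t)\<^sup>m\<close>.\<close>

definition rbar :: "('g::ab_group_add \<Rightarrow> complex) \<Rightarrow> 'g rsig \<Rightarrow> 'g rsig" where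
  "rbar \<sigma> x = psum x (\<lambda>(m, \<alpha>) a. pscale a (rmult \<sigma> (te 0 (- \<alpha>)) (pscale ((-1) powi m) (te m 0))))"

definition mmult :: "('g::ab_group_add \<Rightarrow> complex) \<Rightarrow> 'g rmat \<Rightarrow> 'g rmat \<Rightarrow> 'g rmat" where
  "mmult \<sigma> X Y = psum X (\<lambda>(i, j) x. psum Y (\<lambda>(k, l) y.
     if j = k then Poly_Mapping.single (i, l) (rmult \<sigma> x y) else 0))"

definition mstar :: "('g::ab_group_add \<Rightarrow> complex) \<Rightarrow> 'g rmat \<Rightarrow> 'g rmat" where
  "mstar \<sigma> X = psum X (\<lambda>(i, j) x. Poly_Mapping.single (j, i) (rbar \<sigma> x))"

definition gl_carrier :: "nat \<Rightarrow> ('g rmat) set" where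
  "gl_carrier \<nu> = {X. Poly_Mapping.keys X \<subseteq> {1..\<nu>} \<times> {1..\<nu>}}"

definition gl_cocycle :: "('g::ab_group_add \<Rightarrow> complex) \<Rightarrow> 'g rmat \<Rightarrow> 'g rmat \<Rightarrow> complex" where
  "gl_cocycle \<sigma> X Y = psum X (\<lambda>(i, j) x. psum Y (\<lambda>(k, l) y. psum x (\<lambda>(m, \<alpha>) a. psum y (\<lambda>(n, \<beta>) b.
     if i = l \<and> j = k \<and> m + n = 0 \<and> \<sigma> \<alpha> * \<sigma> \<beta> = 1
     then a * b * of_int m * \<sigma> \<alpha> powi n else 0))))"

text \<open>\<open>(X, s)\<close> stands for \<open>X + s c\<close>.\<close>

type_synonym 'g ghat = "'g rmat \<times> complex"

definition hscale :: "complex \<Rightarrow> 'g ghat \<Rightarrow> 'g ghat" where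
  "hscale c x = (mscale c (fst x), c * snd x)"

interpretation hscale: vector_space hscale
  by standard (auto simp: hscale_def algebra_simps mscale.scale_right_distrib mscale.scale_left_distrib
      intro!: prod_eqI)

definition hbracket :: "('g::ab_group_add \<Rightarrow> complex) \<Rightarrow> 'g ghat \<Rightarrow> 'g ghat \<Rightarrow> 'g ghat" where
  "hbracket \<sigma> x y = (mmult \<sigma> (fst x) (fst y) - mmult \<sigma> (fst y) (fst x), gl_cocycle \<sigma> (fst x) (fst y))"

definition u_hat :: "nat \<Rightarrow> ('g::ab_group_add \<Rightarrow> complex) \<Rightarrow> 'g ghat set" where
  "u_hat \<nu> \<sigma> = {x. fst x \<in> gl_carrier \<nu> \<and> mstar \<sigma> (fst x) = - fst x}"

definition e_gen :: "('g::ab_group_add \<Rightarrow> complex) \<Rightarrow> nat \<Rightarrow> nat \<Rightarrow> int \<Rightarrow> 'g \<Rightarrow> 'g ghat" where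
  "e_gen \<sigma> i j m \<alpha> =
     (Poly_Mapping.single (i, j) (te m \<alpha>) - Poly_Mapping.single (j, i) (rbar \<sigma> (te m \<alpha>)), 0)"

inductive_set eu_hat :: "nat \<Rightarrow> ('g::ab_group_add \<Rightarrow> complex) \<Rightarrow> 'g ghat set" for \<nu> \<sigma> where
  gen: "i \<in> {1..\<nu>} \<Longrightarrow> j \<in> {1..\<nu>} \<Longrightarrow> i \<noteq> j \<Longrightarrow> e_gen \<sigma> i j m \<alpha> \<in> eu_hat \<nu> \<sigma>"
| zero: "0 \<in> eu_hat \<nu> \<sigma>"
| add: "x \<in> eu_hat \<nu> \<sigma> \<Longrightarrow> y \<in> eu_hat \<nu> \<sigma> \<Longrightarrow> x + y \<in> eu_hat \<nu> \<sigma>"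
| scale: "x \<in> eu_hat \<nu> \<sigma> \<Longrightarrow> hscale c x \<in> eu_hat \<nu> \<sigma>"
| bracket: "x \<in> eu_hat \<nu> \<sigma> \<Longrightarrow> y \<in> eu_hat \<nu> \<sigma> \<Longrightarrow> hbracket \<sigma> x y \<in> eu_hat \<nu> \<sigma>"

text \<open>
  The operator of \<open>e\<^sub>i\<^sub>j(m,\<alpha>)\<close> on the Fock space.  An element \<open>X = \<Sum> x E\<^sub>i\<^sub>j t\<^sup>m e\<^sup>\<alpha>\<close> of \<open>u\<^sub>\<nu>\<close>
  satisfies \<open>X = (X - X\<^sup>*) / 2 = 1/2 \<Sum> x e\<^sub>i\<^sub>j(m,\<alpha>)\<close>; this is how the action of \<open>e\<^sub>i\<^sub>j(m,\<alpha>)\<close> is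
  extended linearly.  The \<open>e\<^sub>i\<^sub>j(m,\<alpha>)\<close> are not linearly independent; lemma \<open>u_act_e_gen\<close> below
  confirms that \<open>e\<^sub>i\<^sub>j(m,\<alpha>)\<close> does act by \<open>e_op\<close>.
\<close>

definition e_op :: "('g::ab_group_add \<Rightarrow> complex) \<Rightarrow> nat \<Rightarrow> nat \<Rightarrow> int \<Rightarrow> 'g \<Rightarrow> fock \<Rightarrow> fock" where
  "e_op \<sigma> i j m \<alpha> f = mscale (1/2) (x_op i j (\<sigma> \<alpha>) m f
     + (if m = 0 \<and> i = j \<and> \<sigma> \<alpha> \<noteq> 1 then mscale ((1 + \<sigma> \<alpha>) / (1 - \<sigma> \<alpha>)) f else 0))"

definition u_act :: "('g::ab_group_add \<Rightarrow> complex) \<Rightarrow> 'g ghat \<Rightarrow> fock \<Rightarrow> fock" where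
  "u_act \<sigma> x f =
     psum (fst x) (\<lambda>(i, j) r. psum r (\<lambda>(m, \<alpha>) a. mscale (a / 2) (e_op \<sigma> i j m \<alpha> f)))
     + mscale (snd x / 2) f"

section \<open>Submodules of the Fock space\<close>

definition submod :: "'x set \<Rightarrow> ('x \<Rightarrow> fock \<Rightarrow> fock) \<Rightarrow> fock set \<Rightarrow> bool" where
  "submod L act W \<longleftrightarrow> mscale.subspace W \<and> (\<forall>x\<in>L. \<forall>v\<in>W. act x v \<in> W)"

definition irreducible_mod :: "'x set \<Rightarrow> ('x \<Rightarrow> fock \<Rightarrow> fock) \<Rightarrow> fock set \<Rightarrow> bool" where
  "irreducible_mod L act W \<longleftrightarrow> submod L act W \<and> W \<noteq> {0} \<and>
     (\<forall>U. submod L act U \<and> U \<subseteq> W \<longrightarrow> U = {0} \<or> U = W)"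

text \<open>Complete reducibility: \<open>W\<close> is the direct sum of a family of irreducible submodules.\<close>

definition completely_reducible_mod :: "'x set \<Rightarrow> ('x \<Rightarrow> fock \<Rightarrow> fock) \<Rightarrow> fock set \<Rightarrow> bool" where
  "completely_reducible_mod L act W \<longleftrightarrow> submod L act W \<and>
     (\<exists>F. (\<forall>U\<in>F. irreducible_mod L act U) \<and> W = mscale.span (\<Union>F) \<and>
          (\<forall>U\<in>F. U \<inter> mscale.span (\<Union>(F - {U})) = {0}))"

section \<open>The spaces \<open>V\<^sub>\<nu>(\<gamma>)\<close>\<close>

definition w_factor :: "nat \<Rightarrow> int \<Rightarrow> (lat2 \<Rightarrow>\<^sub>0 complex)" where
  "w_factor j r = ebar 0 + pscale ((if odd j then \<i> else 1) * of_int r) (ebar (eps j))"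

fun w_prod :: "(nat \<Rightarrow> int) \<Rightarrow> nat \<Rightarrow> (lat2 \<Rightarrow>\<^sub>0 complex)" where
  "w_prod \<rho> 0 = ebar 0"
| "w_prod \<rho> (Suc k) = tmult (w_prod \<rho> k) (w_factor (Suc k) (\<rho> (Suc k)))"

definition admissible :: "nat \<Rightarrow> (nat \<Rightarrow> int) \<Rightarrow> (nat \<Rightarrow> int) \<Rightarrow> bool" where
  "admissible \<nu> \<gamma> \<rho> \<longleftrightarrow> (\<forall>i\<in>{1..\<nu>}. \<rho> i \<in> {1, -1}) \<and> \<rho> 1 = \<gamma> 1 \<and>
     (if odd \<nu> then \<forall>j\<in>{1..\<nu> div 2}. \<rho> (2*j) * \<rho> (2*j+1) = \<gamma> (j+1)
      else (\<forall>j\<in>{1..<\<nu> div 2}. \<rho> (2*j) * \<rho> (2*j+1) = \<gamma> (j+1)) \<and> \<rho> \<nu> = \<gamma> (\<nu> div 2 + 1))"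

definition V_space :: "nat \<Rightarrow> (nat \<Rightarrow> int) \<Rightarrow> (lat2 \<Rightarrow>\<^sub>0 complex) set" where
  "V_space \<nu> \<gamma> = pscale.span {w_prod \<rho> \<nu> |\<rho>. admissible \<nu> \<gamma> \<rho>}"

section \<open>Consistency of the definitions\<close>

text \<open>
  \<open>cocyc\<close> is bimultiplicative, \<open>pd\<close> is the partial derivative, \<open>hbracket\<close> is given by the
  usual formula on basis elements, \<open>u_act\<close> sends \<open>e_gen\<close> to \<open>e_op\<close>, and \<open>eu_hat\<close> lies in the Lie
  algebra \<open>u_hat\<close>.
\<close>


lemma pm_induct [case_names single add]:
  fixes x :: "'k \<Rightarrow>\<^sub>0 'a::comm_monoid_add"
  assumes s: "\<And>k a. P (Poly_Mapping.single k a)" and a: "\<And>x y. P x \<Longrightarrow> P y \<Longrightarrow> P (x + y)"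
  shows "P x"
proof -
  have "P (\<Sum>k\<in>A. Poly_Mapping.single k (Poly_Mapping.lookup x k))" if "finite A" for A
    using that
  proof (induction A)
    case empty
    show ?case using s[of undefined 0] by simp
  next
    case (insert k A)
    then show ?case by (simp add: a s)
  qed
  moreover have "x = (\<Sum>k\<in>Poly_Mapping.keys x. Poly_Mapping.single k (Poly_Mapping.lookup x k))"
    by (rule poly_mapping_eqI)
      (auto simp: lookup_sum lookup_single when_def in_keys_iff sum.delta')
  ultimately show ?thesis by (metis finite_keys)
qed

lemma pscale_single [simp]: "pscale c (Poly_Mapping.single k a) = Poly_Mapping.single k (c * a)"
  by (simp add: pscale_def)

lemma mscale_single [simp]: "mscale c (Poly_Mapping.single k a) = Poly_Mapping.single k (pscale c a)"
  by (simp add: mscale_def)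

lemma psum_zero [simp]: "psum 0 F = 0"
  by (simp add: psum_def)

lemma psum_fun_add: "psum x (\<lambda>k a. F k a + G k a) = psum x F + psum x G"
  by (simp add: psum_def sum.distrib)

lemma psum_pscale:
  assumes "\<And>k. F k 0 = 0" "\<And>k a. F k (c * a) = T (F k a)" "T 0 = 0" "\<And>x y. T (x + y) = T x + T y"
  shows "psum (pscale c x) F = T (psum x F)"
proof (induction x rule: pm_induct)
  case (single k a)
  then show ?case by (simp add: psum_single assms)
next
  case (add x y)
  have sub: "psum (pscale c z) F = T (psum z F)" for z
  proof -
    have "psum (pscale c z) F = (\<Sum>k\<in>Poly_Mapping.keys z. F k (c * Poly_Mapping.lookup z k))"
      by (subst psum_superset[of "Poly_Mapping.keys z"]) (auto simp: assms in_keys_iff)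
    also have "\<dots> = T (psum z F)"
      unfolding psum_def assms(2)
      using assms(3,4) by (metis (mono_tags, lifting) sum.cong sum_comp_morphism comp_apply)
    finally show ?thesis .
  qed
  show ?case by (rule sub)
qed

lemma lookup_pd: "Poly_Mapping.lookup (pd v p) m =
    of_nat (Poly_Mapping.lookup m v + 1) * Poly_Mapping.lookup p (m + Poly_Mapping.single v 1)"
proof (induction p rule: pm_induct)
  case (single k a)
  have eq: "k - Poly_Mapping.single v 1 = m \<longleftrightarrow> k = m + Poly_Mapping.single v 1"
    if "Poly_Mapping.lookup k v \<noteq> 0"
  proof
    assume h: "k - Poly_Mapping.single v 1 = m"
    show "k = m + Poly_Mapping.single v 1"
      by (rule poly_mapping_eqI) (use that in \<open>auto simp: h[symmetric] lookup_add lookup_minus lookup_single when_def\<close>)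
  qed simp
  show ?case
  proof (cases "Poly_Mapping.lookup k v = 0")
    case True
    then have "k \<noteq> m + Poly_Mapping.single v 1" by (auto simp: lookup_add)
    then show ?thesis using True by (simp add: pd_def psum_single lookup_single)
  next
    case False
    then show ?thesis using eq by (auto simp: pd_def psum_single lookup_single when_def lookup_add)
  qed
next
  case (add x y)
  have "pd v (x + y) = pd v x + pd v y"
    unfolding pd_def by (rule psum_add) (auto simp: single_add[symmetric] algebra_simps)
  then show ?case using add by (simp add: lookup_add algebra_simps)
qed

lemma pd_add: "pd v (x + y) = pd v x + pd v y"
  by (rule poly_mapping_eqI) (simp add: lookup_pd lookup_add algebra_simps)

lemma pd_pscale: "pd v (pscale c x) = pscale c (pd v x)"
  by (rule poly_mapping_eqI) (simp add: lookup_pd algebra_simps)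

lemma pd_commute: "pd v (pd w p) = pd w (pd v p)"
  by (cases "v = w")
    (auto intro!: poly_mapping_eqI simp: lookup_pd lookup_add lookup_single algebra_simps)

definition lin :: "(sym \<Rightarrow> sym) \<Rightarrow> bool" where
  "lin T \<longleftrightarrow> (\<forall>x y. T (x + y) = T x + T y) \<and> (\<forall>c x. T (pscale c x) = pscale c (T x))"

lemma lin_zero: "lin T \<Longrightarrow> T 0 = 0"
  unfolding lin_def by (metis pscale.scale_zero_left)

lemma pscale_mult: "pscale c (x * y) = x * pscale c (y :: sym)" "pscale c x * y = pscale c (x * y)"
  by (simp_all add: pscale_def mult_map_scale_conv_mult algebra_simps)

lemma heis_lin: "lin (heis i n)"
  by (auto simp: lin_def heis_def distrib_left pscale_mult(1) pd_add pd_pscale pscale.scale_right_distrib mult.commute[of c for c :: complex])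

lemma lin_psum:
  assumes "\<And>k a. lin (F k a)"
  shows "lin (\<lambda>p. psum x (\<lambda>k a. F k a p))"
  using assms by (auto simp: lin_def psum_def sum.distrib pscale.scale_sum_right)

lemma lin_pscale: "lin T \<Longrightarrow> lin (\<lambda>p. pscale c (T p))"
  by (auto simp: lin_def pscale.scale_right_distrib mult.commute)

lemma heis_lat_lin: "lin (heis_lat \<alpha> n)"
  unfolding heis_lat_def by (intro lin_psum lin_pscale heis_lin)

lemma heis_commute:
  assumes "n < 0 \<and> m < 0 \<or> n > 0 \<and> m > 0"
  shows "heis i n (heis j m p) = heis j m (heis i n p)"
  using assms by (auto simp: heis_def pd_pscale pd_commute mult.commute mult.left_commute)

definition ccomm :: "(sym \<Rightarrow> sym) \<Rightarrow> (sym \<Rightarrow> sym) \<Rightarrow> bool" where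
  "ccomm S T \<longleftrightarrow> (\<forall>p. S (T p) = T (S p))"

lemma ccomm_psum:
  assumes "lin S" "\<And>k a. ccomm S (F k a)"
  shows "ccomm S (\<lambda>p. psum x (\<lambda>k a. F k a p))"
proof -
  have "S (sum g A) = (\<Sum>a\<in>A. S (g a))" for g and A :: "'a set"
    using assms(1) lin_zero[OF assms(1)] unfolding lin_def
    by (metis (mono_tags, lifting) sum.cong sum_comp_morphism comp_apply)
  then show ?thesis using assms(2) by (simp add: ccomm_def psum_def)
qed

lemma ccomm_pscale: "lin S \<Longrightarrow> ccomm S T \<Longrightarrow> ccomm S (\<lambda>p. pscale c (T p))"
  by (simp add: ccomm_def lin_def)

lemma ccomm_sym: "ccomm S T \<Longrightarrow> ccomm T S"
  by (simp add: ccomm_def)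

lemma heis_lat_commute:
  assumes "n < 0 \<and> m < 0 \<or> n > 0 \<and> m > 0"
  shows "ccomm (heis_lat \<alpha> n) (heis_lat \<beta> m)"
proof -
  have 1: "ccomm (heis i n) (heis_lat \<beta> m)" for i
    unfolding heis_lat_def
    by (intro ccomm_psum ccomm_pscale heis_lin) (use assms in \<open>auto simp: ccomm_def intro: heis_commute\<close>)
  show ?thesis
    unfolding heis_lat_def[of \<alpha>]
    by (rule ccomm_sym, intro ccomm_psum ccomm_pscale heis_lat_lin ccomm_sym[OF 1])
qed

lemma lin_Sum_any:
  assumes "lin T" "finite {s. g s \<noteq> 0}"
  shows "T (Sum_any g) = Sum_any (\<lambda>s. T (g s))"
proof -
  have "T (sum g A) = (\<Sum>a\<in>A. T (g a))" for A
    using assms(1) lin_zero[OF assms(1)] unfolding lin_def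
    by (metis (mono_tags, lifting) sum.cong sum_comp_morphism comp_apply)
  moreover have "{s. T (g s) \<noteq> 0} \<subseteq> {s. g s \<noteq> 0}" using lin_zero[OF assms(1)] by auto
  ultimately show ?thesis
    by (subst Sum_any.expand_set, subst Sum_any.expand_superset[OF assms(2)]) auto
qed

lemma pscale_lin: "lin (pscale c)"
  by (auto simp: lin_def pscale.scale_right_distrib mult.commute)

lemma Sum_any_pscale:
  fixes g :: "'a \<Rightarrow> sym"
  assumes "c \<noteq> 0"
  shows "Sum_any (\<lambda>s. pscale c (g s)) = pscale c (Sum_any g)"
proof (cases "finite {s. g s \<noteq> 0}")
  case True
  then show ?thesis using lin_Sum_any[OF pscale_lin, of g c] by simp
next
  case False
  have "{s. pscale c (g s) \<noteq> 0} = {s. g s \<noteq> 0}" using assms by simp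
  with False show ?thesis by (metis Sum_any.infinite pscale_zero)
qed

text \<open>Series whose nonzero coefficients have exponents of one strict sign \<open>e\<close>.\<close>

definition onesided :: "int \<Rightarrow> ser \<Rightarrow> bool" where
  "onesided e A \<longleftrightarrow> e \<in> {1, -1} \<and> (\<forall>n v. A n v \<noteq> 0 \<longrightarrow> e * n > 0) \<and> (\<forall>n. lin (A n))"

lemma lin_sum:
  assumes "\<And>s. lin (g s)" "\<And>v. finite {s. g s v \<noteq> 0}"
  shows "lin (\<lambda>v. Sum_any (\<lambda>s. g s v))"
proof -
  have "Sum_any (\<lambda>s. g s (x + y)) = Sum_any (\<lambda>s. g s x) + Sum_any (\<lambda>s. g s y)" for x y
    using assms by (subst Sum_any.distrib[symmetric]) (auto simp: lin_def)
  moreover have "Sum_any (\<lambda>s. g s (pscale c x)) = pscale c (Sum_any (\<lambda>s. g s x))" for c x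
    using assms lin_Sum_any[OF pscale_lin assms(2)] by (simp add: lin_def)
  ultimately show ?thesis by (simp add: lin_def)
qed

lemma ccomm_sum:
  assumes "lin T" "\<And>s. ccomm T (g s)" "\<And>v. finite {s. g s v \<noteq> 0}"
  shows "ccomm T (\<lambda>v. Sum_any (\<lambda>s. g s v))"
  using assms by (simp add: ccomm_def lin_Sum_any)

lemma lin_comp: "lin S \<Longrightarrow> lin T \<Longrightarrow> lin (\<lambda>v. S (T v))"
  by (simp add: lin_def)

lemma ccomm_comp: "ccomm T S \<Longrightarrow> ccomm T R \<Longrightarrow> ccomm T (\<lambda>v. S (R v))"
  by (simp add: ccomm_def)

lemma
  assumes A: "onesided e A"
  shows ser_pow_supp: "ser_pow A k n v \<noteq> 0 \<Longrightarrow> e * n \<ge> int k"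
    and ser_pow_lin: "lin (ser_pow A k n)"
    and ser_pow_fin: "finite {s. A (n - s) (ser_pow A k s v) \<noteq> 0}"
proof -
  have e: "e = 1 \<or> e = -1" using A by (auto simp: onesided_def)
  have A0: "A r 0 = 0" for r using A lin_zero by (auto simp: onesided_def)
  have fin: "finite {s. A (n - s) (ser_pow A k s v) \<noteq> 0}"
    if "\<And>n v. ser_pow A k n v \<noteq> 0 \<Longrightarrow> e * n \<ge> int k" for k n v
  proof (rule finite_subset)
    show "{s. A (n - s) (ser_pow A k s v) \<noteq> 0} \<subseteq> {- \<bar>n\<bar> .. \<bar>n\<bar>}"
    proof
      fix s assume s: "s \<in> {s. A (n - s) (ser_pow A k s v) \<noteq> 0}"
      then have "ser_pow A k s v \<noteq> 0" using A0 by auto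
      then have "e * s \<ge> int k" by (rule that)
      moreover have "e * (n - s) > 0" using s A by (auto simp: onesided_def)
      ultimately show "s \<in> {- \<bar>n\<bar> .. \<bar>n\<bar>}" using e by auto
    qed
  qed simp
  have main: "(\<forall>n v. ser_pow A k n v \<noteq> 0 \<longrightarrow> e * n \<ge> int k) \<and> (\<forall>n. lin (ser_pow A k n))" for k
  proof (induction k)
    case 0
    then show ?case by (auto simp: ser_one_def lin_def)
  next
    case (Suc k)
    have "e * n \<ge> int (Suc k)" if h: "ser_pow A (Suc k) n v \<noteq> 0" for n v
    proof -
      obtain s where s: "A (n - s) (ser_pow A k s v) \<noteq> 0"
        using h Sum_any.not_neutral_obtains_not_neutral by (auto simp: ser_mult_def)
      then have "ser_pow A k s v \<noteq> 0" using A0 by auto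
      then have "e * s \<ge> int k" using Suc by blast
      moreover have "e * (n - s) > 0" using s A by (auto simp: onesided_def)
      ultimately show ?thesis using e by auto
    qed
    moreover have "lin (ser_pow A (Suc k) n)" for n
    proof -
      have "lin (\<lambda>v. Sum_any (\<lambda>s. A (n - s) (ser_pow A k s v)))"
      proof (rule lin_sum)
        show "lin (\<lambda>v. A (n - s) (ser_pow A k s v))" for s
          by (rule lin_comp[of "A (n - s)"]) (use A Suc in \<open>auto simp: onesided_def\<close>)
        show "finite {s. A (n - s) (ser_pow A k s v) \<noteq> 0}" for v
          by (rule fin) (use Suc in blast)
      qed
      moreover have "ser_pow A (Suc k) n = (\<lambda>v. Sum_any (\<lambda>s. A (n - s) (ser_pow A k s v)))"
        by (simp add: ser_mult_def fun_eq_iff)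
      ultimately show ?thesis by metis
    qed
    ultimately show ?case by blast
  qed
  show "ser_pow A k n v \<noteq> 0 \<Longrightarrow> e * n \<ge> int k" using main by blast
  show "lin (ser_pow A k n)" using main by blast
  show "finite {s. A (n - s) (ser_pow A k s v) \<noteq> 0}" using main fin by blast
qed

lemma ser_exp_fin:
  assumes A: "onesided e A"
  shows "finite {k. pscale (1 / fact k) (ser_pow A k n v) \<noteq> 0}"
proof (rule finite_subset)
  show "{k. pscale (1 / fact k) (ser_pow A k n v) \<noteq> 0} \<subseteq> {.. nat \<bar>n\<bar>}"
  proof
    fix k assume "k \<in> {k. pscale (1 / fact k) (ser_pow A k n v) \<noteq> 0}"
    then have "ser_pow A k n v \<noteq> 0" by auto
    then have "e * n \<ge> int k" using ser_pow_supp[OF A] by blast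
    then show "k \<in> {.. nat \<bar>n\<bar>}" using A by (auto simp: onesided_def)
  qed
qed simp

lemma ser_exp_lin:
  assumes A: "onesided e A"
  shows "lin (ser_exp A n)"
proof -
  have "lin (\<lambda>v. Sum_any (\<lambda>k. pscale (1 / fact k) (ser_pow A k n v)))"
    by (intro lin_sum lin_pscale ser_pow_lin[OF A] ser_exp_fin[OF A])
  moreover have "ser_exp A n = (\<lambda>v. Sum_any (\<lambda>k. pscale (1 / fact k) (ser_pow A k n v)))"
    by (simp add: ser_exp_def fun_eq_iff)
  ultimately show ?thesis by metis
qed

lemma ser_exp_ccomm:
  assumes A: "onesided e A" and T: "lin T" "\<And>n. ccomm T (A n)"
  shows "ccomm T (ser_exp A n)"
proof -
  have pw: "ccomm T (ser_pow A k n)" for k n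
  proof (induction k arbitrary: n)
    case 0
    then show ?case using lin_zero[OF T(1)] by (simp add: ccomm_def ser_one_def)
  next
    case (Suc k)
    have "ccomm T (\<lambda>v. Sum_any (\<lambda>s. A (n - s) (ser_pow A k s v)))"
      by (rule ccomm_sum[OF T(1) _ ser_pow_fin[OF A]], rule ccomm_comp[OF T(2) Suc])
    moreover have "ser_pow A (Suc k) n = (\<lambda>v. Sum_any (\<lambda>s. A (n - s) (ser_pow A k s v)))"
      by (simp add: ser_mult_def fun_eq_iff)
    ultimately show ?case by metis
  qed
  have "ccomm T (\<lambda>v. Sum_any (\<lambda>k. pscale (1 / fact k) (ser_pow A k n v)))"
    by (intro ccomm_sum ccomm_pscale T pw ser_exp_fin[OF A])
  moreover have "ser_exp A n = (\<lambda>v. Sum_any (\<lambda>k. pscale (1 / fact k) (ser_pow A k n v)))"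
    by (simp add: ser_exp_def fun_eq_iff)
  ultimately show ?thesis by metis
qed

definition rescale :: "complex \<Rightarrow> ser \<Rightarrow> ser" where
  "rescale b F n v = pscale (b powi n) (F n v)"

lemma rescale_mult:
  assumes "b \<noteq> 0" "\<And>n. lin (F n)"
  shows "ser_mult (rescale b F) (rescale b G) = rescale b (ser_mult F G)"
proof (intro ext)
  fix n v
  have "rescale b F (n - s) (rescale b G s v) = pscale (b powi n) (F (n - s) (G s v))" for s
    using assms(2) by (simp add: rescale_def lin_def power_int_add[symmetric] assms(1))
  then show "ser_mult (rescale b F) (rescale b G) n v = rescale b (ser_mult F G) n v"
    using assms(1) by (simp add: ser_mult_def rescale_def Sum_any_pscale)
qed

lemma rescale_exp:
  assumes "b \<noteq> 0" "onesided e A"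
  shows "ser_exp (rescale b A) = rescale b (ser_exp A)"
proof -
  have pw: "ser_pow (rescale b A) k = rescale b (ser_pow A k)" for k
  proof (induction k)
    case 0
    then show ?case by (auto simp: rescale_def ser_one_def fun_eq_iff)
  next
    case (Suc k)
    then show ?case using rescale_mult[OF assms(1), of A] assms(2) by (simp add: onesided_def)
  qed
  show ?thesis
    using assms(1)
    by (auto simp: fun_eq_iff ser_exp_def pw rescale_def Sum_any_pscale[symmetric] mult.commute)
qed

definition expo :: "int \<Rightarrow> lat \<Rightarrow> complex \<Rightarrow> ser" where
  "expo e \<alpha> a n v = (if odd n \<and> e * n > 0
      then pscale (- 2 / of_int n * a powi (- n)) (heis_lat \<alpha> n v) else 0)"

lemma E_minus_expo: "E_minus \<alpha> a = ser_exp (expo (-1) \<alpha> a)"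
  by (simp add: E_minus_def expo_def[abs_def])

lemma E_plus_expo: "E_plus \<alpha> a = ser_exp (expo 1 \<alpha> a)"
  by (simp add: E_plus_def expo_def[abs_def])

lemma lin_0: "lin (\<lambda>v. 0)"
  by (simp add: lin_def)

lemma expo_alt: "expo e \<alpha> a n = (\<lambda>v. pscale (if odd n \<and> e * n > 0 then - 2 / of_int n * a powi (- n) else 0) (heis_lat \<alpha> n v))"
  by (auto simp: fun_eq_iff expo_def)

lemma expo_lin: "lin (expo e \<alpha> a n)"
  unfolding expo_alt by (intro lin_pscale heis_lat_lin)

lemma expo_onesided: "e \<in> {1, -1} \<Longrightarrow> onesided e (expo e \<alpha> a)"
  unfolding onesided_def
  by (intro conjI allI impI expo_lin) (auto simp: expo_def split: if_splits)

lemma expo_ccomm: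
  assumes "e \<in> {1, -1}"
  shows "ccomm (expo e \<alpha> a n) (expo e \<beta> b m)"
proof (cases "e * n > 0 \<and> e * m > 0")
  case True
  then have *: "ccomm (heis_lat \<alpha> n) (heis_lat \<beta> m)"
    by (intro heis_lat_commute) (use assms in auto)
  show ?thesis
    unfolding expo_alt
    by (rule ccomm_sym, rule ccomm_pscale, fold expo_alt, rule expo_lin, unfold expo_alt,
        rule ccomm_sym, rule ccomm_pscale[OF heis_lat_lin *])
next
  case False
  then have "expo e \<alpha> a n = (\<lambda>v. 0) \<or> expo e \<beta> b m = (\<lambda>v. 0)"
    by (auto simp: expo_def fun_eq_iff)
  then show ?thesis
    using lin_zero[OF expo_lin] by (auto simp: ccomm_def)
qed

lemma ser_mult_commute:
  assumes "\<And>r s. ccomm (F r) (G s)"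
  shows "ser_mult F G = ser_mult G F"
proof (intro ext)
  fix n v
  have "Sum_any (\<lambda>s. F (n - s) (G s v)) = Sum_any (\<lambda>s. G (n - s) (F s v))"
  proof (rule Sum_any.reindex_cong[of "\<lambda>s. n - s"])
    show "bij (\<lambda>s. n - s)" by (rule bij_betw_byWitness[of _ "\<lambda>s. n - s"]) auto
    show "(\<lambda>s. F (n - s) (G s v)) \<circ> (\<lambda>s. n - s) = (\<lambda>s. G (n - s) (F s v))"
      using assms by (auto simp: fun_eq_iff ccomm_def)
  qed
  then show "ser_mult F G n v = ser_mult G F n v" by (simp add: ser_mult_def)
qed

lemma exp_expo_commute:
  assumes "e \<in> {1, -1}"
  shows "ser_mult (ser_exp (expo e \<alpha> a)) (ser_exp (expo e \<beta> b))
    = ser_mult (ser_exp (expo e \<beta> b)) (ser_exp (expo e \<alpha> a))"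
proof (rule ser_mult_commute)
  note o = expo_onesided[OF assms]
  fix r s
  have *: "ccomm (expo e \<alpha> a m) (ser_exp (expo e \<beta> b) s)" for m
    by (rule ser_exp_ccomm[OF o]) (intro expo_lin expo_ccomm[OF assms])+
  show "ccomm (ser_exp (expo e \<alpha> a) r) (ser_exp (expo e \<beta> b) s)"
    by (rule ccomm_sym[OF ser_exp_ccomm[OF o ser_exp_lin[OF o] ccomm_sym[OF *]]])
qed

lemma heis_lat_uminus: "heis_lat (- \<alpha>) n v = - heis_lat \<alpha> n v"
  by (simp add: heis_lat_def psum_def sum_negf keys_minus pscale.scale_minus_left)

lemma expo_flip: "a \<noteq> 0 \<Longrightarrow> expo e (- \<alpha>) b = rescale a (expo e \<alpha> (- (a * b)))"
  by (auto simp: fun_eq_iff expo_def rescale_def heis_lat_uminus power_int_mult_distrib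
      power_int_minus_left_odd power_int_minus field_simps)

lemma exp_flip:
  assumes "a \<noteq> 0" "e \<in> {1, -1}"
  shows "ser_exp (expo e (- \<alpha>) b) = rescale a (ser_exp (expo e \<alpha> (- (a * b))))"
  using rescale_exp[OF assms(1) expo_onesided[OF assms(2)]] by (simp add: expo_flip[OF assms(1)])

lemma E_prod_flip:
  assumes "a \<noteq> 0"
  shows "E_prod i j a = rescale (- (1 / a)) (E_prod j i (1 / a))"
proof -
  let ?b = "- (1 / a)"
  have b: "?b \<noteq> 0" using assms by simp
  have F: "ser_exp (expo e (eps i) 1) = rescale ?b (ser_exp (expo e (- eps i) (1 / a)))"
    if "e \<in> {1, -1}" for e
    using exp_flip[OF b that, of "- eps i" 1] by simp
  have G: "ser_exp (expo e (- eps j) a) = rescale ?b (ser_exp (expo e (eps j) 1))"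
    if "e \<in> {1, -1}" for e
    using exp_flip[OF b that, of "eps j" a] assms by simp
  have half: "ser_mult (ser_exp (expo e (eps i) 1)) (ser_exp (expo e (- eps j) a))
     = rescale ?b (ser_mult (ser_exp (expo e (eps j) 1)) (ser_exp (expo e (- eps i) (1 / a))))"
    if e: "e \<in> {1, -1}" for e
    unfolding F[OF e] G[OF e]
    by (subst rescale_mult[OF b]) (auto intro: ser_exp_lin[OF expo_onesided[OF e]] simp: exp_expo_commute[OF e])
  have L: "lin (ser_mult (ser_exp (expo (-1) \<alpha> c)) (ser_exp (expo (-1) \<beta> d)) n)" for \<alpha> \<beta> c d n
  proof -
    note o = expo_onesided[of "-1", simplified]
    have supp: "ser_exp (expo (-1) \<gamma> x) m v \<noteq> 0 \<Longrightarrow> m \<le> 0" for \<gamma> x m v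
    proof -
      assume "ser_exp (expo (-1) \<gamma> x) m v \<noteq> 0"
      then obtain k where "pscale (1 / fact k) (ser_pow (expo (-1) \<gamma> x) k m v) \<noteq> 0"
        using Sum_any.not_neutral_obtains_not_neutral unfolding ser_exp_def by blast
      then show "m \<le> 0" using ser_pow_supp[OF o, of \<gamma> x k m v] by auto
    qed
    have "finite {s. ser_exp (expo (-1) \<alpha> c) (n - s) (ser_exp (expo (-1) \<beta> d) s v) \<noteq> 0}" for v
    proof (rule finite_subset)
      show "{s. ser_exp (expo (-1) \<alpha> c) (n - s) (ser_exp (expo (-1) \<beta> d) s v) \<noteq> 0} \<subseteq> {n .. 0}"
      proof
        fix s assume s: "s \<in> {s. ser_exp (expo (-1) \<alpha> c) (n - s) (ser_exp (expo (-1) \<beta> d) s v) \<noteq> 0}"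
        then have "ser_exp (expo (-1) \<beta> d) s v \<noteq> 0" using lin_zero[OF ser_exp_lin[OF o]] by auto
        with s supp show "s \<in> {n..0}" by force
      qed
    qed simp
    then have "lin (\<lambda>v. Sum_any (\<lambda>s. ser_exp (expo (-1) \<alpha> c) (n - s) (ser_exp (expo (-1) \<beta> d) s v)))"
      by (intro lin_sum lin_comp[OF ser_exp_lin[OF o] ser_exp_lin[OF o]])
    then show ?thesis unfolding ser_mult_def[abs_def] .
  qed
  show ?thesis
    unfolding E_prod_def E_minus_expo E_plus_expo
    using half[of "-1"] half[of 1] rescale_mult[OF b L] by simp
qed

lemma map_scale:
  assumes "\<And>v. F v = pscale c (G v)" "G 0 = 0"
  shows "Poly_Mapping.map F f = mscale c (Poly_Mapping.map G (f :: fock))"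
  using assms by (auto intro!: poly_mapping_eqI simp: Poly_Mapping.map.rep_eq when_def)

lemma lookup_left_mult: "Poly_Mapping.lookup (left_mult \<alpha> f) B
    = pscale (cocyc2 (bar2 \<alpha>) (B - bar2 \<alpha>)) (Poly_Mapping.lookup f (B - bar2 \<alpha>))"
proof (induction f rule: pm_induct)
  case (single k a)
  have "bar2 \<alpha> + k = B \<longleftrightarrow> k = B - bar2 \<alpha>" by (auto simp: algebra_simps)
  then show ?case by (auto simp: left_mult_def psum_single lookup_single when_def)
next
  case (add x y)
  have "left_mult \<alpha> (x + y) = left_mult \<alpha> x + left_mult \<alpha> y"
    unfolding left_mult_def by (rule psum_add) (auto simp: single_add[symmetric] pscale.scale_right_distrib)
  then show ?case using add by (simp add: lookup_add pscale.scale_right_distrib)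
qed

lemma left_mult_mscale: "left_mult \<alpha> (mscale c f) = mscale c (left_mult \<alpha> f)"
  by (rule poly_mapping_eqI) (simp add: lookup_left_mult mult.commute)

lemma bar2_swap: "bar2 (eps i - eps j) = bar2 (eps j - eps i)"
proof -
  have "of_int (- x) = (of_int x :: bit)" for x :: int by simp
  moreover have "eps j - eps i = - (eps i - eps j)" by simp
  ultimately show ?thesis
    unfolding bar2_def
    by (intro poly_mapping_eqI) (auto simp: Poly_Mapping.map.rep_eq when_def lookup_minus)
qed

lemma left_mult_swap: "left_mult (eps i - eps j) = left_mult (eps j - eps i)"
  by (simp add: fun_eq_iff left_mult_def bar2_swap[of i j])

lemma cocyc_eps: "cocyc (eps i) (eps j) = (if i > j then -1 else 1)"
  by (simp add: cocyc_def eps_def psum_single)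

lemma cocyc_eps_swap: "i \<noteq> j \<Longrightarrow> cocyc (eps i) (eps j) = - cocyc (eps j) (eps i)"
  by (auto simp: cocyc_eps)

lemma ser_mult_zero: "(\<And>n. F n 0 = 0) \<Longrightarrow> (\<And>n. G n 0 = 0) \<Longrightarrow> ser_mult F G n 0 = 0"
  by (simp add: ser_mult_def)

lemma E_prod_zero: "E_prod i j a n 0 = 0"
  unfolding E_prod_def E_minus_expo E_plus_expo
  by (intro ser_mult_zero lin_zero[OF ser_exp_lin[OF expo_onesided[of 1]]]
      lin_zero[OF ser_exp_lin[OF expo_onesided[of "-1"]]]) auto

lemma e_op_flip:
  assumes "character \<sigma>"
  shows "e_op \<sigma> j i m (- \<alpha>) f = mscale (- ((- \<sigma> \<alpha>) powi m)) (e_op \<sigma> i j m \<alpha> f)"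
proof -
  define a where "a = \<sigma> \<alpha>"
  have a: "a \<noteq> 0" using assms by (simp add: a_def character_def)
  have "\<sigma> 0 * \<sigma> 0 = \<sigma> 0" "\<sigma> 0 \<noteq> 0" using assms by (metis add.right_neutral character_def)+
  then have "\<sigma> 0 = 1" by simp
  then have inv: "\<sigma> (- \<alpha>) = 1 / a"
    using assms a unfolding character_def a_def by (metis add.right_inverse nonzero_mult_div_cancel_left)
  have E: "E_prod j i (1 / a) n v = pscale ((- a) powi n) (E_prod i j a n v)" for n v i j
    using E_prod_flip[of "1 / a" j i] a by (simp add: rescale_def)
  have M: "Poly_Mapping.map (E_prod j i (1 / a) n) f
     = mscale ((- a) powi n) (Poly_Mapping.map (E_prod i j a n) f)" for n i j
    by (rule map_scale) (auto simp: E E_prod_zero)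
  show ?thesis
  proof (cases "i = j")
    case False
    then show ?thesis
      unfolding e_op_def inv a_def[symmetric] x_op_def
      by (simp add: M left_mult_mscale left_mult_swap[of j i] cocyc_eps_swap[of j i] mult_ac)
  next
    case True
    show ?thesis
    proof (cases "a = 1")
      case True
      then show ?thesis using \<open>i = j\<close>
        unfolding e_op_def inv a_def[symmetric] x_op_def
        by (auto simp: power_int_minus_left)
    next
      case False
      then have d: "(1 + 1 / a) / (1 - 1 / a) = - ((1 + a) / (1 - a))"
        using a by (simp add: divide_simps) (simp add: algebra_simps)
      have "1 / a \<noteq> 1" using False a by simp
      with False d show ?thesis using \<open>i = j\<close>
        unfolding e_op_def inv a_def[symmetric] x_op_def d
        by (auto simp: M mscale.scale_right_diff_distrib mscale.scale_right_distrib mult_ac)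
    qed
  qed
qed

lemma rmult_te: "rmult \<sigma> (te m \<alpha>) (te n \<beta>) = pscale (\<sigma> \<alpha> powi n) (te (m + n) (\<alpha> + \<beta>))"
  by (simp add: rmult_def te_def psum_single)

lemma rbar_te: "rbar \<sigma> (te m \<alpha>) = pscale ((-1) powi m * \<sigma> (- \<alpha>) powi m) (te m (- \<alpha>))"
  by (simp add: rbar_def rmult_def te_def psum_single)

lemma u_act_add: "u_act \<sigma> (x + y) f = u_act \<sigma> x f + u_act \<sigma> y f"
proof -
  have "psum (X + Y) (\<lambda>(i, j) r. psum r (\<lambda>(m, \<alpha>) a. mscale (a / 2) (e_op \<sigma> i j m \<alpha> f)))
      = psum X (\<lambda>(i, j) r. psum r (\<lambda>(m, \<alpha>) a. mscale (a / 2) (e_op \<sigma> i j m \<alpha> f)))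
      + psum Y (\<lambda>(i, j) r. psum r (\<lambda>(m, \<alpha>) a. mscale (a / 2) (e_op \<sigma> i j m \<alpha> f)))" for X Y
    by (rule psum_add) (auto intro!: psum_add simp: add_divide_distrib mscale.scale_left_distrib)
  then show ?thesis by (simp add: u_act_def add_divide_distrib mscale.scale_left_distrib)
qed

lemma u_act_single: "u_act \<sigma> (Poly_Mapping.single (i, j) (pscale c (te m \<alpha>)), 0) f = mscale (c / 2) (e_op \<sigma> i j m \<alpha> f)"
  by (simp add: u_act_def te_def psum_single)

lemma u_act_e_gen:
  assumes "character \<sigma>"
  shows "u_act \<sigma> (e_gen \<sigma> i j m \<alpha>) f = e_op \<sigma> i j m \<alpha> f"
proof -
  let ?c = "(-1) powi m * \<sigma> (- \<alpha>) powi m"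
  have "\<sigma> 0 * \<sigma> 0 = \<sigma> 0" "\<sigma> 0 \<noteq> 0" "\<sigma> \<alpha> \<noteq> 0" "\<sigma> \<alpha> * \<sigma> (- \<alpha>) = \<sigma> 0"
    using assms by (metis add.right_neutral character_def add.right_inverse)+
  then have inv: "?c * (- \<sigma> \<alpha>) powi m = 1"
    by (simp flip: power_int_mult_distrib) (simp add: mult.commute)
  have "e_gen \<sigma> i j m \<alpha> = (Poly_Mapping.single (i, j) (pscale 1 (te m \<alpha>)), 0)
      + (Poly_Mapping.single (j, i) (pscale (- ?c) (te m (- \<alpha>))), 0)"
    by (simp add: e_gen_def rbar_te plus_prod_def single_uminus)
  then have "u_act \<sigma> (e_gen \<sigma> i j m \<alpha>) f
     = mscale (1 / 2) (e_op \<sigma> i j m \<alpha> f) + mscale (- ?c / 2) (e_op \<sigma> j i m (- \<alpha>) f)"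
    by (simp only: u_act_add u_act_single)
  also have "\<dots> = mscale (1 / 2 + (?c * (- \<sigma> \<alpha>) powi m) / 2) (e_op \<sigma> i j m \<alpha> f)"
    unfolding e_op_flip[OF assms] mscale.scale_left_distrib by simp
  finally show ?thesis unfolding inv by simp
qed

lemma character_uminus: "character \<sigma> \<Longrightarrow> \<sigma> (- \<alpha>) = inverse (\<sigma> \<alpha>)"
proof -
  assume c: "character \<sigma>"
  then have "\<sigma> 0 * \<sigma> 0 = \<sigma> 0" "\<sigma> 0 \<noteq> 0" "\<sigma> \<alpha> * \<sigma> (- \<alpha>) = \<sigma> 0"
    by (metis add.right_neutral character_def add.right_inverse)+
  then show ?thesis by (simp add: inverse_unique)
qed

lemma pscale_te: "Poly_Mapping.single (m, \<alpha>) a = pscale a (te m \<alpha>)"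
  by (simp add: te_def)

lemma rmult_single: "rmult \<sigma> (Poly_Mapping.single (m, \<alpha>) a) (Poly_Mapping.single (n, \<beta>) b)
    = Poly_Mapping.single (m + n, \<alpha> + \<beta>) (a * b * \<sigma> \<alpha> powi n)"
  by (simp add: rmult_def psum_single)

lemma rmult_add_right: "rmult \<sigma> x (y + z) = rmult \<sigma> x y + rmult \<sigma> x z"
  unfolding rmult_def
  by (simp add: psum_add single_add[symmetric] algebra_simps split_def psum_fun_add[symmetric]
      del: single_add)

lemma rmult_add_left: "rmult \<sigma> (x + y) z = rmult \<sigma> x z + rmult \<sigma> y z"
  unfolding rmult_def
  by (rule psum_add)
    (auto simp: psum_def sum.distrib[symmetric] single_add[symmetric] algebra_simps split_def)

lemma rmult_zero [simp]: "rmult \<sigma> 0 x = 0" "rmult \<sigma> x 0 = 0"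
  by (auto simp: rmult_def psum_def split_def)

lemma rbar_single: "rbar \<sigma> (Poly_Mapping.single (m, \<alpha>) a)
    = Poly_Mapping.single (m, - \<alpha>) (a * ((-1) powi m * \<sigma> (- \<alpha>) powi m))"
  by (simp add: rbar_def te_def rmult_single psum_single)

lemma rbar_add: "rbar \<sigma> (x + y) = rbar \<sigma> x + rbar \<sigma> y"
  unfolding rbar_def by (rule psum_add) (auto simp: pscale.scale_left_distrib)

lemma rbar_zero [simp]: "rbar \<sigma> 0 = 0"
  by (simp add: rbar_def)

lemma rbar_rmult:
  assumes "character \<sigma>"
  shows "rbar \<sigma> (rmult \<sigma> x y) = rmult \<sigma> (rbar \<sigma> y) (rbar \<sigma> x)"
proof (induction x rule: pm_induct)
  case (single k a)
  show ?case
  proof (induction y rule: pm_induct)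
    case (single l b)
    have nz: "\<sigma> \<alpha> \<noteq> 0" for \<alpha> using assms by (simp add: character_def)
    have mult: "\<sigma> (\<alpha> + \<beta>) = \<sigma> \<alpha> * \<sigma> \<beta>" for \<alpha> \<beta> using assms by (simp add: character_def)
    have diff: "\<sigma> (- \<alpha> - \<beta>) = inverse (\<sigma> \<alpha>) * inverse (\<sigma> \<beta>)" for \<alpha> \<beta>
      using mult[of "- \<alpha>" "- \<beta>"] by (simp add: character_uminus[OF assms])
    show ?case
      by (cases k; cases l)
        (simp add: rmult_single rbar_single character_uminus[OF assms] nz mult diff
          power_int_add power_int_mult_distrib power_int_inverse add.commute field_simps)
  qed (simp add: rmult_add_right rmult_add_left rbar_add)
qed (simp add: rmult_add_right rmult_add_left rbar_add)

lemma rbar_rbar: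
  assumes "character \<sigma>"
  shows "rbar \<sigma> (rbar \<sigma> x) = x"
proof (induction x rule: pm_induct)
  case (single k a)
  have nz: "\<sigma> \<alpha> \<noteq> 0" for \<alpha> using assms by (simp add: character_def)
  have "(-1 :: complex) powi m * (-1) powi m = 1" for m
    by (simp flip: power_int_mult_distrib)
  then have *: "a * ((-1) powi m * inverse s) * ((-1) powi m * s) = a" if "s \<noteq> 0" for m s
    using that by (simp add: field_simps)
  show ?case
    by (cases k) (simp add: rbar_single character_uminus[OF assms] power_int_inverse nz *
        del: mult_cancel_left mult_cancel_right mult_cancel_left1 mult_cancel_right1)
qed (simp add: rbar_add)

lemma mmult_single: "mmult \<sigma> (Poly_Mapping.single (i, j) x) (Poly_Mapping.single (k, l) y)
    = (if j = k then Poly_Mapping.single (i, l) (rmult \<sigma> x y) else 0)"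
  by (simp add: mmult_def psum_single)

lemma mmult_add_right: "mmult \<sigma> X (Y + Z) = mmult \<sigma> X Y + mmult \<sigma> X Z"
  unfolding mmult_def
  by (simp add: psum_add single_add[symmetric] rmult_add_right split_def psum_fun_add[symmetric]
      del: single_add)

lemma mmult_add_left: "mmult \<sigma> (X + Y) Z = mmult \<sigma> X Z + mmult \<sigma> Y Z"
  unfolding mmult_def
  by (rule psum_add)
    (auto simp: sum.neutral psum_def sum.distrib[symmetric] single_add[symmetric] rmult_add_left split_def intro!: sum.cong)

lemma mstar_single: "mstar \<sigma> (Poly_Mapping.single (i, j) x) = Poly_Mapping.single (j, i) (rbar \<sigma> x)"
  by (simp add: mstar_def psum_single)

lemma mstar_add: "mstar \<sigma> (X + Y) = mstar \<sigma> X + mstar \<sigma> Y"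
  unfolding mstar_def by (rule psum_add) (auto simp: rbar_add single_add)

lemma mstar_zero [simp]: "mstar \<sigma> 0 = 0"
  by (simp add: mstar_def)

lemma mstar_minus: "mstar \<sigma> (X - Y) = mstar \<sigma> X - mstar \<sigma> Y"
  using mstar_add[of \<sigma> "X - Y" Y] by simp

lemma mstar_uminus: "mstar \<sigma> (- X) = - mstar \<sigma> X"
  using mstar_minus[of \<sigma> 0 X] by simp

lemma mstar_mmult:
  assumes "character \<sigma>"
  shows "mstar \<sigma> (mmult \<sigma> X Y) = mmult \<sigma> (mstar \<sigma> Y) (mstar \<sigma> X)"
proof (induction X rule: pm_induct)
  case (single k a)
  show ?case
  proof (induction Y rule: pm_induct)
    case (single l b)
    show ?case
      by (cases k; cases l) (simp add: mmult_single mstar_single rbar_rmult[OF assms])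
  qed (simp add: mmult_add_right mmult_add_left mstar_add)
qed (simp add: mmult_add_right mmult_add_left mstar_add)

lemma mstar_mscale: "mstar \<sigma> (mscale c X) = mscale c (mstar \<sigma> X)"
proof (induction X rule: pm_induct)
  case (single k x)
  have "rbar \<sigma> (pscale c x) = pscale c (rbar \<sigma> x)"
  proof (induction x rule: pm_induct)
    case (single l b)
    then show ?case by (cases l) (simp add: rbar_single mult.assoc)
  qed (simp add: rbar_add pscale.scale_right_distrib)
  then show ?case by (cases k) (simp add: mstar_single)
qed (simp add: mstar_add mscale.scale_right_distrib)

lemma mmult_uminus: "mmult \<sigma> (- X) Y = - mmult \<sigma> X Y" "mmult \<sigma> X (- Y) = - mmult \<sigma> X Y"
proof -
  have "mmult \<sigma> (- X) Y + mmult \<sigma> X Y = mmult \<sigma> 0 Y" "mmult \<sigma> X (- Y) + mmult \<sigma> X Y = mmult \<sigma> X 0"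
    by (simp_all flip: mmult_add_left mmult_add_right)
  moreover have "mmult \<sigma> 0 Y = 0" "mmult \<sigma> X 0 = 0" by (auto simp: mmult_def psum_def split_def)
  ultimately show "mmult \<sigma> (- X) Y = - mmult \<sigma> X Y" "mmult \<sigma> X (- Y) = - mmult \<sigma> X Y"
    by (simp_all add: eq_neg_iff_add_eq_0)
qed

lemma gl_carrier_add: "X \<in> gl_carrier \<nu> \<Longrightarrow> Y \<in> gl_carrier \<nu> \<Longrightarrow> X + Y \<in> gl_carrier \<nu>"
  using keys_add[of X Y] by (auto simp: gl_carrier_def)

lemma gl_carrier_uminus: "X \<in> gl_carrier \<nu> \<Longrightarrow> - X \<in> gl_carrier \<nu>"
  by (auto simp: gl_carrier_def in_keys_iff)

lemma gl_carrier_mscale: "X \<in> gl_carrier \<nu> \<Longrightarrow> mscale c X \<in> gl_carrier \<nu>"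
  unfolding gl_carrier_def using pscale_zero by (fastforce simp: in_keys_iff)

lemma gl_carrier_sum: "(\<And>a. a \<in> A \<Longrightarrow> f a \<in> gl_carrier \<nu>) \<Longrightarrow> sum f A \<in> gl_carrier \<nu>"
  by (induction A rule: infinite_finite_induct) (auto intro!: gl_carrier_add, auto simp: gl_carrier_def)

lemma gl_carrier_mmult: "X \<in> gl_carrier \<nu> \<Longrightarrow> Y \<in> gl_carrier \<nu> \<Longrightarrow> mmult \<sigma> X Y \<in> gl_carrier \<nu>"
  unfolding mmult_def psum_def split_def
  by (intro gl_carrier_sum) (auto simp: gl_carrier_def)

lemma e_gen_in_u_hat:
  assumes "character \<sigma>" "i \<in> {1..\<nu>}" "j \<in> {1..\<nu>}"
  shows "e_gen \<sigma> i j m \<alpha> \<in> u_hat \<nu> \<sigma>"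
proof -
  have "Poly_Mapping.single (i, j) (te m \<alpha>) + - Poly_Mapping.single (j, i) (rbar \<sigma> (te m \<alpha>)) \<in> gl_carrier \<nu>"
    by (intro gl_carrier_add gl_carrier_uminus) (use assms in \<open>auto simp: gl_carrier_def\<close>)
  then show ?thesis
    by (simp add: u_hat_def e_gen_def mstar_minus mstar_single rbar_rbar[OF assms(1)])
qed

lemma hbracket_in_u_hat:
  assumes "character \<sigma>" "x \<in> u_hat \<nu> \<sigma>" "y \<in> u_hat \<nu> \<sigma>"
  shows "hbracket \<sigma> x y \<in> u_hat \<nu> \<sigma>"
proof -
  have "mmult \<sigma> (fst x) (fst y) + - mmult \<sigma> (fst y) (fst x) \<in> gl_carrier \<nu>"
    by (intro gl_carrier_add gl_carrier_uminus gl_carrier_mmult) (use assms in \<open>auto simp: u_hat_def\<close>)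
  with assms show ?thesis
    by (simp add: u_hat_def hbracket_def mstar_minus mstar_mmult mmult_uminus)
qed

lemma eu_hat_subset_u_hat:
  assumes "character \<sigma>"
  shows "eu_hat \<nu> \<sigma> \<subseteq> u_hat \<nu> \<sigma>"
proof
  fix x assume "x \<in> eu_hat \<nu> \<sigma>"
  then show "x \<in> u_hat \<nu> \<sigma>"
  proof induction
    case zero
    show ?case by (simp add: u_hat_def gl_carrier_def)
  next
    case (add x y)
    then show ?case by (auto simp: u_hat_def mstar_add intro: gl_carrier_add)
  next
    case (scale x c)
    then show ?case by (auto simp: u_hat_def hscale_def mstar_mscale intro: gl_carrier_mscale)
  qed (auto intro: e_gen_in_u_hat hbracket_in_u_hat assms)
qed

lemma hbracket_basis:
  "hbracket \<sigma> (Poly_Mapping.single (i, j) (te m \<alpha>), 0) (Poly_Mapping.single (k, l) (te n \<beta>), 0) =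
     (mscale (of_bool (j = k) * \<sigma> \<alpha> powi n) (Poly_Mapping.single (i, l) (te (m + n) (\<alpha> + \<beta>)))
      - mscale (of_bool (i = l) * \<sigma> \<beta> powi m) (Poly_Mapping.single (k, j) (te (m + n) (\<alpha> + \<beta>))),
      of_int m * of_bool (i = l) * of_bool (j = k) * of_bool (m + n = 0)
        * of_bool (\<sigma> \<alpha> * \<sigma> \<beta> = 1) * \<sigma> \<alpha> powi n)"
  by (auto simp: hbracket_def mmult_single rmult_single gl_cocycle_def psum_single te_def add.commute[of n m] add.commute[of \<beta> \<alpha>])

lemma pd_hvar: "pd v (hvar i n) = (if v = (i, n) then 1 else 0)"
  by (auto simp: pd_def hvar_def psum_single lookup_single when_def)

lemma pd_mult: "pd v (p * q) = pd v p * q + p * pd v q"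
proof (induction p rule: pm_induct)
  case (single k a)
  show ?case
  proof (induction q rule: pm_induct)
    case (single l b)
    have 1: "k + l - Poly_Mapping.single v 1 = (k - Poly_Mapping.single v 1) + l" if "Poly_Mapping.lookup k v \<noteq> 0"
      by (rule poly_mapping_eqI) (use that in \<open>auto simp: lookup_add lookup_minus lookup_single when_def\<close>)
    have 2: "k + l - Poly_Mapping.single v 1 = k + (l - Poly_Mapping.single v 1)" if "Poly_Mapping.lookup l v \<noteq> 0"
      by (rule poly_mapping_eqI) (use that in \<open>auto simp: lookup_add lookup_minus lookup_single when_def\<close>)
    show ?case
      by (cases "Poly_Mapping.lookup k v = 0"; cases "Poly_Mapping.lookup l v = 0")
        (auto simp: pd_def psum_single mult_single lookup_add 1 2[symmetric] single_add[symmetric] algebra_simps simp del: One_nat_def)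
  qed (simp add: pd_add algebra_simps)
qed (simp add: pd_add algebra_simps)

lemma cocyc_add_left: "cocyc (\<alpha> + \<alpha>') \<beta> = cocyc \<alpha> \<beta> * cocyc \<alpha>' \<beta>"
  unfolding cocyc_def
  by (subst psum_add) (auto simp: psum_def power_int_add sum.distrib[symmetric] algebra_simps sum.neutral intro!: sum.cong)

lemma cocyc_add_right: "cocyc \<alpha> (\<beta> + \<beta>') = cocyc \<alpha> \<beta> * cocyc \<alpha> \<beta>'"
proof -
  have "psum (\<beta> + \<beta>') (\<lambda>j b. if i > j then a * b else 0) =
      psum \<beta> (\<lambda>j b. if i > j then a * b else 0) + psum \<beta>' (\<lambda>j b. if i > j then a * b else 0)"
    for i :: nat and a :: int
    by (rule psum_add) (auto simp: algebra_simps)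
  then show ?thesis by (simp add: cocyc_def psum_fun_add power_int_add)
qed

end

theory Submission
  imports Defs "HOL-Library.Multiset"
begin

text \<open>
  Write \<open>Z\<close> for the set of all integers \<open>n\<close> with \<open>\<sigma>(\<alpha>)\<^sup>n = 1\<close> for every \<open>\<alpha>\<close>.  It contains no odd
  number if \<open>\<sigma>(G)\<close> is infinite or of even order, and it consists of the multiples of \<open>N\<close> if
  \<open>\<sigma>(G)\<close> has order \<open>N\<close>.  Let \<open>H\<^sub>Z\<close> be the span of all \<open>\<epsilon>\<^sub>i(m) - \<epsilon>\<^sub>j(m)\<close> and of the \<open>\<epsilon>\<^sub>i(n)\<close> with
  \<open>n \<notin> Z\<close> (\<open>m, n\<close> odd negative).  Both parts of the theorem are instances of two statements that hold
  for every character: \<open>V(\<gamma>) \<otimes> S(H\<^sub>Z)\<close> is irreducible, and \<open>V(\<gamma>) \<otimes> S(H\<^sup>-)\<close> is a direct sum of copies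
  of it.

  \<^emph>\<open>What the Lie algebra can reach.\<close>  The bracket of \<open>e\<^sub>i\<^sub>j(k,\<alpha>)\<close> with \<open>e\<^sub>j\<^sub>i(0,-\<alpha>)\<close> is
  \<open>e\<^sub>i\<^sub>i(k,0) - \<sigma>(\<alpha>)\<^bsup>-k\<^esup> e\<^sub>j\<^sub>j(k,0)\<close>, and for odd \<open>k\<close> the element \<open>e\<^sub>i\<^sub>i(k,0)\<close> acts as a multiple of \<open>\<epsilon>\<^sub>i(k)\<close>.
  So a submodule is stable under all \<open>\<epsilon>\<^sub>i(k) - \<epsilon>\<^sub>j(k)\<close>, and under \<open>\<epsilon>\<^sub>i(k)\<close> itself as soon as \<open>k \<notin> Z\<close>.
  The operators with \<open>k > 0\<close> lower the degree, so a nonzero submodule of \<open>V(\<gamma>) \<otimes> S(H\<^sub>Z)\<close> contains a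
  nonzero vector killed by all of them, and such a vector lies in \<open>V(\<gamma>) \<otimes> 1\<close>.  On \<open>V(\<gamma>) \<otimes> 1\<close> the
  generator \<open>e\<^sub>i\<^sub>j(0,0)\<close> acts as a multiple of \<open>e\<^bsup>\<epsilon>\<^sub>i - \<epsilon>\<^sub>j\<^esup>\<close>.  The \<open>c\<^sub>i = e\<^bsup>\<epsilon>\<^sub>i\<^esup>\<close> generate a Clifford algebra
  in which \<open>c\<^sub>2\<^sub>k\<^sub>-\<^sub>1 c\<^sub>2\<^sub>k\<close> is diagonal on the vectors \<open>w(\<rho>)\<close> and \<open>c\<^sub>2\<^sub>k c\<^sub>2\<^sub>k\<^sub>+\<^sub>1\<close> reverses two of their signs, up to
  scalars.  The former separate the \<open>w(\<rho>)\<close> in \<open>V(\<gamma>)\<close> and the latter permute them transitively, which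
  makes \<open>V(\<gamma>)\<close> irreducible (\<open>V_space_irreducible\<close>).  Multiplication by the elements of \<open>H\<^sub>Z\<close>
  then gives everything (\<open>Fock_irreducible\<close>).

  \<^emph>\<open>What the Lie algebra cannot reach.\<close>  The monomials \<open>t\<^sup>n e\<^sup>\<alpha>\<close> with \<open>n \<in> Z\<close>, \<open>\<sigma>(\<alpha>) = 1\<close> are central
  in \<open>R\<^sub>\<sigma>\<close>, so their coefficients in the trace of a commutator vanish; hence they vanish in the trace of
  every element of the elementary subalgebra (\<open>eu_hat_trace_free\<close>).  For \<open>n \<in> Z\<close> odd negative put
  \<open>y\<^sub>n = \<Sum>\<^sub>i \<epsilon>\<^sub>i(n)\<close> and \<open>D\<^sub>n = \<Sum>\<^sub>i \<partial>/\<partial>\<epsilon>\<^sub>i(n)\<close>.  These commute with every vertex operator whose parameter \<open>a\<close>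
  satisfies \<open>a\<^sup>n = 1\<close>, because the contributions of \<open>\<epsilon>\<^sub>i\<close> and \<open>-\<epsilon>\<^sub>j\<close> to the commutator cancel
  (\<open>E_prod_comm\<close>); together with the trace condition, they commute with the whole elementary subalgebra.
  Inside \<open>S(H\<^sup>-)\<close> the algebra \<open>S(H\<^sub>Z)\<close> is the common kernel of the \<open>D\<^sub>n\<close> (\<open>Sym_HZ_eq\<close>), so
  \<open>V(\<gamma>) \<otimes> S(H\<^sub>Z)\<close> is a submodule; and \<open>S(H\<^sup>-)\<close> is the direct sum of the \<open>y\<^sup>M S(H\<^sub>Z)\<close> over all monomials
  \<open>y\<^sup>M\<close>, which are told apart by the eigenvalues of the operators \<open>y\<^sub>n D\<^sub>n\<close>.  Multiplication by
  \<open>y\<^sup>M\<close> identifies each summand with the first one (\<open>completely_reducible_Fock\<close>).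
\<close>

section \<open>Joint eigenvectors\<close>


text \<open>
  Subtracting from \<open>T\<^sub>k\<close> its eigenvalue at one summand removes that summand and rescales the others,
  so the number of summands drops.  With \<open>V = 0\<close> this is the linear independence of joint eigenvectors
  with distinct eigenvalues; with \<open>V\<close> a submodule it extracts single weight vectors.
\<close>

lemma (in vector_space) joint_eigen_components:
  assumes sub: "subspace V"
    and add: "\<And>k x y. T k (x + y) = T k x + T k y"
    and scl: "\<And>k c x. T k (c *s x) = c *s T k x"
    and inv: "\<And>k x. k \<in> K \<Longrightarrow> x \<in> V \<Longrightarrow> T k x \<in> V"
    and fin: "finite A"
    and eig: "\<And>a k. a \<in> A \<Longrightarrow> k \<in> K \<Longrightarrow> T k (g a) = lam a k *s g a"
    and dist: "\<And>a b. a \<in> A \<Longrightarrow> b \<in> A \<Longrightarrow> a \<noteq> b \<Longrightarrow> \<exists>k\<in>K. lam a k \<noteq> lam b k"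
    and mem: "sum g A \<in> V"
  shows "\<forall>a\<in>A. g a \<in> V"
  using fin eig dist mem
proof (induction A arbitrary: g rule: finite_induct)
  case (insert a A)
  have T0: "T k 0 = 0" for k using scl[of k 0 0] by simp
  have Tsum: "T k (sum f B) = (\<Sum>b\<in>B. T k (f b))" for k f and B :: "'d set"
    by (induction B rule: infinite_finite_induct) (auto simp: T0 add)
  have b: "g b \<in> V" if bA: "b \<in> A" for b
  proof -
    have "b \<noteq> a" using bA insert.hyps by auto
    then obtain k where k: "k \<in> K" "lam b k \<noteq> lam a k"
      using insert.prems(2)[of b a] bA by auto
    let ?g = "\<lambda>x. (lam x k - lam a k) *s g x"
    have "T k (sum g (insert a A)) - lam a k *s sum g (insert a A)
        = (\<Sum>x\<in>insert a A. lam x k *s g x - lam a k *s g x)"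
      by (simp only: Tsum scale_sum_right sum_subtractf)
        (auto intro!: arg_cong2[where f = "(-)"] sum.cong simp: insert.prems(1) k)
    also have "\<dots> = sum ?g A"
      using insert.hyps by (simp add: scale_left_diff_distrib)
    finally have eq: "T k (sum g (insert a A)) - lam a k *s sum g (insert a A) = sum ?g A" .
    have "sum ?g A \<in> V"
      unfolding eq[symmetric]
      by (intro subspace_diff[OF sub] subspace_scale[OF sub] inv k insert.prems)
    then have "\<forall>x\<in>A. ?g x \<in> V"
      by (intro insert.IH) (use insert.prems in \<open>auto simp: scl mult.commute\<close>)
    then have "?g b \<in> V" using bA by (rule bspec)
    then have "(1 / (lam b k - lam a k)) *s ?g b \<in> V" by (rule subspace_scale[OF sub])
    then show ?thesis using k by simp
  qed
  have "sum g (insert a A) - sum g A \<in> V"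
    by (intro subspace_diff[OF sub] insert.prems subspace_sum[OF sub] b)
  then show ?case using b insert.hyps by simp
qed simp

lemma (in vector_space) span_UN_decompose:
  assumes E: "\<And>a. a \<in> I \<Longrightarrow> subspace (E a)" and x: "x \<in> span (\<Union>a\<in>I. E a)"
  obtains A g where "finite A" "A \<subseteq> I" "\<And>a. a \<in> A \<Longrightarrow> g a \<in> E a" "x = sum g A"
proof -
  let ?P = "\<lambda>x. \<exists>A g. finite A \<and> A \<subseteq> I \<and> (\<forall>a\<in>A. g a \<in> E a) \<and> x = sum g A"
  have "?P x"
    using x
  proof (induction rule: span_induct_alt)
    case base
    show ?case by (intro exI[of _ "{}"]) auto
  next
    case (step c x y)
    then obtain a A g where a: "a \<in> I" "x \<in> E a"
      and A: "finite A" "A \<subseteq> I" "\<forall>a\<in>A. g a \<in> E a" "y = sum g A"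
      by blast
    let ?g = "\<lambda>b. (if b = a then c *s x else 0) + (if b \<in> A then g b else 0)"
    have "sum ?g (insert a A) = c *s x + y"
      using A by (simp add: sum.distrib sum.delta' sum.inter_restrict[symmetric] Int_insert_left insert_absorb)
    moreover have "?g b \<in> E b" if "b \<in> insert a A" for b
      using that a A E by (intro subspace_add) (auto intro: subspace_scale subspace_0)
    ultimately show ?case
      using a A by (intro exI[of _ "insert a A"] exI[of _ ?g]) auto
  qed
  then show ?thesis using that by blast
qed

section \<open>Symmetric algebras as common kernels of derivations\<close>

lemma poly_mapping_sum_singles: "(\<Sum>k\<in>Poly_Mapping.keys x. Poly_Mapping.single k (Poly_Mapping.lookup x k)) = x"
  for x :: "'k \<Rightarrow>\<^sub>0 'a::comm_monoid_add"
  by (rule poly_mapping_eqI) (auto simp: lookup_sum lookup_single when_def in_keys_iff sum.delta')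

lemma const_sym: "Poly_Mapping.single 0 c = pscale c (1::sym)"
  by (simp flip: single_one)

lemma lin_mult: "lin ((*) (q::sym))"
  by (simp add: lin_def distrib_left pscale_mult(1))

lemma lin_minus: "lin T \<Longrightarrow> T (x - y) = T x - T y"
proof -
  assume l: "lin T"
  have "T (x - y) + T y = T x" using l unfolding lin_def by (metis diff_add_cancel)
  then show ?thesis by (metis add_diff_cancel_right')
qed

lemma lin_finite_sum: "lin T \<Longrightarrow> T (sum g A) = (\<Sum>a\<in>A. T (g a))"
  by (induction A rule: infinite_finite_induct) (auto simp: lin_zero, auto simp: lin_def)

lemma subspace_kernel: "lin T \<Longrightarrow> pscale.subspace {p. T p = 0}"
  by (rule pscale.subspaceI) (auto simp: lin_zero, auto simp: lin_def)

lemma lin_pd: "lin (pd v)"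
  by (simp add: lin_def pd_add pd_pscale)

lemma pd_one [simp]: "pd v 1 = 0"
proof (rule poly_mapping_eqI)
  fix m :: "nat \<times> int \<Rightarrow>\<^sub>0 nat"
  have "Poly_Mapping.lookup (m + Poly_Mapping.single v 1) v \<noteq> Poly_Mapping.lookup 0 v"
    by (simp add: lookup_add)
  then have "m + Poly_Mapping.single v 1 \<noteq> 0" by metis
  then show "Poly_Mapping.lookup (pd v 1) m = Poly_Mapping.lookup 0 m"
    by (simp only: lookup_pd lookup_one when_def) simp
qed

lemma Sym_one: "1 \<in> Sym W"
  unfolding Sym_def by (rule pscale.span_base) (auto intro!: exI[of _ "[]"])

lemma Sym_subspace: "pscale.subspace (Sym W)"
  by (simp add: Sym_def)

lemma Sym_mult:
  assumes "w \<in> W" "p \<in> Sym W"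
  shows "w * p \<in> Sym W"
  using assms(2) unfolding Sym_def
proof (induction rule: pscale.span_induct_alt)
  case base
  then show ?case by (simp add: pscale.span_zero)
next
  case (step c x y)
  then obtain ws where "x = prod_list ws" "set ws \<subseteq> W" by auto
  then have "w * x \<in> pscale.span {prod_list ws |ws. set ws \<subseteq> W}"
    using assms(1) by (intro pscale.span_base CollectI exI[of _ "w # ws"]) auto
  then show ?case
    unfolding distrib_left pscale_mult(1)[symmetric]
    by (intro pscale.span_add pscale.span_scale step)
qed

text \<open>
  The induction principle for \<open>Sym\<close>: a space of polynomials containing 1 and stable under
  multiplication by generators of the degree one part contains the whole algebra.
\<close>

lemma Sym_span_least:
  assumes P: "pscale.subspace P" "1 \<in> P" and G: "\<And>g p. g \<in> G \<Longrightarrow> p \<in> P \<Longrightarrow> g * p \<in> P"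
  shows "Sym (pscale.span G) \<subseteq> P"
proof -
  have w: "w * p \<in> P" if w: "w \<in> pscale.span G" and p: "p \<in> P" for w p
    using w
  proof (induction rule: pscale.span_induct_alt)
    case base
    then show ?case using P by (simp add: pscale.subspace_0)
  next
    case (step c x y)
    from step.hyps(1) have "x * p \<in> P" using p by (rule G)
    with step show ?case
      unfolding distrib_right pscale_mult(2)
      by (intro pscale.subspace_add[OF P(1)] pscale.subspace_scale[OF P(1)])
  qed
  have "prod_list ws \<in> P" if "set ws \<subseteq> pscale.span G" for ws
    using that by (induction ws) (auto intro: P w)
  then show ?thesis
    unfolding Sym_def by (intro pscale.span_minimal P) auto
qed

definition is_var :: "nat \<Rightarrow> nat \<times> int \<Rightarrow> bool" where
  "is_var \<nu> v \<longleftrightarrow> fst v \<in> {1..\<nu>} \<and> snd v < 0 \<and> odd (snd v)"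

text \<open>
  Total degree of a monomial in which the variable \<open>v\<close> has degree \<open>w v\<close>.
\<close>

definition mdeg :: "('v \<Rightarrow> nat) \<Rightarrow> ('v \<Rightarrow>\<^sub>0 nat) \<Rightarrow> nat" where
  "mdeg w m = psum m (\<lambda>v a. a * w v)"

lemma mdeg_add_var: "mdeg w (m + Poly_Mapping.single v 1) = mdeg w m + w v"
  unfolding mdeg_def by (subst psum_add) (auto simp: psum_single algebra_simps)

lemma mdeg_zero [simp]: "mdeg w 0 = 0"
  by (simp add: mdeg_def)

lemma monom_split:
  assumes "v \<in> Poly_Mapping.keys m"
  shows "(m - Poly_Mapping.single v 1) + Poly_Mapping.single v 1 = (m :: 'v \<Rightarrow>\<^sub>0 nat)"
  using assms by (intro poly_mapping_eqI) (auto simp: lookup_add lookup_minus lookup_single when_def in_keys_iff)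

lemma pd_zero_lookup:
  assumes "pd v p = 0" "v \<in> Poly_Mapping.keys m"
  shows "Poly_Mapping.lookup p m = 0"
proof -
  have "Poly_Mapping.lookup (pd v p) (m - Poly_Mapping.single v 1) = 0" using assms(1) by simp
  then show ?thesis unfolding lookup_pd monom_split[OF assms(2)]
    by (metis add_eq_0_iff_both_eq_0 mult_eq_0_iff of_nat_eq_0_iff one_neq_zero)
qed

lemma monom_in_Sym:
  assumes "\<And>v. v \<in> Poly_Mapping.keys m \<Longrightarrow> is_var \<nu> v"
  shows "Poly_Mapping.single m c \<in> Sym (H_minus \<nu>)"
  using assms
proof (induction "mdeg (\<lambda>_. 1) m" arbitrary: m rule: less_induct)
  case less
  show ?case
  proof (cases "m = 0")
    case True
    then show ?thesis by (simp add: const_sym pscale.subspace_scale[OF Sym_subspace Sym_one])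
  next
    case False
    then obtain v where v: "v \<in> Poly_Mapping.keys m" by (metis keys_eq_empty ex_in_conv)
    let ?m = "m - Poly_Mapping.single v 1"
    have "mdeg (\<lambda>_. 1) ?m < mdeg (\<lambda>_. 1) m"
      using mdeg_add_var[of "\<lambda>_. 1" ?m v] by (simp only: monom_split[OF v])
    moreover have "Poly_Mapping.keys ?m \<subseteq> Poly_Mapping.keys m"
      by (auto simp: in_keys_iff lookup_minus)
    ultimately have "Poly_Mapping.single ?m c \<in> Sym (H_minus \<nu>)"
      by (intro less.hyps) (use less.prems in auto)
    moreover have "hvar (fst v) (snd v) \<in> H_minus \<nu>"
      unfolding H_minus_def using less.prems[OF v]
      by (intro pscale.span_base) (auto simp: is_var_def)
    ultimately have "hvar (fst v) (snd v) * Poly_Mapping.single ?m c \<in> Sym (H_minus \<nu>)"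
      by (intro Sym_mult)
    then show ?thesis
      using monom_split[OF v] by (simp add: hvar_def mult_single add.commute)
  qed
qed

lemma pd_hvar_of_bool: "pd v (hvar i n) = of_bool (v = (i, n))"
  by (simp add: pd_hvar)

text \<open>
  In characteristic zero a polynomial avoids a variable iff its derivative by that variable vanishes.
  Kernels are convenient here since an operator commuting with the derivations preserves them.
\<close>

lemma Sym_H_minus_eq: "Sym (H_minus \<nu>) = {p. \<forall>v. \<not> is_var \<nu> v \<longrightarrow> pd v p = 0}"
proof
  have "pscale.subspace {p. \<forall>v. \<not> is_var \<nu> v \<longrightarrow> pd v p = 0}"
    by (rule pscale.subspaceI) (auto simp: pd_add pd_pscale lin_zero[OF lin_pd])
  then show "Sym (H_minus \<nu>) \<subseteq> {p. \<forall>v. \<not> is_var \<nu> v \<longrightarrow> pd v p = 0}"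
    unfolding H_minus_def by (intro Sym_span_least) (auto simp: pd_mult pd_hvar is_var_def)
next
  show "{p. \<forall>v. \<not> is_var \<nu> v \<longrightarrow> pd v p = 0} \<subseteq> Sym (H_minus \<nu>)"
  proof
    fix p assume p: "p \<in> {p. \<forall>v. \<not> is_var \<nu> v \<longrightarrow> pd v p = 0}"
    have "(\<Sum>m\<in>Poly_Mapping.keys p. Poly_Mapping.single m (Poly_Mapping.lookup p m)) \<in> Sym (H_minus \<nu>)"
    proof (intro pscale.subspace_sum[OF Sym_subspace] monom_in_Sym)
      fix m v assume "m \<in> Poly_Mapping.keys p" "v \<in> Poly_Mapping.keys m"
      then show "is_var \<nu> v" using pd_zero_lookup[of v p m] p unfolding in_keys_iff by blast
    qed
    then show "p \<in> Sym (H_minus \<nu>)" by (simp add: poly_mapping_sum_singles)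
  qed
qed

text \<open>
  The space \<open>H\<^sub>Z\<close>.  For \<open>Z\<close> the multiples of \<open>N\<close> it is \<open>H\<^sub>0\<^sup>-\<close>, and if \<open>Z\<close> has no odd
  elements it is all of \<open>H\<^sup>-\<close>.
\<close>

definition HZ :: "nat \<Rightarrow> int set \<Rightarrow> sym set" where
  "HZ \<nu> Z = pscale.span
     ({hvar i m - hvar j m |i j m. i \<in> {1..\<nu>} \<and> j \<in> {1..\<nu>} \<and> i \<noteq> j \<and> m < 0 \<and> odd m}
      \<union> {hvar i n |i n. i \<in> {1..\<nu>} \<and> n < 0 \<and> odd n \<and> n \<notin> Z})"

definition Zneg :: "int set \<Rightarrow> int set" where
  "Zneg Z = {n \<in> Z. n < 0 \<and> odd n}"

text \<open>
  The element \<open>y\<^sub>n\<close>, and below the dual derivation \<open>D\<^sub>n\<close>.  For negative \<open>n \<in> Z\<close> the \<open>y\<^sub>n\<close> are coordinates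
  complementary to \<open>H\<^sub>Z\<close>.
\<close>

definition trace_var :: "nat \<Rightarrow> int \<Rightarrow> sym" where
  "trace_var \<nu> n = (\<Sum>i\<in>{1..\<nu>}. hvar i n)"

definition trace_pd :: "nat \<Rightarrow> int \<Rightarrow> sym \<Rightarrow> sym" where
  "trace_pd \<nu> n p = (\<Sum>i\<in>{1..\<nu>}. pd (i, n) p)"

text \<open>Multisets of exponents index the monomials \<open>y\<^sup>M\<close>.\<close>

definition trace_monom :: "nat \<Rightarrow> int multiset \<Rightarrow> sym" where
  "trace_monom \<nu> M = prod_mset (image_mset (trace_var \<nu>) M)"

lemma trace_pd_lin: "lin (trace_pd \<nu> n)"
  by (simp add: lin_def trace_pd_def pd_add pd_pscale sum.distrib pscale.scale_sum_right)

lemma trace_pd_mult: "trace_pd \<nu> n (p * q) = trace_pd \<nu> n p * q + p * trace_pd \<nu> n q"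
  by (simp add: trace_pd_def pd_mult sum.distrib sum_distrib_left sum_distrib_right)

lemma trace_pd_one [simp]: "trace_pd \<nu> n 1 = 0"
  by (simp add: trace_pd_def)

lemma trace_pd_hvar: "i \<in> {1..\<nu>} \<Longrightarrow> trace_pd \<nu> n (hvar i m) = of_bool (n = m)"
  by (auto simp: trace_pd_def pd_hvar_of_bool of_bool_def sum.delta)

lemma sym_of_nat: "(of_nat k :: sym) = pscale (of_nat k) 1"
  by (induction k) (auto simp: pscale.scale_left_distrib)

lemma trace_pd_var: "trace_pd \<nu> n (trace_var \<nu> m) = pscale (of_nat \<nu> * of_bool (n = m)) 1"
  unfolding trace_var_def lin_finite_sum[OF trace_pd_lin]
  by (subst sum.cong[OF refl trace_pd_hvar]) (auto simp: sym_of_nat)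

lemma trace_monom_add: "trace_monom \<nu> (add_mset n M) = trace_var \<nu> n * trace_monom \<nu> M"
  by (simp add: trace_monom_def)

lemma trace_monom_empty [simp]: "trace_monom \<nu> {#} = 1"
  by (simp add: trace_monom_def)

text \<open>
  On \<open>y\<^sup>M s\<close> with \<open>D\<^sub>n s = 0\<close> the operator \<open>y\<^sub>n D\<^sub>n\<close> is \<open>\<nu>\<close> times the Euler operator of the variable
  \<open>y\<^sub>n\<close>.
\<close>

lemma trace_euler:
  assumes "trace_pd \<nu> n s = 0"
  shows "trace_var \<nu> n * trace_pd \<nu> n (trace_monom \<nu> M * s)
    = pscale (of_nat (\<nu> * count M n)) (trace_monom \<nu> M * s)"
proof (induction M)
  case empty
  then show ?case using assms by (simp add: trace_pd_mult)
next
  case (add m M)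
  let ?X = "trace_monom \<nu> M * s"
  have "trace_pd \<nu> n (trace_monom \<nu> (add_mset m M) * s)
      = pscale (of_nat \<nu> * of_bool (n = m)) ?X + trace_var \<nu> m * trace_pd \<nu> n ?X"
    by (simp only: trace_monom_add mult.assoc trace_pd_mult[of _ _ "trace_var \<nu> m"] trace_pd_var)
      (simp add: pscale_mult(2))
  then have "trace_var \<nu> n * trace_pd \<nu> n (trace_monom \<nu> (add_mset m M) * s)
      = pscale (of_nat \<nu> * of_bool (n = m)) (trace_var \<nu> n * ?X)
        + trace_var \<nu> m * (trace_var \<nu> n * trace_pd \<nu> n ?X)"
    by (simp only: distrib_left mult.left_commute[of "trace_var \<nu> n"] flip: pscale_mult(1))
  also have "trace_var \<nu> m * (trace_var \<nu> n * trace_pd \<nu> n ?X)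
      = pscale (of_nat (\<nu> * count M n)) (trace_var \<nu> m * ?X)"
    by (simp only: add pscale_mult(1))
  also have "pscale (of_nat \<nu> * of_bool (n = m)) (trace_var \<nu> n * ?X) + \<dots>
      = pscale (of_nat (\<nu> * count (add_mset m M) n)) (trace_var \<nu> m * ?X)"
    by (cases "n = m") (simp_all add: algebra_simps flip: pscale.scale_left_distrib)
  finally show ?case by (simp only: trace_monom_add mult.assoc)
qed

text \<open>
  Differentiating by one of the factors recovers the product of the others, up to a positive
  factor.
\<close>

lemma trace_monom_mult_inj:
  assumes "\<nu> > 0" "\<And>n. n \<in># M \<Longrightarrow> trace_pd \<nu> n s = 0" "trace_monom \<nu> M * s = 0"
  shows "s = 0"
  using assms(2,3)
proof (induction M)
  case (add n M)
  let ?q = "trace_monom \<nu> M * s"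
  have "0 = trace_pd \<nu> n (trace_var \<nu> n * ?q)"
    using add.prems by (simp add: trace_monom_add mult.assoc lin_zero[OF trace_pd_lin])
  also have "\<dots> = pscale (of_nat (\<nu> * Suc (count M n))) ?q"
  proof -
    have "trace_var \<nu> n * trace_pd \<nu> n ?q = pscale (of_nat (\<nu> * count M n)) ?q"
      by (rule trace_euler) (use add.prems in simp)
    moreover have "(of_nat (\<nu> * Suc (count M n)) :: complex) = of_nat \<nu> + of_nat (\<nu> * count M n)"
      by simp
    ultimately show ?thesis
      by (simp only: trace_pd_mult[of _ _ "trace_var \<nu> n"] trace_pd_var pscale.scale_left_distrib)
        (simp add: pscale_mult(2))
  qed
  finally have "pscale (of_nat (\<nu> * Suc (count M n))) ?q = 0" by (rule sym)
  moreover have "(of_nat (\<nu> * Suc (count M n)) :: complex) \<noteq> 0"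
    using \<open>\<nu> > 0\<close> by (simp only: of_nat_eq_0_iff) simp
  ultimately have "?q = 0" by (metis pscale.scale_eq_0_iff)
  then show ?case using add by simp
qed simp

lemma Sym_HZ_imp_Sym_H_minus: "p \<in> Sym (HZ \<nu> Z) \<Longrightarrow> p \<in> Sym (H_minus \<nu>)"
proof -
  have "Sym (HZ \<nu> Z) \<subseteq> Sym (H_minus \<nu>)"
    unfolding HZ_def
  proof (rule Sym_span_least[OF Sym_subspace Sym_one])
    fix g p assume g: "g \<in> {hvar i m - hvar j m |i j m. i \<in> {1..\<nu>} \<and> j \<in> {1..\<nu>} \<and> i \<noteq> j \<and> m < 0 \<and> odd m}
      \<union> {hvar i n |i n. i \<in> {1..\<nu>} \<and> n < 0 \<and> odd n \<and> n \<notin> Z}" and p: "p \<in> Sym (H_minus \<nu>)"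
    have "hvar i n \<in> H_minus \<nu>" if "i \<in> {1..\<nu>}" "n < 0" "odd n" for i n
      unfolding H_minus_def by (rule pscale.span_base) (use that in auto)
    then have "g \<in> H_minus \<nu>"
      using g unfolding H_minus_def by (auto intro: pscale.span_diff)
    then show "g * p \<in> Sym (H_minus \<nu>)" using p by (rule Sym_mult)
  qed
  then show "p \<in> Sym (HZ \<nu> Z) \<Longrightarrow> p \<in> Sym (H_minus \<nu>)" by blast
qed

lemma trace_pd_HZ:
  assumes "n \<in> Zneg Z" "p \<in> Sym (HZ \<nu> Z)"
  shows "trace_pd \<nu> n p = 0"
proof -
  have "Sym (HZ \<nu> Z) \<subseteq> {p. trace_pd \<nu> n p = 0}"
    unfolding HZ_def
    by (intro Sym_span_least subspace_kernel trace_pd_lin)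
      (use assms(1) in \<open>auto simp: trace_pd_mult lin_minus[OF trace_pd_lin] trace_pd_hvar Zneg_def\<close>)
  then show ?thesis using assms(2) by blast
qed

text \<open>
  The change of variables behind the decomposition: \<open>\<nu> \<epsilon>\<^sub>i(n) = y\<^sub>n + \<Sum>\<^sub>j (\<epsilon>\<^sub>i(n) - \<epsilon>\<^sub>j(n))\<close>.
\<close>

lemma Sym_H_minus_decompose:
  assumes "\<nu> > 0"
  shows "Sym (H_minus \<nu>) \<subseteq> pscale.span (\<Union>M\<in>{M. set_mset M \<subseteq> Zneg Z}. (*) (trace_monom \<nu> M) ` Sym (HZ \<nu> Z))"
    (is "_ \<subseteq> pscale.span ?G")
proof -
  have base: "trace_monom \<nu> M * s \<in> pscale.span ?G" if "set_mset M \<subseteq> Zneg Z" "s \<in> Sym (HZ \<nu> Z)" for M s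
    by (rule pscale.span_base) (use that in auto)
  show ?thesis
    unfolding H_minus_def
  proof (rule Sym_span_least)
    show "1 \<in> pscale.span ?G" using base[of "{#}" 1] by (simp add: Sym_one)
    fix g p assume g: "g \<in> {hvar i n |i n. i \<in> {1..\<nu>} \<and> n < 0 \<and> odd n}" and p: "p \<in> pscale.span ?G"
    obtain i n where i: "i \<in> {1..\<nu>}" "n < 0" "odd n" "g = hvar i n" using g by blast
    show "g * p \<in> pscale.span ?G"
      using p
    proof (induction rule: pscale.span_induct_alt)
      case (step c x y)
      then obtain M s where M: "set_mset M \<subseteq> Zneg Z" "s \<in> Sym (HZ \<nu> Z)" "x = trace_monom \<nu> M * s" by auto
      have "g * x \<in> pscale.span ?G"
      proof (cases "n \<in> Z")
        case False
        then have "g \<in> HZ \<nu> Z" unfolding HZ_def by (intro pscale.span_base) (use i in auto)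
        from base[OF M(1) Sym_mult[OF this M(2)]] show ?thesis by (simp add: M mult_ac)
      next
        case True
        have d: "hvar i n - hvar j n \<in> HZ \<nu> Z" if "j \<in> {1..\<nu>}" for j
        proof (cases "i = j")
          case False
          then show ?thesis unfolding HZ_def by (intro pscale.span_base) (use i that in auto)
        qed (auto simp: HZ_def pscale.span_zero)
        have "(\<Sum>j\<in>{1..\<nu>}. hvar i n - hvar j n) = pscale (of_nat \<nu>) g - trace_var \<nu> n"
          by (simp add: sum_subtractf trace_var_def i pscale_mult sym_of_nat mult.commute[of _ g] flip: pscale_mult(1))
        then have "pscale (of_nat \<nu>) g - trace_var \<nu> n \<in> HZ \<nu> Z"
          using d unfolding HZ_def by (metis (no_types, lifting) pscale.span_sum)
        from base[OF M(1) Sym_mult[OF this M(2)]]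
        have 1: "trace_monom \<nu> M * ((pscale (of_nat \<nu>) g - trace_var \<nu> n) * s) \<in> pscale.span ?G" .
        have 2: "trace_monom \<nu> (add_mset n M) * s \<in> pscale.span ?G"
          by (rule base) (use M True i in \<open>auto simp: Zneg_def\<close>)
        have "trace_monom \<nu> M * ((pscale (of_nat \<nu>) g - trace_var \<nu> n) * s)
            + trace_monom \<nu> (add_mset n M) * s = pscale (of_nat \<nu>) g * x"
          by (simp add: trace_monom_add M algebra_simps)
        then have "pscale (1 / of_nat \<nu>) (trace_monom \<nu> M * ((pscale (of_nat \<nu>) g - trace_var \<nu> n) * s)
            + trace_monom \<nu> (add_mset n M) * s) = g * x"
          using assms by (simp add: pscale_mult(2))
        then show ?thesis
          using pscale.span_scale[OF pscale.span_add[OF 1 2], of "1 / of_nat \<nu>"] by simp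
      qed
      then show ?case
        unfolding distrib_left pscale_mult(1)[symmetric]
        by (intro pscale.span_add pscale.span_scale step)
    qed (simp add: pscale.span_zero)
  qed simp
qed

lemma subspace_lin_image:
  assumes "lin T" "pscale.subspace S"
  shows "pscale.subspace (T ` S)"
proof (rule pscale.subspaceI)
  show "0 \<in> T ` S"
    by (rule image_eqI[of _ _ 0]) (auto simp: lin_zero[OF assms(1)] pscale.subspace_0[OF assms(2)])
  fix x y assume "x \<in> T ` S" "y \<in> T ` S"
  then obtain p q where pq: "x = T p" "y = T q" "p \<in> S" "q \<in> S" by blast
  show "x + y \<in> T ` S"
    by (rule image_eqI[of _ _ "p + q"]) (use pq assms in \<open>auto simp: lin_def pscale.subspace_add\<close>)
next
  fix c x assume "x \<in> T ` S"
  then obtain p where p: "x = T p" "p \<in> S" by blast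
  show "pscale c x \<in> T ` S"
    by (rule image_eqI[of _ _ "pscale c p"]) (use p assms in \<open>auto simp: lin_def pscale.subspace_scale\<close>)
qed

text \<open>
  Decompose an element of the kernel as a sum of \<open>y\<^sup>M s\<^sub>M\<close>.  The element is annihilated by all
  \<open>y\<^sub>n D\<^sub>n\<close>, so it has the eigenvalues of the component with \<open>M\<close> empty and agrees with it.
\<close>

lemma Sym_HZ_eq:
  assumes "\<nu> > 0"
  shows "Sym (HZ \<nu> Z) = {p \<in> Sym (H_minus \<nu>). \<forall>n\<in>Zneg Z. trace_pd \<nu> n p = 0}"
proof (intro equalityI subsetI)
  fix p assume "p \<in> Sym (HZ \<nu> Z)"
  then show "p \<in> {p \<in> Sym (H_minus \<nu>). \<forall>n\<in>Zneg Z. trace_pd \<nu> n p = 0}"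
    by (auto intro: Sym_HZ_imp_Sym_H_minus trace_pd_HZ)
next
  fix p assume p: "p \<in> {p \<in> Sym (H_minus \<nu>). \<forall>n\<in>Zneg Z. trace_pd \<nu> n p = 0}"
  then have "p \<in> pscale.span (\<Union>M\<in>{M. set_mset M \<subseteq> Zneg Z}. (*) (trace_monom \<nu> M) ` Sym (HZ \<nu> Z))"
    using Sym_H_minus_decompose[OF assms] by blast
  then obtain A g where A: "finite A" "A \<subseteq> {M. set_mset M \<subseteq> Zneg Z}"
     "\<And>M. M \<in> A \<Longrightarrow> g M \<in> (*) (trace_monom \<nu> M) ` Sym (HZ \<nu> Z)" "p = sum g A"
    by (rule pscale.span_UN_decompose[rotated]) (auto intro: subspace_lin_image lin_mult Sym_subspace)
  \<comment> \<open>The decomposition of \<open>p\<close> is rewritten as a vanishing sum in which \<open>-p\<close> joins the empty monomial.\<close>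
  let ?g = "\<lambda>M. (if M = {#} then - p else 0) + (if M \<in> A then g M else 0)"
  let ?T = "\<lambda>n q. trace_var \<nu> n * trace_pd \<nu> n q"
  have eig: "?T n (g M) = pscale (of_nat (\<nu> * count M n)) (g M)" if "M \<in> A" "n \<in> Zneg Z" for M n
    using A(3)[OF that(1)] trace_euler trace_pd_HZ[OF that(2)] by auto
  have "sum ?g (insert {#} A) = - p + p"
    using A by (simp add: sum.distrib sum.delta' sum.inter_restrict[symmetric] Int_insert_left insert_absorb)
  then have "\<forall>M\<in>insert {#} A. ?g M \<in> {0}"
  proof (intro pscale.joint_eigen_components[where T = ?T and K = "Zneg Z" and lam = "\<lambda>M n. of_nat (\<nu> * count M n)"])
    have l: "lin (?T n)" for n by (rule lin_comp[OF lin_mult trace_pd_lin])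
    then show "?T n (x + y) = ?T n x + ?T n y" "?T n (pscale c x) = pscale c (?T n x)" for n x y c
      by (auto simp: lin_def)
    fix M n assume M: "M \<in> insert {#} A" "n \<in> Zneg Z"
    show "?T n (?g M) = pscale (of_nat (\<nu> * count M n)) (?g M)"
    proof -
      let ?c = "of_nat (\<nu> * count M n) :: complex"
      have "?T n (if M \<in> A then g M else 0) = pscale ?c (if M \<in> A then g M else 0)"
        using eig[of M n] M by (cases "M \<in> A") (simp_all add: lin_zero[OF trace_pd_lin] del: of_nat_mult)
      moreover have "?T n (if M = {#} then - p else 0) = pscale ?c (if M = {#} then - p else 0)"
        using p M lin_minus[OF trace_pd_lin, of \<nu> n 0 p]
        by (cases "M = {#}") (simp_all add: lin_zero[OF trace_pd_lin])
      moreover have "?T n (x + y) = ?T n x + ?T n y" for x y using l[of n] by (simp add: lin_def)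
      ultimately show ?thesis by (metis pscale.scale_right_distrib)
    qed
  next
    fix M M' assume M: "M \<in> insert {#} A" "M' \<in> insert {#} A" "M \<noteq> M'"
    then obtain n where n: "count M n \<noteq> count M' n" by (meson multiset_eqI)
    then have "n \<in># M \<or> n \<in># M'" by (metis count_eq_zero_iff)
    then have "n \<in> Zneg Z" using M A(2) by auto
    then show "\<exists>n\<in>Zneg Z. (of_nat (\<nu> * count M n) :: complex) \<noteq> of_nat (\<nu> * count M' n)"
      using n assms by (intro bexI[of _ n]) (auto simp del: of_nat_mult)
  qed (use A in \<open>auto simp: pscale.subspace_def lin_zero[OF trace_pd_lin]\<close>)
  then have "p = (if {#} \<in> A then g {#} else 0)" by (auto split: if_splits)
  then show "p \<in> Sym (HZ \<nu> Z)"
    using A(3)[of "{#}"] by (auto simp: pscale.subspace_0[OF Sym_subspace])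
qed


section \<open>Heisenberg commutation relations of exponential series\<close>

text \<open>
  In terms of generating series: \<open>[h, F(z)] = c z\<^bsup>-r\<^esup> F(z)\<close>, as for an operator \<open>h\<close> pairing with the
  mode \<open>r\<close> only and an exponential of Heisenberg modes.
\<close>

definition series_comm :: "(sym \<Rightarrow> sym) \<Rightarrow> complex \<Rightarrow> int \<Rightarrow> ser \<Rightarrow> bool" where
  "series_comm h c r F \<longleftrightarrow> (\<forall>n v. h (F n v) = F n (h v) + pscale c (F (n - r) v))"

lemma Sum_any_shift: "Sum_any (\<lambda>s::int. g (s - r)) = Sum_any g"
  by (rule Sum_any.reindex_cong[of "\<lambda>s. s - r", symmetric])
    (auto intro!: bij_betw_byWitness[of _ "\<lambda>s. s + r"])

lemma finite_shift: "finite {s::int. P s} \<Longrightarrow> finite {s. P (s - r)}"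
proof -
  assume "finite {s. P s}"
  then have "finite ((\<lambda>s. s + r) ` {s. P s})" by simp
  moreover have "(\<lambda>s. s + r) ` {s. P s} = {s. P (s - r)}" by (auto simp: image_iff) (metis diff_add_cancel)
  ultimately show ?thesis by simp
qed

text \<open>
  Logarithmic derivatives add under products.
\<close>

lemma series_comm_mult:
  assumes h: "lin h" and F: "series_comm h c r F" "\<And>n. lin (F n)" and G: "series_comm h d r G"
    and fin: "\<And>n v. finite {s. F (n - s) (G s v) \<noteq> 0}"
  shows "series_comm h (c + d) r (ser_mult F G)"
  unfolding series_comm_def
proof (intro allI)
  fix n v
  let ?a = "\<lambda>s. F (n - s) (G s (h v))"
  let ?b = "\<lambda>s. pscale d (F (n - s) (G (s - r) v))"
  let ?c = "\<lambda>s. pscale c (F (n - r - s) (G s v))"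
  have fb: "finite {s. F (n - s) (G (s - r) v) \<noteq> 0}"
    using finite_shift[OF fin[of "n - r" v], of r] by simp
  have fin_b: "finite {s. ?b s \<noteq> 0}"
    by (rule finite_subset[OF _ fb]) auto
  have fin_c: "finite {s. ?c s \<noteq> 0}"
    by (rule finite_subset[OF _ fin[of "n - r" v]]) auto
  have fin_bc: "finite {s. ?b s + ?c s \<noteq> 0}"
    by (rule finite_subset[OF _ finite_UnI[OF fin_b fin_c]]) auto
  have *: "F (n - s - r) w = F (n - r - s) w" for s w by (simp add: algebra_simps)
  have "h (ser_mult F G n v) = Sum_any (\<lambda>s. h (F (n - s) (G s v)))"
    unfolding ser_mult_def by (rule lin_Sum_any[OF h fin])
  also have "\<dots> = Sum_any (\<lambda>s. ?a s + (?b s + ?c s))"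
    using F G by (simp add: series_comm_def lin_def * add.assoc)
  also have "\<dots> = Sum_any ?a + (Sum_any ?b + Sum_any ?c)"
    by (simp only: Sum_any.distrib[OF fin fin_bc] Sum_any.distrib[OF fin_b fin_c])
  also have "Sum_any ?b = pscale d (Sum_any (\<lambda>s. F (n - s) (G (s - r) v)))"
    by (rule lin_Sum_any[OF pscale_lin fb, symmetric])
  also have "Sum_any (\<lambda>s. F (n - s) (G (s - r) v)) = Sum_any (\<lambda>s. F (n - r - s) (G s v))"
    using Sum_any_shift[of "\<lambda>s. F (n - r - s) (G s v)" r] by simp
  also have "Sum_any ?c = pscale c (Sum_any (\<lambda>s. F (n - r - s) (G s v)))"
    by (rule lin_Sum_any[OF pscale_lin fin, symmetric])
  finally show "h (ser_mult F G n v) = ser_mult F G n (h v) + pscale (c + d) (ser_mult F G (n - r) v)"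
    by (simp add: ser_mult_def pscale.scale_left_distrib algebra_simps)
qed

text \<open>
  In terms of generating series: \<open>[h, A(z)]\<close> is the scalar \<open>c z\<^bsup>-r\<^esup>\<close>.
\<close>

definition central_comm :: "(sym \<Rightarrow> sym) \<Rightarrow> complex \<Rightarrow> int \<Rightarrow> ser \<Rightarrow> bool" where
  "central_comm h c r A \<longleftrightarrow> (\<forall>n v. h (A n v) = A n (h v) + (if n = r then pscale c v else 0))"

text \<open>
  The Leibniz rule: as \<open>[h, A]\<close> is central, \<open>[h, A\<^sup>k] = k [h, A] A\<^bsup>k-1\<^esup>\<close>.
\<close>

lemma central_comm_pow:
  assumes A: "onesided e A" and h: "lin h" and c: "central_comm h c r A"
  shows "h (ser_pow A k n v) = ser_pow A k n (h v) + pscale (of_nat k * c) (ser_pow A (k - 1) (n - r) v)"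
proof (induction k arbitrary: n v)
  case 0
  then show ?case by (simp add: ser_one_def lin_zero[OF h])
next
  case (Suc k)
  let ?P = "ser_pow A k" and ?Q = "ser_pow A (k - 1)"
  have linA: "lin (A n)" for n using A by (simp add: onesided_def)
  let ?a = "\<lambda>s. A (n - s) (?P s (h v))"
  let ?b = "\<lambda>s. pscale (of_nat k * c) (A (n - s) (?Q (s - r) v))"
  let ?c = "\<lambda>s. (if s = n - r then pscale c (?P (n - r) v) else 0)"
  have fb: "finite {s. A (n - s) (?Q (s - r) v) \<noteq> 0}"
    using finite_shift[OF ser_pow_fin[OF A, of "n - r" "k - 1" v], of r] by simp
  have fin_b: "finite {s. ?b s \<noteq> 0}"
    by (rule finite_subset[OF _ fb]) auto
  have fin_c: "finite {s. ?c s \<noteq> 0}"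
    by (rule finite_subset[of _ "{n - r}"]) auto
  have fin_bc: "finite {s. ?b s + ?c s \<noteq> 0}"
    by (rule finite_subset[OF _ finite_UnI[OF fin_b fin_c]]) auto
  have "h (ser_pow A (Suc k) n v) = Sum_any (\<lambda>s. h (A (n - s) (?P s v)))"
    by (simp add: ser_mult_def lin_Sum_any[OF h ser_pow_fin[OF A]])
  also have "\<dots> = Sum_any (\<lambda>s. ?a s + (?b s + ?c s))"
  proof (rule Sum_any.cong)
    fix s
    have "h (A (n - s) (?P s v)) = A (n - s) (h (?P s v)) + (if n - s = r then pscale c (?P s v) else 0)"
      using c by (simp add: central_comm_def)
    moreover have "A (n - s) (h (?P s v)) = ?a s + ?b s"
      using linA[of "n - s"] by (simp add: Suc lin_def)
    ultimately show "h (A (n - s) (?P s v)) = ?a s + (?b s + ?c s)"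
      by (auto simp: add.assoc algebra_simps)
  qed
  also have "\<dots> = Sum_any ?a + (Sum_any ?b + Sum_any ?c)"
    by (simp only: Sum_any.distrib[OF ser_pow_fin[OF A] fin_bc] Sum_any.distrib[OF fin_b fin_c])
  also have "Sum_any ?a = ser_pow A (Suc k) n (h v)" by (simp add: ser_mult_def)
  also have "Sum_any ?b = pscale (of_nat k * c) (Sum_any (\<lambda>s. A (n - s) (?Q (s - r) v)))"
    by (rule lin_Sum_any[OF pscale_lin fb, symmetric])
  also have "Sum_any (\<lambda>s. A (n - s) (?Q (s - r) v)) = Sum_any (\<lambda>s. A (n - r - s) (?Q s v))"
    using Sum_any_shift[of "\<lambda>s. A (n - r - s) (?Q s v)" r] by simp
  also have "pscale (of_nat k * c) \<dots> = pscale (of_nat k * c) (?P (n - r) v)"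
    by (cases k) (simp_all add: ser_mult_def)
  also have "Sum_any ?c = pscale c (?P (n - r) v)"
    by (subst Sum_any.expand_superset[of "{n - r}"]) auto
  finally show ?case
    by (simp add: distrib_right pscale.scale_left_distrib add.commute)
qed

text \<open>
  The exponential of a series without constant term is a finite sum in each degree.  The bound \<open>K\<close> is free, so that two
  coefficients can be expanded with the same number of terms.
\<close>

lemma ser_exp_finite:
  assumes A: "onesided e A" and K: "nat \<bar>n\<bar> \<le> K"
  shows "ser_exp A n v = (\<Sum>k\<le>K. pscale (1 / fact k) (ser_pow A k n v))"
  unfolding ser_exp_def
proof (rule Sum_any.expand_superset)
  show "{k. pscale (1 / fact k) (ser_pow A k n v) \<noteq> 0} \<subseteq> {..K}"
  proof
    fix k assume "k \<in> {k. pscale (1 / fact k) (ser_pow A k n v) \<noteq> 0}"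
    then have "ser_pow A k n v \<noteq> 0" by auto
    then have "e * n \<ge> int k" using ser_pow_supp[OF A] by blast
    then show "k \<in> {..K}" using A K by (auto simp: onesided_def)
  qed
qed simp

text \<open>
  Sum the Leibniz rule over \<open>A\<^sup>k / k!\<close>: the derivative of an exponential.
\<close>

lemma series_comm_exp:
  assumes A: "onesided e A" and h: "lin h" and c: "central_comm h c r A"
  shows "series_comm h c r (ser_exp A)"
  unfolding series_comm_def
proof (intro allI)
  fix n v
  let ?K = "max (nat \<bar>n\<bar>) (nat \<bar>n - r\<bar>)"
  have "h (ser_exp A n v) = h (\<Sum>k\<le>Suc ?K. pscale (1 / fact k) (ser_pow A k n v))"
    by (subst ser_exp_finite[OF A, of n "Suc ?K"]) auto
  also have "\<dots> = (\<Sum>k\<le>Suc ?K. pscale (1 / fact k) (h (ser_pow A k n v)))"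
    using h by (subst lin_finite_sum[OF h]) (simp add: lin_def)
  also have "\<dots> = (\<Sum>k\<le>Suc ?K. pscale (1 / fact k) (ser_pow A k n (h v)))
      + (\<Sum>k\<le>Suc ?K. pscale (of_nat k * c / fact k) (ser_pow A (k - 1) (n - r) v))"
    unfolding sum.distrib[symmetric]
    by (intro sum.cong refl) (simp add: central_comm_pow[OF A h c] pscale.scale_right_distrib)
  also have "(\<Sum>k\<le>Suc ?K. pscale (1 / fact k) (ser_pow A k n (h v))) = ser_exp A n (h v)"
    by (rule ser_exp_finite[OF A, symmetric]) simp
  also have "(\<Sum>k\<le>Suc ?K. pscale (of_nat k * c / fact k) (ser_pow A (k - 1) (n - r) v))
      = (\<Sum>k\<le>?K. pscale (of_nat (Suc k) * c / fact (Suc k)) (ser_pow A k (n - r) v))"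
    by (subst sum.atMost_Suc_shift) simp
  also have "\<dots> = (\<Sum>k\<le>?K. pscale c (pscale (1 / fact k) (ser_pow A k (n - r) v)))"
  proof (rule sum.cong[OF refl])
    fix k :: nat
    have "(of_nat (Suc k) :: complex) * c / fact (Suc k) = c * (1 / fact k)"
      by (simp del: of_nat_Suc)
    then show "pscale (of_nat (Suc k) * c / fact (Suc k)) (ser_pow A k (n - r) v)
      = pscale c (pscale (1 / fact k) (ser_pow A k (n - r) v))" by simp
  qed
  also have "\<dots> = pscale c (ser_exp A (n - r) v)"
    by (subst ser_exp_finite[OF A, of "n - r" ?K]) (auto simp: pscale.scale_sum_right)
  finally show "h (ser_exp A n v) = ser_exp A n (h v) + pscale c (ser_exp A (n - r) v)" .
qed

section \<open>Local finiteness of the vertex operators\<close>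

text \<open>
  All monomials have weight at most \<open>W\<close>, where \<open>\<epsilon>\<^sub>i(n)\<close> has weight \<open>\<bar>n\<bar>\<close>.  The coefficients of
  \<open>E\<^sub>+\<close> lower this weight, which is why products of the form \<open>E\<^sub>- E\<^sub>+\<close> are finite sums on every vector.
\<close>

definition weight_le :: "int \<Rightarrow> sym \<Rightarrow> bool" where
  "weight_le W p \<longleftrightarrow> (\<forall>m. Poly_Mapping.lookup p m \<noteq> 0 \<longrightarrow> int (mdeg (\<lambda>v. nat \<bar>snd v\<bar>) m) \<le> W)"

lemma weight_le_exists: "\<exists>W. weight_le W p"
proof
  let ?f = "\<lambda>m. int (mdeg (\<lambda>v. nat \<bar>snd v\<bar>) m)"
  show "weight_le (\<Sum>m\<in>Poly_Mapping.keys p. ?f m) p"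
    unfolding weight_le_def by (auto intro!: member_le_sum simp: in_keys_iff)
qed

lemma weight_le_neg: "weight_le W p \<Longrightarrow> W < 0 \<Longrightarrow> p = 0"
  by (rule poly_mapping_eqI) (force simp: weight_le_def)

lemma weight_le_zero [simp]: "weight_le W 0"
  by (simp add: weight_le_def)

lemma weight_le_add: "weight_le W p \<Longrightarrow> weight_le W q \<Longrightarrow> weight_le W (p + q)"
  unfolding weight_le_def by (metis add_0 lookup_add)

lemma weight_le_pscale: "weight_le W p \<Longrightarrow> weight_le W (pscale c p)"
  by (simp add: weight_le_def)

lemma weight_le_Sum_any: "(\<And>s. weight_le W (g s)) \<Longrightarrow> weight_le W (Sum_any g)"
proof -
  assume g: "\<And>s. weight_le W (g s)"
  have "weight_le W (sum g A)" for A
    by (induction A rule: infinite_finite_induct) (auto intro: weight_le_add g)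
  then show ?thesis by (simp add: Sum_any.expand_set)
qed

definition lowering :: "ser \<Rightarrow> bool" where
  "lowering F \<longleftrightarrow> (\<forall>W n v. weight_le W v \<longrightarrow> weight_le (W - n) (F n v))"

lemma lowering_mult: "lowering F \<Longrightarrow> lowering G \<Longrightarrow> lowering (ser_mult F G)"
  unfolding lowering_def ser_mult_def
proof (intro allI impI weight_le_Sum_any)
  fix W n v s
  assume F: "\<forall>W n v. weight_le W v \<longrightarrow> weight_le (W - n) (F n v)"
    and G: "\<forall>W n v. weight_le W v \<longrightarrow> weight_le (W - n) (G n v)" and v: "weight_le W v"
  have "weight_le (W - s - (n - s)) (F (n - s) (G s v))" using F G v by blast
  then show "weight_le (W - n) (F (n - s) (G s v))" by simp
qed

lemma lowering_exp: "lowering A \<Longrightarrow> lowering (ser_exp A)"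
proof -
  assume A: "lowering A"
  have "lowering (ser_pow A k)" for k
  proof (induction k)
    case 0
    show ?case by (auto simp: lowering_def ser_one_def)
  next
    case (Suc k)
    then show ?case using A by (simp add: lowering_mult)
  qed
  then show ?thesis
    unfolding lowering_def ser_exp_def by (intro allI impI weight_le_Sum_any weight_le_pscale) blast
qed

lemma weight_le_heis:
  assumes "n > 0" "weight_le W p"
  shows "weight_le (W - n) (heis i n p)"
  unfolding weight_le_def
proof (intro allI impI)
  fix m assume "Poly_Mapping.lookup (heis i n p) m \<noteq> 0"
  then have "Poly_Mapping.lookup p (m + Poly_Mapping.single (i, - n) 1) \<noteq> 0"
    using assms(1) by (auto simp: heis_def lookup_pd)
  then have "int (mdeg (\<lambda>v. nat \<bar>snd v\<bar>) (m + Poly_Mapping.single (i, - n) 1)) \<le> W"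
    using assms(2) unfolding weight_le_def by blast
  then show "int (mdeg (\<lambda>v. nat \<bar>snd v\<bar>) m) \<le> W - n"
    using assms(1) unfolding mdeg_add_var by simp
qed

lemma heis_lat_eps: "heis_lat (eps i) n = heis i n"
  by (simp add: fun_eq_iff heis_lat_def eps_def psum_single)

lemma lowering_expo: "\<alpha> \<in> {eps i, - eps i} \<Longrightarrow> lowering (expo 1 \<alpha> a)"
  unfolding lowering_def expo_def
proof (intro allI impI)
  fix W n v assume v: "weight_le W v" and \<alpha>: "\<alpha> \<in> {eps i, - eps i}"
  have "weight_le (W - n) (heis_lat \<alpha> n v)" if "n > 0"
    using weight_le_heis[OF that v, of i] \<alpha> weight_le_pscale[OF weight_le_heis[OF that v, of i], of "-1"]
    by (auto simp: heis_lat_uminus heis_lat_eps)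
  then show "weight_le (W - n) (if odd n \<and> 1 * n > 0
     then pscale (- 2 / of_int n * a powi (- n)) (heis_lat \<alpha> n v) else 0)"
    by (auto intro: weight_le_pscale simp del: pscale.scale_minus_left)
qed

lemma exp_expo_lin: "e \<in> {1, -1} \<Longrightarrow> lin (ser_exp (expo e \<alpha> a) n)"
  by (rule ser_exp_lin[OF expo_onesided])

lemma exp_expo_supp:
  assumes "e \<in> {1, -1}" "ser_exp (expo e \<alpha> a) n v \<noteq> 0"
  shows "e * n \<ge> 0"
proof -
  obtain k where "pscale (1 / fact k) (ser_pow (expo e \<alpha> a) k n v) \<noteq> 0"
    using assms(2) Sum_any.not_neutral_obtains_not_neutral unfolding ser_exp_def by blast
  then have "ser_pow (expo e \<alpha> a) k n v \<noteq> 0" by auto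
  then show ?thesis using ser_pow_supp[OF expo_onesided[OF assms(1)], of \<alpha> a k n v] by linarith
qed

text \<open>
  The factor \<open>E\<^sub>-(\<epsilon>\<^sub>i,z) E\<^sub>-(-\<epsilon>\<^sub>j,az)\<close> of the vertex operator for \<open>e = -1\<close>, and its counterpart
  with \<open>E\<^sub>+\<close> for \<open>e = 1\<close>.
\<close>

definition half_prod :: "int \<Rightarrow> nat \<Rightarrow> nat \<Rightarrow> complex \<Rightarrow> ser" where
  "half_prod e i j a = ser_mult (ser_exp (expo e (eps i) 1)) (ser_exp (expo e (- eps j) a))"

lemma E_prod_half: "E_prod i j a = ser_mult (half_prod (-1) i j a) (half_prod 1 i j a)"
  by (simp add: E_prod_def half_prod_def E_minus_expo E_plus_expo)

lemma half_term_supp: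
  assumes e: "e \<in> {1, -1}"
    and nz: "ser_exp (expo e \<alpha> a) (n - s) (ser_exp (expo e \<beta> b) s v) \<noteq> 0"
  shows "0 \<le> e * s" "e * s \<le> e * n"
proof -
  have "ser_exp (expo e \<beta> b) s v \<noteq> 0"
    using nz lin_zero[OF exp_expo_lin[OF e]] by auto
  then show "0 \<le> e * s" by (rule exp_expo_supp[OF e])
  show "e * s \<le> e * n"
    using exp_expo_supp[OF e nz] by (simp add: algebra_simps)
qed

lemma half_fin:
  assumes e: "e \<in> {1, -1}"
  shows "finite {s. ser_exp (expo e \<alpha> a) (n - s) (ser_exp (expo e \<beta> b) s v) \<noteq> 0}"
proof (rule finite_subset)
  show "{s. ser_exp (expo e \<alpha> a) (n - s) (ser_exp (expo e \<beta> b) s v) \<noteq> 0} \<subseteq> {- \<bar>n\<bar> .. \<bar>n\<bar>}"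
  proof
    fix s assume "s \<in> {s. ser_exp (expo e \<alpha> a) (n - s) (ser_exp (expo e \<beta> b) s v) \<noteq> 0}"
    then have "ser_exp (expo e \<alpha> a) (n - s) (ser_exp (expo e \<beta> b) s v) \<noteq> 0" by simp
    from half_term_supp[OF e this] show "s \<in> {- \<bar>n\<bar> .. \<bar>n\<bar>}" using e by auto
  qed
qed simp

lemma half_prod_lin: "e \<in> {1, -1} \<Longrightarrow> lin (half_prod e i j a n)"
  unfolding half_prod_def ser_mult_def[abs_def]
  by (intro lin_sum lin_comp[OF exp_expo_lin exp_expo_lin] half_fin)

lemma half_prod_supp:
  assumes e: "e \<in> {1, -1}" and nz: "half_prod e i j a n v \<noteq> 0"
  shows "e * n \<ge> 0"
proof -
  obtain s where "ser_exp (expo e (eps i) 1) (n - s) (ser_exp (expo e (- eps j) a) s v) \<noteq> 0"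
    using nz Sum_any.not_neutral_obtains_not_neutral unfolding half_prod_def ser_mult_def by blast
  from half_term_supp[OF e this] show ?thesis by simp
qed

lemma half_prod_lowering: "lowering (half_prod 1 i j a)"
  unfolding half_prod_def by (intro lowering_mult lowering_exp lowering_expo[of _ i] lowering_expo[of _ j]) auto

lemma half_prod_bound:
  assumes "weight_le W v" "half_prod 1 i j a n v \<noteq> 0"
  shows "0 \<le> n" "n \<le> W"
proof -
  show "0 \<le> n" using half_prod_supp[of 1 i j a n v] assms(2) by simp
  have "weight_le (W - n) (half_prod 1 i j a n v)"
    using half_prod_lowering assms(1) unfolding lowering_def by blast
  then show "n \<le> W" using weight_le_neg assms(2) by force
qed

lemma E_prod_fin: "finite {s. half_prod (-1) i j a (n - s) (half_prod 1 i j a s v) \<noteq> 0}"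
proof -
  obtain W where W: "weight_le W v" using weight_le_exists by blast
  have "{s. half_prod (-1) i j a (n - s) (half_prod 1 i j a s v) \<noteq> 0} \<subseteq> {0..W}"
  proof
    fix s assume "s \<in> {s. half_prod (-1) i j a (n - s) (half_prod 1 i j a s v) \<noteq> 0}"
    then have "half_prod 1 i j a s v \<noteq> 0"
      using lin_zero[OF half_prod_lin[of "-1"]] by auto
    from half_prod_bound[OF W this] show "s \<in> {0..W}" by simp
  qed
  then show ?thesis by (rule finite_subset) simp
qed

lemma E_prod_lin: "lin (E_prod i j a n)"
  unfolding E_prod_half ser_mult_def[abs_def]
  by (intro lin_sum lin_comp[OF half_prod_lin half_prod_lin] E_prod_fin) auto

lemma half_prod_0:
  assumes e: "e \<in> {1, -1}"
  shows "half_prod e i j a 0 v = v"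
proof -
  have 1: "ser_exp (expo e \<alpha> b) 0 w = w" for \<alpha> b w
    by (simp add: ser_exp_finite[OF expo_onesided[OF e], of 0 0] ser_one_def)
  have "half_prod e i j a 0 v = (\<Sum>s\<in>{0}. ser_exp (expo e (eps i) 1) (0 - s) (ser_exp (expo e (- eps j) a) s v))"
    unfolding half_prod_def ser_mult_def
  proof (rule Sum_any.expand_superset)
    show "{s. ser_exp (expo e (eps i) 1) (0 - s) (ser_exp (expo e (- eps j) a) s v) \<noteq> 0} \<subseteq> {0}"
    proof
      fix s assume "s \<in> {s. ser_exp (expo e (eps i) 1) (0 - s) (ser_exp (expo e (- eps j) a) s v) \<noteq> 0}"
      then have "ser_exp (expo e (eps i) 1) (0 - s) (ser_exp (expo e (- eps j) a) s v) \<noteq> 0" by simp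
      from half_term_supp[OF e this] show "s \<in> {0}" using e by auto
    qed
  qed simp
  then show ?thesis by (simp add: 1)
qed

text \<open>
  A constant is killed by all annihilation operators, and the coefficient of \<open>z\<^sup>0\<close> in the creation part
  is the identity.
\<close>

lemma E_prod_const: "E_prod i j a 0 (Poly_Mapping.single 0 c) = Poly_Mapping.single 0 c"
proof -
  have W: "weight_le 0 (Poly_Mapping.single 0 c)"
    by (auto simp: weight_le_def lookup_single when_def)
  have "E_prod i j a 0 (Poly_Mapping.single 0 c)
    = (\<Sum>s\<in>{0}. half_prod (-1) i j a (0 - s) (half_prod 1 i j a s (Poly_Mapping.single 0 c)))"
    unfolding E_prod_half ser_mult_def
  proof (rule Sum_any.expand_superset)
    show "{s. half_prod (-1) i j a (0 - s) (half_prod 1 i j a s (Poly_Mapping.single 0 c)) \<noteq> 0} \<subseteq> {0}"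
    proof
      fix s assume "s \<in> {s. half_prod (-1) i j a (0 - s) (half_prod 1 i j a s (Poly_Mapping.single 0 c)) \<noteq> 0}"
      then have "half_prod 1 i j a s (Poly_Mapping.single 0 c) \<noteq> 0"
        using lin_zero[OF half_prod_lin[of "-1"]] by auto
      from half_prod_bound[OF W this] show "s \<in> {0}" by simp
    qed
  qed simp
  then show ?thesis by (simp add: half_prod_0)
qed

section \<open>Heisenberg operators commuting with the vertex operators\<close>

text \<open>
  The operator \<open>h\<close> pairs with every \<open>\<epsilon>\<^sub>i(r)\<close>, \<open>i \<le> \<nu>\<close>, in the same way and commutes with the other modes.
  This uniform treatment covers \<open>D\<^sub>n\<close> (\<open>r = n\<close>), multiplication by \<open>y\<^sub>n\<close> (\<open>r = -n\<close>), and the derivatives by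
  variables outside \<open>H\<^sup>-\<close> (\<open>c = 0\<close>).
\<close>

definition heis_central :: "nat \<Rightarrow> (sym \<Rightarrow> sym) \<Rightarrow> complex \<Rightarrow> int \<Rightarrow> bool" where
  "heis_central \<nu> h c r \<longleftrightarrow> lin h \<and> odd r \<and> (\<forall>i\<in>{1..\<nu>}. \<forall>m p. odd m \<longrightarrow>
     h (heis i m p) = heis i m (h p) + (if m = r then pscale c p else 0))"

lemma expo_central:
  assumes h: "heis_central \<nu> h c r" and i: "i \<in> {1..\<nu>}"
  shows "central_comm h (if e * r > 0 then - 2 / of_int r * a powi (- r) * c else 0) r (expo e (eps i) a)"
    and "central_comm h (if e * r > 0 then 2 / of_int r * a powi (- r) * c else 0) r (expo e (- eps i) a)"
proof -
  have l: "lin h" and r: "odd r" using h by (auto simp: heis_central_def)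
  have n: "h (- x) = - h x" for x using lin_minus[OF l, of 0 x] by (simp add: lin_zero[OF l])
  have s: "h (pscale d x) = pscale d (h x)" for d x using l by (simp add: lin_def)
  have c: "h (heis i m p) = heis i m (h p) + (if m = r then pscale c p else 0)" if "odd m" for m p
    using h i that by (auto simp: heis_central_def)
  show "central_comm h (if e * r > 0 then - 2 / of_int r * a powi (- r) * c else 0) r (expo e (eps i) a)"
    unfolding central_comm_def expo_def heis_lat_eps
    by (auto simp: s c r n lin_zero[OF l] pscale.scale_right_distrib)
  show "central_comm h (if e * r > 0 then 2 / of_int r * a powi (- r) * c else 0) r (expo e (- eps i) a)"
    unfolding central_comm_def expo_def heis_lat_eps heis_lat_uminus
    by (auto simp: s c r n lin_zero[OF l] pscale.scale_right_distrib pscale.scale_right_diff_distrib)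
qed

text \<open>
  The commutators of \<open>h\<close> with the exponentials of \<open>\<epsilon>\<^sub>i(z)\<close> and of \<open>-\<epsilon>\<^sub>j(az)\<close> have the factors
  \<open>-2c/r\<close> and \<open>2c a\<^bsup>-r\<^esup>/r\<close>, which cancel when \<open>a\<^sup>r = 1\<close>.
\<close>

lemma E_prod_comm:
  assumes h: "heis_central \<nu> h c r" and ij: "i \<in> {1..\<nu>}" "j \<in> {1..\<nu>}"
    and a: "c \<noteq> 0 \<Longrightarrow> a powi r = 1"
  shows "h (E_prod i j a n v) = E_prod i j a n (h v)"
proof -
  have l: "lin h" using h by (auto simp: heis_central_def)
  have half: "series_comm h 0 r (half_prod e i j a)" if e: "e \<in> {1, -1}" for e
  proof -
    let ?c = "if e * r > 0 then - 2 / of_int r * 1 powi (- r) * c else 0"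
    let ?d = "if e * r > 0 then 2 / of_int r * a powi (- r) * c else 0"
    have "series_comm h (?c + ?d) r (half_prod e i j a)"
      unfolding half_prod_def
      by (intro series_comm_mult l series_comm_exp[OF expo_onesided[OF e]] expo_central[OF h] ij
          exp_expo_lin half_fin e)
    moreover have "?c + ?d = 0" using a by (cases "c = 0") (auto simp: power_int_minus)
    ultimately show ?thesis by metis
  qed
  have "series_comm h (0 + 0) r (E_prod i j a)"
    unfolding E_prod_half
    by (intro series_comm_mult l half half_prod_lin E_prod_fin) auto
  then show ?thesis by (simp add: series_comm_def)
qed

lemma heis_central_pd: "\<not> is_var \<nu> v \<Longrightarrow> heis_central \<nu> (pd v) 0 1"
  unfolding heis_central_def
  by (auto simp: lin_pd heis_def pd_mult pd_hvar pd_pscale pd_commute is_var_def)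

lemma trace_pd_commute: "trace_pd \<nu> n (pd v p) = pd v (trace_pd \<nu> n p)"
  unfolding trace_pd_def lin_finite_sum[OF lin_pd] by (simp add: pd_commute)

lemma heis_central_trace_pd:
  assumes "n < 0" "odd n"
  shows "heis_central \<nu> (trace_pd \<nu> n) 1 n"
proof -
  have s: "trace_pd \<nu> n (pscale d x) = pscale d (trace_pd \<nu> n x)" for d x
    using trace_pd_lin[of \<nu> n] by (simp add: lin_def)
  show ?thesis
    unfolding heis_central_def using assms
    by (auto simp: trace_pd_lin heis_def trace_pd_mult trace_pd_hvar s trace_pd_commute)
qed

lemma pd_trace_var: "i \<in> {1..\<nu>} \<Longrightarrow> pd (i, n) (trace_var \<nu> m) = of_bool (n = m)"
  unfolding trace_var_def lin_finite_sum[OF lin_pd] by (simp add: pd_hvar sum.delta)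

lemma heis_central_trace_var:
  assumes "n < 0" "odd n"
  shows "heis_central \<nu> ((*) (trace_var \<nu> n)) (of_int n / 2) (- n)"
  unfolding heis_central_def using assms
  by (auto simp: lin_mult heis_def mult.left_commute pd_mult pd_trace_var pscale_mult(1)[symmetric]
      pscale.scale_right_distrib)


section \<open>The twisted group algebra is a Clifford algebra\<close>

lemma cocyc_square: "cocyc \<alpha> \<beta> * cocyc \<alpha> \<beta> = 1"
  unfolding cocyc_def by (simp flip: power_int_mult_distrib)

lemma lookup_rep2: "Poly_Mapping.lookup (rep2 A) i = of_bit (Poly_Mapping.lookup A i)"
  by (simp add: rep2_def Poly_Mapping.map.rep_eq when_def)

text \<open>
  The representatives are additive up to \<open>2\<Gamma>\<close>, and the bimultiplicative cocycle with values \<open>\<plusminus>1\<close> is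
  trivial on \<open>2\<Gamma>\<close>.
\<close>

lemma rep2_add: "\<exists>\<delta>. rep2 A + rep2 B = rep2 (A + B) + (\<delta> + \<delta>)"
proof
  \<comment> \<open>The carry bits of the addition modulo 2.\<close>
  let ?d = "Poly_Mapping.map (\<lambda>x. x div 2) (rep2 A + rep2 B - rep2 (A + B))"
  show "rep2 A + rep2 B = rep2 (A + B) + (?d + ?d)"
  proof (rule poly_mapping_eqI)
    fix i
    show "Poly_Mapping.lookup (rep2 A + rep2 B) i = Poly_Mapping.lookup (rep2 (A + B) + (?d + ?d)) i"
      unfolding lookup_add
      by (cases "Poly_Mapping.lookup A i"; cases "Poly_Mapping.lookup B i")
        (simp_all add: lookup_add lookup_minus lookup_rep2 Poly_Mapping.map.rep_eq when_def)
  qed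
qed

lemma cocyc2_add_left: "cocyc2 (A + B) C = cocyc2 A C * cocyc2 B C"
proof -
  obtain \<delta> where "rep2 A + rep2 B = rep2 (A + B) + (\<delta> + \<delta>)" using rep2_add by blast
  then have "cocyc (rep2 A + rep2 B) (rep2 C) = cocyc (rep2 (A + B)) (rep2 C)"
    by (simp only: cocyc_add_left[of _ "\<delta> + \<delta>"] cocyc_add_left[of \<delta> \<delta>] cocyc_square mult_1_right)
  then show ?thesis by (simp add: cocyc2_def cocyc_add_left)
qed

lemma cocyc2_add_right: "cocyc2 C (A + B) = cocyc2 C A * cocyc2 C B"
proof -
  obtain \<delta> where "rep2 A + rep2 B = rep2 (A + B) + (\<delta> + \<delta>)" using rep2_add by blast
  then have "cocyc (rep2 C) (rep2 A + rep2 B) = cocyc (rep2 C) (rep2 (A + B))"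
    by (simp only: cocyc_add_right[of _ _ "\<delta> + \<delta>"] cocyc_add_right[of _ \<delta> \<delta>] cocyc_square mult_1_right)
  then show ?thesis by (simp add: cocyc2_def cocyc_add_right)
qed

lemma pm_map_zero: "Poly_Mapping.map f 0 = 0"
  by (rule poly_mapping_eqI) (simp add: Poly_Mapping.map.rep_eq when_def)

lemma cocyc2_zero [simp]: "cocyc2 0 A = 1" "cocyc2 A 0 = 1"
  by (simp_all only: cocyc2_def cocyc_def rep2_def pm_map_zero psum_zero) (simp_all add: psum_def)

lemma tmult_single: "tmult (Poly_Mapping.single A a) (Poly_Mapping.single B b)
    = Poly_Mapping.single (A + B) (a * b * cocyc2 A B)"
  by (simp add: tmult_def psum_single)

lemma tmult_add_left: "tmult (x + y) z = tmult x z + tmult y z"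
  unfolding tmult_def
  by (rule psum_add) (auto simp: psum_def sum.distrib[symmetric] single_add[symmetric] algebra_simps)

lemma tmult_add_right: "tmult x (y + z) = tmult x y + tmult x z"
  unfolding tmult_def
  by (simp add: psum_add single_add[symmetric] algebra_simps psum_fun_add[symmetric] del: single_add)

lemma tmult_zero [simp]: "tmult 0 x = 0" "tmult x 0 = 0"
  by (auto simp: tmult_def psum_def)

lemma tmult_pscale_left: "tmult (pscale c x) y = pscale c (tmult x y)"
proof (induction x rule: pm_induct)
  case (single k a)
  show ?case by (induction y rule: pm_induct)
    (simp_all add: tmult_single tmult_add_right pscale.scale_right_distrib mult.assoc)
qed (simp add: tmult_add_left pscale.scale_right_distrib)

lemma tmult_pscale_right: "tmult y (pscale c x) = pscale c (tmult y x)"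
proof (induction x rule: pm_induct)
  case (single k a)
  show ?case by (induction y rule: pm_induct)
    (simp_all add: tmult_single tmult_add_left pscale.scale_right_distrib mult_ac)
qed (simp add: tmult_add_right pscale.scale_right_distrib)

text \<open>
  A bimultiplicative cocycle satisfies the 2-cocycle identity.
\<close>

lemma tmult_assoc: "tmult (tmult x y) z = tmult x (tmult y z)"
proof (induction x rule: pm_induct)
  case (single k a)
  show ?case
  proof (induction y rule: pm_induct)
    case (single l b)
    show ?case by (induction z rule: pm_induct)
      (simp_all add: tmult_single tmult_add_right cocyc2_add_left cocyc2_add_right add.assoc mult_ac)
  qed (simp add: tmult_add_right tmult_add_left)
qed (simp add: tmult_add_left)

lemma bar2_zero [simp]: "bar2 0 = 0"
  by (simp add: bar2_def pm_map_zero)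

lemma tmult_one [simp]: "tmult (ebar 0) x = x" "tmult x (ebar 0) = x"
proof -
  have e: "ebar 0 = Poly_Mapping.single 0 1" by (simp only: ebar_def bar2_zero)
  show "tmult (ebar 0) x = x"
    by (induction x rule: pm_induct) (simp_all only: e tmult_single tmult_add_right cocyc2_zero, simp)
  show "tmult x (ebar 0) = x"
    by (induction x rule: pm_induct) (simp_all only: e tmult_single tmult_add_left cocyc2_zero, simp)
qed

lemma bar2_eps: "bar2 (eps i) = Poly_Mapping.single i 1"
  by (simp add: bar2_def eps_def)

lemma rep2_single: "rep2 (Poly_Mapping.single i 1) = eps i"
  by (rule poly_mapping_eqI) (simp add: lookup_rep2 eps_def lookup_single when_def)

lemma bar2_diff: "bar2 (eps i - eps j) = Poly_Mapping.single i 1 + Poly_Mapping.single j 1"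
  unfolding bar2_def eps_def
  by (rule poly_mapping_eqI)
    (auto simp: Poly_Mapping.map.rep_eq when_def lookup_minus lookup_add lookup_single)

lemma cocyc2_single: "cocyc2 (Poly_Mapping.single i 1) (Poly_Mapping.single j 1) = (if i > j then -1 else 1)"
  by (simp add: cocyc2_def rep2_single cocyc_eps)

lemma single_bit_add_self: "Poly_Mapping.single i (1::bit) + Poly_Mapping.single i 1 = 0"
  by (simp flip: single_add)

lemma clifford_square: "tmult (ebar (eps i)) (ebar (eps i)) = ebar 0"
  by (simp add: ebar_def bar2_eps tmult_single cocyc2_single single_bit_add_self del: single_add)

lemma clifford_anticomm:
  "i \<noteq> j \<Longrightarrow> tmult (ebar (eps i)) (ebar (eps j)) = pscale (-1) (tmult (ebar (eps j)) (ebar (eps i)))"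
  by (auto simp: ebar_def bar2_eps tmult_single cocyc2_single add.commute)

lemma ebar_diff: "ebar (eps i - eps j)
    = pscale (cocyc (eps i) (eps j)) (tmult (ebar (eps i)) (ebar (eps j)))"
  by (simp add: ebar_def bar2_eps bar2_diff tmult_single cocyc2_single cocyc_eps)

definition clif_coeff :: "nat \<Rightarrow> int \<Rightarrow> complex" where
  "clif_coeff j r = (if odd j then \<i> else 1) * of_int r"

lemma w_factor_alt: "w_factor j r = ebar 0 + pscale (clif_coeff j r) (ebar (eps j))"
  by (simp add: w_factor_def clif_coeff_def)

lemma clifford_w_factor_other:
  "i \<noteq> j \<Longrightarrow> tmult (ebar (eps i)) (w_factor j r) = tmult (w_factor j (- r)) (ebar (eps i))"
proof -
  assume ij: "i \<noteq> j"
  have "clif_coeff j (- r) = clif_coeff j r * - 1" by (simp add: clif_coeff_def)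
  then show ?thesis
    by (simp only: w_factor_alt tmult_add_left tmult_add_right tmult_pscale_left tmult_pscale_right
        clifford_anticomm[OF ij] tmult_one pscale.scale_scale)
qed

text \<open>
  The factor \<open>w\<^sub>j\<close> is chosen such that \<open>e\<^bsup>\<epsilon>\<^sub>j\<^esup>\<close> has \<open>w\<^sub>j(\<rho>)\<close> as an eigenvector for even \<open>j\<close>, where
  \<open>w\<^sub>j\<close> is twice an idempotent, and exchanges \<open>w\<^sub>j(1)\<close> and \<open>w\<^sub>j(-1)\<close> up to scalars for odd \<open>j\<close>.
\<close>

lemma clifford_w_factor_same:
  assumes "r \<in> {1, -1}"
  shows "tmult (ebar (eps j)) (w_factor j r)
    = pscale (clif_coeff j r) (w_factor j (if odd j then - r else r))"
proof -
  have "clif_coeff j r * clif_coeff j (if odd j then - r else r) = 1"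
    using assms by (auto simp: clif_coeff_def)
  then show ?thesis
    by (simp add: w_factor_alt tmult_add_left tmult_add_right tmult_pscale_left
      tmult_pscale_right clifford_square pscale.scale_right_distrib add.commute)
qed

definition sflip :: "nat \<Rightarrow> (nat \<Rightarrow> int) \<Rightarrow> (nat \<Rightarrow> int)" where
  "sflip m \<rho> = (\<lambda>i. if i \<le> m then - \<rho> i else \<rho> i)"

text \<open>
  The last index whose sign is reversed by \<open>e\<^bsup>\<epsilon>\<^sub>j\<^esup>\<close>: moving it past \<open>w\<^sub>1,\<dots>,w\<^bsub>j-1\<^esub>\<close> reverses the first
  \<open>j - 1\<close> signs, and the \<open>j\<close>-th sign is reversed only for odd \<open>j\<close>.
\<close>

definition odd_below :: "nat \<Rightarrow> nat" where
  "odd_below j = (if odd j then j else j - 1)"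

lemma w_prod_cong: "(\<And>i. i \<in> {1..k} \<Longrightarrow> \<rho> i = \<rho>' i) \<Longrightarrow> w_prod \<rho> k = w_prod \<rho>' k"
  by (induction k) auto

lemma clifford_w_prod_past:
  "j > k \<Longrightarrow> k \<le> m \<Longrightarrow> tmult (ebar (eps j)) (w_prod \<rho> k) = tmult (w_prod (sflip m \<rho>) k) (ebar (eps j))"
proof (induction k)
  case (Suc k)
  then show ?case
    by (simp add: tmult_assoc[symmetric]) (simp add: tmult_assoc clifford_w_factor_other sflip_def)
qed simp

lemma clifford_w_prod:
  assumes "j \<ge> 1" "j \<le> k" "\<rho> j \<in> {1, -1}"
  shows "tmult (ebar (eps j)) (w_prod \<rho> k) = pscale (clif_coeff j (\<rho> j)) (w_prod (sflip (odd_below j) \<rho>) k)"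
  using assms(2)
proof (induction k rule: dec_induct)
  case base
  obtain k where k: "j = Suc k" using assms(1) by (cases j) auto
  have "k \<le> odd_below j" by (simp add: k odd_below_def)
  then have "tmult (ebar (eps j)) (w_prod \<rho> j)
      = tmult (w_prod (sflip (odd_below j) \<rho>) k) (tmult (ebar (eps j)) (w_factor j (\<rho> j)))"
    using clifford_w_prod_past[of k j "odd_below j" \<rho>] by (simp add: k tmult_assoc[symmetric])
  also have "\<dots> = pscale (clif_coeff j (\<rho> j)) (w_prod (sflip (odd_below j) \<rho>) j)"
    unfolding clifford_w_factor_same[OF assms(3)] tmult_pscale_right
    by (auto simp: k sflip_def odd_below_def)
  finally show ?case .
next
  case (step n)
  then show ?case
    by (simp add: tmult_assoc[symmetric] tmult_pscale_left)
      (auto simp: sflip_def odd_below_def split: if_splits)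
qed

lemma admissible_sign: "admissible \<nu> \<gamma> \<rho> \<Longrightarrow> i \<in> {1..\<nu>} \<Longrightarrow> \<rho> i \<in> {1, -1}"
  by (simp add: admissible_def)

lemma sflip_sign: "\<rho> i \<in> {1, -1} \<Longrightarrow> sflip m \<rho> i \<in> {1, -1}"
  by (auto simp: sflip_def)

lemma clifford_pair_w_prod:
  assumes "i \<in> {1..\<nu>}" "j \<in> {1..\<nu>}" "\<rho> i \<in> {1, -1}" "\<rho> j \<in> {1, -1}"
  shows "tmult (ebar (eps i - eps j)) (w_prod \<rho> \<nu>)
    = pscale (cocyc (eps i) (eps j) * clif_coeff j (\<rho> j) * clif_coeff i (sflip (odd_below j) \<rho> i))
        (w_prod (sflip (odd_below i) (sflip (odd_below j) \<rho>)) \<nu>)"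
  using assms sflip_sign[of \<rho> i "odd_below j"]
  by (simp add: ebar_diff tmult_pscale_left tmult_assoc clifford_w_prod tmult_pscale_right del: insert_iff)

text \<open>
  Sign flips always end at an odd index, so two of them together fix the first sign, never split a pair
  \<open>2k, 2k+1\<close>, and fix the last sign when \<open>\<nu>\<close> is even.
\<close>

lemma admissible_sflip:
  assumes "admissible \<nu> \<gamma> \<rho>" "i \<in> {1..\<nu>}" "j \<in> {1..\<nu>}"
  shows "admissible \<nu> \<gamma> (sflip (odd_below i) (sflip (odd_below j) \<rho>))"
proof -
  have odd: "odd (odd_below k)" "odd_below k \<ge> 1" "odd_below k \<le> \<nu>" if "k \<in> {1..\<nu>}" for k
    using that by (auto simp: odd_below_def)
  have pair: "2 * k + 1 \<le> odd_below l \<longleftrightarrow> 2 * k \<le> odd_below l" if "l \<in> {1..\<nu>}" for k l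
    using odd(1)[OF that] by presburger
  have last: "\<not> \<nu> \<le> odd_below l" if "l \<in> {1..\<nu>}" "even \<nu>" for l
    using odd(1,3)[OF that(1)] that(2) by (metis le_antisym)
  show ?thesis
    using assms odd(2)[OF assms(2)] odd(2)[OF assms(3)] pair[OF assms(2)] pair[OF assms(3)]
      last[OF assms(2)] last[OF assms(3)]
    by (auto simp: admissible_def sflip_def)
qed

lemma clifford_pair_V_space:
  assumes "u \<in> V_space \<nu> \<gamma>" "i \<in> {1..\<nu>}" "j \<in> {1..\<nu>}"
  shows "tmult (ebar (eps i - eps j)) u \<in> V_space \<nu> \<gamma>"
  using assms(1) unfolding V_space_def
proof (induction rule: pscale.span_induct_alt)
  case base
  show ?case by (simp add: pscale.span_zero)
next
  case (step c x y)
  then obtain \<rho> where \<rho>: "x = w_prod \<rho> \<nu>" "admissible \<nu> \<gamma> \<rho>" by auto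
  have "tmult (ebar (eps i - eps j)) x \<in> pscale.span {w_prod \<rho> \<nu> |\<rho>. admissible \<nu> \<gamma> \<rho>}"
    unfolding \<rho>(1)
      clifford_pair_w_prod[OF assms(2,3) admissible_sign[OF \<rho>(2) assms(2)] admissible_sign[OF \<rho>(2) assms(3)]]
    using admissible_sflip[OF \<rho>(2) assms(2,3)] by (intro pscale.span_scale pscale.span_base) blast
  with step show ?case
    by (simp add: tmult_add_right tmult_pscale_right pscale.span_add pscale.span_scale)
qed

section \<open>The Clifford module is irreducible under even elements\<close>

lemma w_prod_support: "Poly_Mapping.lookup (w_prod \<rho> k) A \<noteq> 0 \<Longrightarrow> Poly_Mapping.keys A \<subseteq> {1..k}"
proof (induction k arbitrary: A)
  case 0
  then show ?case by (auto simp: ebar_def lookup_one when_def split: if_splits)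
next
  case (Suc k)
  have *: "Poly_Mapping.lookup (tmult x (ebar (eps (Suc k)))) A
    = cocyc2 (A - Poly_Mapping.single (Suc k) 1) (Poly_Mapping.single (Suc k) 1)
      * Poly_Mapping.lookup x (A - Poly_Mapping.single (Suc k) 1)" for x
  proof (induction x rule: pm_induct)
    case (single B b)
    have "B + Poly_Mapping.single (Suc k) 1 = A \<longleftrightarrow> B = A - Poly_Mapping.single (Suc k) 1"
      by (auto simp: algebra_simps)
    then show ?case by (auto simp: ebar_def bar2_eps tmult_single lookup_single when_def)
  qed (simp add: tmult_add_left lookup_add algebra_simps)
  have "Poly_Mapping.lookup (w_prod \<rho> k) A \<noteq> 0
      \<or> Poly_Mapping.lookup (w_prod \<rho> k) (A - Poly_Mapping.single (Suc k) 1) \<noteq> 0"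
    using Suc.prems by (auto simp: w_factor_alt tmult_add_right tmult_pscale_right lookup_add *)
  then have "Poly_Mapping.keys A \<subseteq> {1..k} \<or> Poly_Mapping.keys (A - Poly_Mapping.single (Suc k) 1) \<subseteq> {1..k}"
    using Suc.IH by blast
  then have keys: "\<exists>B\<in>{A, A - Poly_Mapping.single (Suc k) 1}. Poly_Mapping.keys B \<subseteq> {1..k}" by blast
  show ?case
  proof
    fix x assume "x \<in> Poly_Mapping.keys A"
    then have "x = Suc k \<or> x \<in> Poly_Mapping.keys A \<and> x \<in> Poly_Mapping.keys (A - Poly_Mapping.single (Suc k) 1)"
      by (simp add: in_keys_iff lookup_minus lookup_single when_def)
    with keys have "x = Suc k \<or> x \<in> {1..k}" by blast
    then show "x \<in> {1..Suc k}" by auto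
  qed
qed

text \<open>
  The other terms of the product are distinct nonempty products of the generators, so they do not
  interfere with the constant term.  In particular \<open>w(\<rho>)\<close> is nonzero.
\<close>

lemma w_prod_constant_term: "Poly_Mapping.lookup (w_prod \<rho> k) 0 = 1"
proof (induction k)
  case 0
  then show ?case by (simp add: ebar_def)
next
  case (Suc k)
  have *: "Poly_Mapping.lookup (tmult x (ebar (eps (Suc k)))) 0
    = cocyc2 (- Poly_Mapping.single (Suc k) 1) (Poly_Mapping.single (Suc k) 1)
      * Poly_Mapping.lookup x (- Poly_Mapping.single (Suc k) 1)" for x
  proof (induction x rule: pm_induct)
    case (single B b)
    have "B + Poly_Mapping.single (Suc k) 1 = 0 \<longleftrightarrow> B = - Poly_Mapping.single (Suc k) 1"
      by (simp add: eq_neg_iff_add_eq_0)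
    then show ?case by (auto simp: ebar_def bar2_eps tmult_single lookup_single when_def)
  qed (simp add: tmult_add_left lookup_add algebra_simps)
  have "Suc k \<in> Poly_Mapping.keys (- Poly_Mapping.single (Suc k) (1::bit))"
    by (simp add: in_keys_iff)
  then have "Poly_Mapping.lookup (w_prod \<rho> k) (- Poly_Mapping.single (Suc k) 1) = 0"
    using w_prod_support[of \<rho> k "- Poly_Mapping.single (Suc k) 1"] by fastforce
  then show ?case
    using Suc by (simp add: w_factor_alt tmult_add_right tmult_pscale_right lookup_add *)
qed

lemma admissible_exists:
  assumes "\<nu> \<ge> 2" "\<forall>k\<in>{1..\<nu> div 2 + 1}. \<gamma> k \<in> {1, -1}"
  shows "\<exists>\<rho>. admissible \<nu> \<gamma> \<rho>"
proof
  \<comment> \<open>The free signs, at the even positions, are set to 1.\<close>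
  let ?r = "\<lambda>i. if i = 1 then \<gamma> 1 else if even i then (if i = \<nu> then \<gamma> (\<nu> div 2 + 1) else 1)
     else \<gamma> ((i - 1) div 2 + 1)"
  have "?r i \<in> {1, -1}" if "i \<in> {1..\<nu>}" for i
  proof -
    have "(i - 1) div 2 + 1 \<in> {1..\<nu> div 2 + 1}" using that by auto
    moreover have "1 \<in> {1..\<nu> div 2 + 1}" "\<nu> div 2 + 1 \<in> {1..\<nu> div 2 + 1}" by auto
    ultimately show ?thesis using assms(2) by (simp del: insert_iff) (simp add: insert_iff)
  qed
  moreover have "?r (2 * j) * ?r (2 * j + 1) = \<gamma> (j + 1)" if "j \<ge> 1" "2 * j \<noteq> \<nu>" for j
    using that by auto
  moreover have "even \<nu> \<Longrightarrow> ?r \<nu> = \<gamma> (\<nu> div 2 + 1)" using assms(1) by auto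
  ultimately show "admissible \<nu> \<gamma> ?r"
    unfolding admissible_def by (intro conjI ballI) (auto simp del: insert_iff)
qed

text \<open>
  The constraints tie the sign \<open>2k+1\<close> to the sign \<open>2k\<close>, and the given products tie \<open>2k\<close> to \<open>2k-1\<close>;
  the first sign is prescribed.  Thus the weights of the \<open>e\<^bsup>\<epsilon>\<^sub>2\<^sub>k\<^sub>-\<^sub>1 - \<epsilon>\<^sub>2\<^sub>k\<^esup>\<close> separate admissible sign vectors.
\<close>

lemma admissible_eqI:
  assumes a: "admissible \<nu> \<gamma> \<rho>" "admissible \<nu> \<gamma> \<rho>'"
    and w: "\<And>k. k \<in> {1..\<nu> div 2} \<Longrightarrow> \<rho> (2*k-1) * \<rho> (2*k) = \<rho>' (2*k-1) * \<rho>' (2*k)"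
  shows "i \<in> {1..\<nu>} \<Longrightarrow> \<rho> i = \<rho>' i"
proof (induction i rule: less_induct)
  case (less i)
  have nz: "\<rho> k \<noteq> 0" if "k \<in> {1..\<nu>}" for k using admissible_sign[OF a(1) that] by auto
  consider "i = 1" | "even i" | "odd i" "i > 1" using less.prems by fastforce
  then show ?case
  proof cases
    case 1
    then show ?thesis using a by (simp add: admissible_def)
  next
    case 2
    then obtain k where k: "i = 2 * k" by blast
    then have k1: "k \<in> {1..\<nu> div 2}" using less.prems by auto
    have "\<rho> (2*k-1) = \<rho>' (2*k-1)" by (rule less.IH) (use k less.prems in auto)
    moreover have "\<rho> (2*k-1) \<noteq> 0" by (rule nz) (use k less.prems in auto)
    ultimately show ?thesis using w[OF k1] k by simp
  next
    case 3
    then obtain k where k: "i = 2 * k + 1" by (metis oddE)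
    then have k1: "k \<ge> 1" "k \<le> \<nu> div 2" "even \<nu> \<longrightarrow> k < \<nu> div 2" using less.prems 3 by auto
    have "\<rho> (2*k) = \<rho>' (2*k)" by (rule less.IH) (use k k1 less.prems in auto)
    moreover have "\<rho> (2*k) \<noteq> 0" by (rule nz) (use k k1 less.prems in auto)
    moreover have "\<rho> (2*k) * \<rho> (2*k+1) = \<rho>' (2*k) * \<rho>' (2*k+1)"
      using a k1 unfolding admissible_def by (cases "odd \<nu>") auto
    ultimately show ?thesis using k by simp
  qed
qed

text \<open>
  The element \<open>e\<^bsup>\<epsilon>\<^sub>2\<^sub>k - \<epsilon>\<^sub>2\<^sub>k\<^sub>+\<^sub>1\<^esup>\<close> reverses exactly the two signs \<open>2k\<close> and \<open>2k+1\<close>, so the signs can be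
  corrected from left to right; the constraints make the first and the other odd positions and, for even \<open>\<nu>\<close>,
  the last position correct automatically.
\<close>

lemma V_space_connected:
  assumes V': "pscale.subspace V'"
    and inv: "\<And>i j u. i \<in> {1..\<nu>} \<Longrightarrow> j \<in> {1..\<nu>} \<Longrightarrow> i \<noteq> j \<Longrightarrow> u \<in> V' \<Longrightarrow> tmult (ebar (eps i - eps j)) u \<in> V'"
    and \<rho>: "admissible \<nu> \<gamma> \<rho>" "w_prod \<rho> \<nu> \<in> V'" and \<rho>': "admissible \<nu> \<gamma> \<rho>'"
  shows "w_prod \<rho>' \<nu> \<in> V'"
proof -
  have "\<exists>\<rho>''. admissible \<nu> \<gamma> \<rho>'' \<and> w_prod \<rho>'' \<nu> \<in> V' \<and> (\<forall>i\<in>{1..j}. \<rho>'' i = \<rho>' i)" if "j \<le> \<nu>" for j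
    using that
  proof (induction j)
    case 0
    then show ?case using \<rho> by auto
  next
    case (Suc j)
    then obtain r where r: "admissible \<nu> \<gamma> r" "w_prod r \<nu> \<in> V'" "\<forall>i\<in>{1..j}. r i = \<rho>' i" by auto
    have sgn: "r (Suc j) \<in> {1, -1}" "\<rho>' (Suc j) \<in> {1, -1}"
      using Suc.prems admissible_sign[OF r(1), of "Suc j"] admissible_sign[OF \<rho>', of "Suc j"] by auto
    show ?case
    proof (cases "r (Suc j) = \<rho>' (Suc j)")
      case True
      then show ?thesis using r by (intro exI[of _ r]) (auto simp: le_Suc_eq)
    next
      case False
      have "j \<noteq> 0"
      proof
        assume "j = 0"
        then have "r (Suc j) = \<rho>' (Suc j)" using r(1) \<rho>' by (simp add: admissible_def)
        then show False using False by simp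
      qed
      have "odd j"
      proof
        assume "even j"
        then obtain k where k: "j = 2 * k" by blast
        then have k1: "k \<ge> 1" "k \<le> \<nu> div 2" "even \<nu> \<longrightarrow> k < \<nu> div 2" using Suc.prems \<open>j \<noteq> 0\<close> by auto
        have "r (2*k) * r (2*k+1) = \<rho>' (2*k) * \<rho>' (2*k+1)"
          using r(1) \<rho>' k1 unfolding admissible_def by (cases "odd \<nu>") auto
        moreover have "r (2*k) = \<rho>' (2*k)" "r (2*k) \<in> {1,-1}"
          using r(3) k k1 admissible_sign[OF r(1), of "2*k"] by auto
        ultimately show False using False k by auto
      qed
      then obtain k where k: "Suc j = 2 * k" by (metis even_Suc evenE)
      have "Suc j \<noteq> \<nu>"
      proof
        assume "Suc j = \<nu>"
        then have "r (Suc j) = \<rho>' (Suc j)" using r(1) \<rho>' \<open>odd j\<close> unfolding admissible_def by auto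
        then show False using False by simp
      qed
      then have i: "Suc j \<in> {1..\<nu>}" "Suc (Suc j) \<in> {1..\<nu>}" using Suc.prems by auto
      let ?s = "sflip (odd_below (Suc j)) (sflip (odd_below (Suc (Suc j))) r)"
      let ?c = "cocyc (eps (Suc j)) (eps (Suc (Suc j))) * clif_coeff (Suc (Suc j)) (r (Suc (Suc j)))
         * clif_coeff (Suc j) (sflip (odd_below (Suc (Suc j))) r (Suc j))"
      have eq: "tmult (ebar (eps (Suc j) - eps (Suc (Suc j)))) (w_prod r \<nu>) = pscale ?c (w_prod ?s \<nu>)"
        by (intro clifford_pair_w_prod i admissible_sign[OF r(1)])
      have "?c \<noteq> 0"
        using admissible_sign[OF r(1) i(1)] admissible_sign[OF r(1) i(2)]
        by (auto simp: cocyc_eps clif_coeff_def sflip_def)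
      moreover have "pscale (1 / ?c) (pscale ?c (w_prod ?s \<nu>)) \<in> V'"
        unfolding eq[symmetric] by (intro pscale.subspace_scale[OF V'] inv i r) simp
      ultimately have "w_prod ?s \<nu> \<in> V'" by simp
      moreover have "admissible \<nu> \<gamma> ?s" by (intro admissible_sflip r i)
      moreover have "?s x = \<rho>' x" if x: "x \<in> {1..Suc j}" for x
      proof (cases "x = Suc j")
        case True
        then show ?thesis using sgn False \<open>odd j\<close> by (auto simp: sflip_def odd_below_def)
      next
        case False
        then have "x \<in> {1..j}" using x by auto
        then show ?thesis using r(3) \<open>odd j\<close> by (auto simp: sflip_def odd_below_def)
      qed
      ultimately show ?thesis by blast
    qed
  qed
  from this[of \<nu>] obtain r where "w_prod r \<nu> \<in> V'" "\<forall>i\<in>{1..\<nu>}. r i = \<rho>' i" by auto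
  then show ?thesis using w_prod_cong[of \<nu> r \<rho>'] by simp
qed

text \<open>
  Weight vectors of the commuting elements \<open>e\<^bsup>\<epsilon>\<^sub>2\<^sub>k\<^sub>-\<^sub>1 - \<epsilon>\<^sub>2\<^sub>k\<^esup>\<close> can be extracted from any nonzero vector, and the
  weights have multiplicity one, so some \<open>w(\<rho>)\<close> is in the subspace.
\<close>

lemma V_space_irreducible:
  assumes V': "pscale.subspace V'" "V' \<subseteq> V_space \<nu> \<gamma>" "V' \<noteq> {0}"
    and inv: "\<And>i j u. i \<in> {1..\<nu>} \<Longrightarrow> j \<in> {1..\<nu>} \<Longrightarrow> i \<noteq> j \<Longrightarrow> u \<in> V' \<Longrightarrow> tmult (ebar (eps i - eps j)) u \<in> V'"
  shows "V' = V_space \<nu> \<gamma>"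
proof -
  obtain v where v: "v \<in> V'" "v \<noteq> 0" using V' pscale.subspace_0 by blast
  then have "v \<in> pscale.span {w_prod \<rho> \<nu> |\<rho>. admissible \<nu> \<gamma> \<rho>}"
    using V'(2) by (auto simp: V_space_def)
  then obtain t c where t: "finite t" "t \<subseteq> {w_prod \<rho> \<nu> |\<rho>. admissible \<nu> \<gamma> \<rho>}"
    and vt: "v = (\<Sum>x\<in>t. pscale (c x) x)"
    unfolding pscale.span_explicit by blast
  have "\<exists>R. \<forall>x\<in>t. x = w_prod (R x) \<nu> \<and> admissible \<nu> \<gamma> (R x)"
    using t(2) by (intro bchoice) blast
  then obtain R where R: "\<And>x. x \<in> t \<Longrightarrow> x = w_prod (R x) \<nu>" "\<And>x. x \<in> t \<Longrightarrow> admissible \<nu> \<gamma> (R x)" by blast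
  let ?T = "\<lambda>k. tmult (ebar (eps (2*k-1) - eps (2*k)))"
  let ?lam = "\<lambda>x k. - \<i> * of_int (R x (2*k-1) * R x (2*k))"
  have mem: "\<forall>x\<in>t. pscale (c x) x \<in> V'"
  proof (rule pscale.joint_eigen_components[where T = ?T and lam = ?lam and K = "{1..\<nu> div 2}", OF V'(1)])
    fix x k assume x: "x \<in> t" and k: "k \<in> {1..\<nu> div 2}"
    have ij: "2*k-1 \<in> {1..\<nu>}" "2*k \<in> {1..\<nu>}" using k by auto
    let ?r = "R x"
    have ob: "odd_below (2*k-1) = 2*k-1" "odd_below (2*k) = 2*k-1" using k by (auto simp: odd_below_def)
    have "sflip (2*k-1) (sflip (2*k-1) ?r) = ?r" by (auto simp: sflip_def)
    then have "?T k (w_prod ?r \<nu>) = pscale (cocyc (eps (2*k-1)) (eps (2*k)) * clif_coeff (2*k) (?r (2*k))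
        * clif_coeff (2*k-1) (sflip (2*k-1) ?r (2*k-1))) (w_prod ?r \<nu>)"
      using clifford_pair_w_prod[OF ij admissible_sign[OF R(2)[OF x] ij(1)] admissible_sign[OF R(2)[OF x] ij(2)]]
      unfolding ob by simp
    also have "cocyc (eps (2*k-1)) (eps (2*k)) * clif_coeff (2*k) (?r (2*k))
        * clif_coeff (2*k-1) (sflip (2*k-1) ?r (2*k-1)) = ?lam x k"
      using k by (auto simp: cocyc_eps clif_coeff_def sflip_def mult_ac)
    finally show "?T k (pscale (c x) x) = pscale (?lam x k) (pscale (c x) x)"
      using R(1)[OF x] by (simp add: tmult_pscale_right mult.commute)
  next
    fix x y assume xy: "x \<in> t" "y \<in> t" "x \<noteq> y"
    show "\<exists>k\<in>{1..\<nu> div 2}. ?lam x k \<noteq> ?lam y k"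
    proof (rule ccontr)
      assume "\<not> ?thesis"
      then have "R x (2*k-1) * R x (2*k) = R y (2*k-1) * R y (2*k)" if "k \<in> {1..\<nu> div 2}" for k
        using that by (metis (no_types, lifting) complex_i_not_zero mult_left_cancel neg_equal_0_iff_equal of_int_eq_iff)
      then have "R x i = R y i" if "i \<in> {1..\<nu>}" for i
        using admissible_eqI[OF R(2)[OF xy(1)] R(2)[OF xy(2)]] that by blast
      then have "w_prod (R x) \<nu> = w_prod (R y) \<nu>" by (rule w_prod_cong)
      then show False using R(1) xy by metis
    qed
  next
    fix k u assume k: "k \<in> {1..\<nu> div 2}" and u: "u \<in> V'"
    show "?T k u \<in> V'" by (rule inv) (use k u in auto)
  qed (use t v vt in \<open>auto simp: tmult_add_right tmult_pscale_right\<close>)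
  obtain x where x: "x \<in> t" "pscale (c x) x \<noteq> 0"
    using v(2) vt by (metis (no_types, lifting) sum.neutral)
  from mem x(1) have "pscale (c x) x \<in> V'" by (rule bspec)
  then have "pscale (1 / c x) (pscale (c x) x) \<in> V'" by (rule pscale.subspace_scale[OF V'(1)])
  then have w: "w_prod (R x) \<nu> \<in> V'" using x R(1)[OF x(1)] by (cases "c x = 0") auto
  have "w_prod \<rho>' \<nu> \<in> V'" if "admissible \<nu> \<gamma> \<rho>'" for \<rho>'
    by (rule V_space_connected[OF V'(1) _ R(2)[OF x(1)] w that]) (rule inv)
  then have "V_space \<nu> \<gamma> \<subseteq> V'"
    unfolding V_space_def by (intro pscale.span_minimal V'(1)) auto
  then show ?thesis using V'(2) by blast
qed


section \<open>Operators on the tensor product\<close>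

lemma lookup_map_lin: "lin T \<Longrightarrow> Poly_Mapping.lookup (Poly_Mapping.map T f) A = T (Poly_Mapping.lookup f A)"
  by (auto simp: Poly_Mapping.map.rep_eq when_def lin_zero)

lemma lookup_tens: "Poly_Mapping.lookup (tens u s) A = pscale (Poly_Mapping.lookup u A) s"
  by (simp add: tens_def Poly_Mapping.map.rep_eq when_def)

lemma tens_add_left: "tens (u + v) s = tens u s + tens v s"
  by (rule poly_mapping_eqI) (simp add: lookup_tens lookup_add pscale.scale_left_distrib)

lemma tens_add_right: "tens u (s + t) = tens u s + tens u t"
  by (rule poly_mapping_eqI) (simp add: lookup_tens lookup_add pscale.scale_right_distrib)

lemma tens_pscale_left: "tens (pscale c u) s = mscale c (tens u s)"
  by (rule poly_mapping_eqI) (simp add: lookup_tens)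

lemma tens_pscale_right: "tens u (pscale c s) = mscale c (tens u s)"
  by (rule poly_mapping_eqI) (simp add: lookup_tens mult.commute)

lemma tens_zero [simp]: "tens 0 s = 0" "tens u 0 = 0"
  by (rule poly_mapping_eqI, simp add: lookup_tens)+

lemma map_lin_add: "lin T \<Longrightarrow> Poly_Mapping.map T (f + g) = Poly_Mapping.map T f + Poly_Mapping.map T g"
  by (rule poly_mapping_eqI) (simp add: lookup_map_lin lookup_add lin_def)

lemma map_lin_mscale: "lin T \<Longrightarrow> Poly_Mapping.map T (mscale c f) = mscale c (Poly_Mapping.map T f)"
  by (rule poly_mapping_eqI) (simp add: lookup_map_lin lin_def)

lemma map_lin_tens: "lin T \<Longrightarrow> Poly_Mapping.map T (tens u s) = tens u (T s)"
  by (rule poly_mapping_eqI) (simp add: lookup_map_lin lookup_tens lin_def)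

lemma left_mult_add: "left_mult \<alpha> (f + g) = left_mult \<alpha> f + left_mult \<alpha> g"
  by (rule poly_mapping_eqI) (simp add: lookup_left_mult lookup_add pscale.scale_right_distrib)

lemma left_mult_tens: "left_mult \<alpha> (tens u s) = tens (tmult (ebar \<alpha>) u) s"
proof (induction u rule: pm_induct)
  case (single B b)
  have "tens (Poly_Mapping.single B b) s = Poly_Mapping.single B (pscale b s)" for B b
    by (rule poly_mapping_eqI) (simp add: lookup_tens lookup_single when_def)
  then show ?case
    by (simp add: ebar_def tmult_single left_mult_def psum_single mult.commute)
qed (simp add: tens_add_left left_mult_add tmult_add_right)

lemma left_mult_map: "lin T \<Longrightarrow> left_mult \<alpha> (Poly_Mapping.map T f) = Poly_Mapping.map T (left_mult \<alpha> f)"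
  by (rule poly_mapping_eqI) (simp add: lookup_map_lin lookup_left_mult lin_def)

lemma tensor_space_subspace: "mscale.subspace (tensor_space U S)"
  by (simp add: tensor_space_def)

lemma tens_in_tensor_space: "u \<in> U \<Longrightarrow> s \<in> S \<Longrightarrow> tens u s \<in> tensor_space U S"
  unfolding tensor_space_def by (rule mscale.span_base) blast

lemma tensor_space_least:
  "mscale.subspace P \<Longrightarrow> (\<And>u s. u \<in> U \<Longrightarrow> s \<in> S \<Longrightarrow> tens u s \<in> P) \<Longrightarrow> tensor_space U S \<subseteq> P"
  unfolding tensor_space_def by (rule mscale.span_minimal) auto

lemma mscale_linear_vimage:
  assumes "\<And>f g. Op (f + g) = Op f + Op g" "\<And>c f. Op (mscale c f) = mscale c (Op f)" "mscale.subspace P"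
  shows "mscale.subspace {f. Op f \<in> P}"
proof (rule mscale.subspaceI)
  have "Op 0 = 0" using assms(2)[of 0 0] by simp
  then show "0 \<in> {f. Op f \<in> P}" using assms(3) by (simp add: mscale.subspace_0)
qed (auto simp: assms(1,2) intro: mscale.subspace_add[OF assms(3)] mscale.subspace_scale[OF assms(3)])

lemma map_tensor_space:
  assumes "lin T" "\<And>s. s \<in> S \<Longrightarrow> T s \<in> S'" "f \<in> tensor_space U S"
  shows "Poly_Mapping.map T f \<in> tensor_space U S'"
proof -
  have "tensor_space U S \<subseteq> {f. Poly_Mapping.map T f \<in> tensor_space U S'}"
    by (intro tensor_space_least mscale_linear_vimage tensor_space_subspace)
      (auto simp: assms map_lin_add map_lin_mscale map_lin_tens intro: tens_in_tensor_space)
  then show ?thesis using assms(3) by blast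
qed

lemma left_mult_tensor_space:
  assumes "\<And>u. u \<in> U \<Longrightarrow> tmult (ebar \<alpha>) u \<in> U" "f \<in> tensor_space U S"
  shows "left_mult \<alpha> f \<in> tensor_space U S"
proof -
  have "tensor_space U S \<subseteq> {f. left_mult \<alpha> f \<in> tensor_space U S}"
    by (intro tensor_space_least mscale_linear_vimage tensor_space_subspace)
      (auto simp: assms left_mult_add left_mult_mscale left_mult_tens intro: tens_in_tensor_space)
  then show ?thesis using assms(2) by blast
qed

lemma tensor_space_coeff:
  assumes "pscale.subspace S" "f \<in> tensor_space U S"
  shows "Poly_Mapping.lookup f A \<in> S"
proof -
  have "tensor_space U S \<subseteq> {f. Poly_Mapping.lookup f A \<in> S}"
  proof (rule tensor_space_least)
    show "mscale.subspace {f. Poly_Mapping.lookup f A \<in> S}"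
      by (rule mscale.subspaceI) (auto simp: lookup_add pscale.subspace_0[OF assms(1)]
          intro: pscale.subspace_add[OF assms(1)] pscale.subspace_scale[OF assms(1)])
  qed (auto simp: lookup_tens intro: pscale.subspace_scale[OF assms(1)])
  then show ?thesis using assms(2) by blast
qed

section \<open>Vacuum vectors and irreducibility of Fock spaces\<close>

lemma const_of_kernel:
  assumes "\<And>v. pd v p = 0"
  shows "p = Poly_Mapping.single 0 (Poly_Mapping.lookup p 0)"
proof (rule poly_mapping_eqI)
  fix m
  show "Poly_Mapping.lookup p m = Poly_Mapping.lookup (Poly_Mapping.single 0 (Poly_Mapping.lookup p 0)) m"
  proof (cases "m = 0")
    case False
    then obtain v where "v \<in> Poly_Mapping.keys m" by (metis keys_eq_empty ex_in_conv)
    then show ?thesis using pd_zero_lookup[OF assms, of v m] False by (simp add: lookup_single)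
  qed simp
qed

definition total_deg_le :: "nat \<Rightarrow> fock \<Rightarrow> bool" where
  "total_deg_le d f \<longleftrightarrow> (\<forall>A m. Poly_Mapping.lookup (Poly_Mapping.lookup f A) m \<noteq> 0 \<longrightarrow> mdeg (\<lambda>_. 1) m \<le> d)"

lemma total_deg_le_exists: "\<exists>d. total_deg_le d f"
proof
  let ?d = "\<Sum>A\<in>Poly_Mapping.keys f. \<Sum>m\<in>Poly_Mapping.keys (Poly_Mapping.lookup f A). mdeg (\<lambda>_. 1) m"
  show "total_deg_le ?d f"
    unfolding total_deg_le_def
  proof (intro allI impI)
    fix A m assume nz: "Poly_Mapping.lookup (Poly_Mapping.lookup f A) m \<noteq> 0"
    then have A: "A \<in> Poly_Mapping.keys f" by (auto simp: in_keys_iff)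
    have "mdeg (\<lambda>_. 1) m \<le> (\<Sum>m\<in>Poly_Mapping.keys (Poly_Mapping.lookup f A). mdeg (\<lambda>_. 1) m)"
      by (rule member_le_sum) (use nz in \<open>auto simp: in_keys_iff\<close>)
    also have "\<dots> \<le> ?d" by (rule member_le_sum[OF A]) auto
    finally show "mdeg (\<lambda>_. 1) m \<le> ?d" .
  qed
qed

definition degree_lowering :: "(sym \<Rightarrow> sym) \<Rightarrow> bool" where
  "degree_lowering T \<longleftrightarrow> lin T \<and>
     (\<forall>p m. Poly_Mapping.lookup (T p) m \<noteq> 0 \<longrightarrow> (\<exists>v. Poly_Mapping.lookup p (m + Poly_Mapping.single v 1) \<noteq> 0))"

text \<open>
  A nonzero vector of least degree in \<open>U\<close> is killed by every degree-lowering operator that preserves \<open>U\<close>.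
\<close>

lemma exists_vacuum_vector:
  fixes f :: fock
  assumes "f \<in> U" "f \<noteq> 0" and T: "\<And>T. T \<in> \<T> \<Longrightarrow> degree_lowering T"
    and closed: "\<And>T g. T \<in> \<T> \<Longrightarrow> g \<in> U \<Longrightarrow> Poly_Mapping.map T g \<in> U"
  obtains g where "g \<in> U" "g \<noteq> 0" "\<And>T A. T \<in> \<T> \<Longrightarrow> T (Poly_Mapping.lookup g A) = 0"
proof -
  define d where "d = (LEAST d. \<exists>g\<in>U. g \<noteq> 0 \<and> total_deg_le d g)"
  have "\<exists>d. \<exists>g\<in>U. g \<noteq> 0 \<and> total_deg_le d g" using assms(1,2) total_deg_le_exists by blast
  then have "\<exists>g\<in>U. g \<noteq> 0 \<and> total_deg_le d g" unfolding d_def by (rule LeastI_ex)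
  then obtain g where g: "g \<in> U" "g \<noteq> 0" "total_deg_le d g" by blast
  have least: "h = 0" if "h \<in> U" "total_deg_le d' h" "d' < d" for h d'
    using not_less_Least[of d' "\<lambda>d. \<exists>g\<in>U. g \<noteq> 0 \<and> total_deg_le d g"] that unfolding d_def by blast
  have "T (Poly_Mapping.lookup g A) = 0" if TT: "T \<in> \<T>" for T A
  proof -
    have l: "lin T" and low: "\<And>p m. Poly_Mapping.lookup (T p) m \<noteq> 0 \<Longrightarrow> \<exists>v. Poly_Mapping.lookup p (m + Poly_Mapping.single v 1) \<noteq> 0"
      using T[OF TT] by (auto simp: degree_lowering_def)
    have low: "Suc (mdeg (\<lambda>_. 1) m) \<le> d" if nz: "Poly_Mapping.lookup (T (Poly_Mapping.lookup g A)) m \<noteq> 0" for A m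
    proof -
      obtain v where "Poly_Mapping.lookup (Poly_Mapping.lookup g A) (m + Poly_Mapping.single v 1) \<noteq> 0"
        using low[OF nz] by blast
      then have "mdeg (\<lambda>_. 1) (m + Poly_Mapping.single v 1) \<le> d"
        using g(3) unfolding total_deg_le_def by blast
      then show ?thesis unfolding mdeg_add_var by simp
    qed
    have "Poly_Mapping.map T g = 0"
    proof (cases d)
      case 0
      show ?thesis
        by (intro poly_mapping_eqI) (use low 0 in \<open>force simp: lookup_map_lin[OF l]\<close>)
    next
      case (Suc d')
      then show ?thesis
        using low by (intro least[OF closed[OF TT g(1)], of d']) (auto simp: total_deg_le_def lookup_map_lin[OF l])
    qed
    then show ?thesis using lookup_map_lin[OF l, of g A] by simp
  qed
  then show ?thesis using that g by blast
qed

lemma heis_degree_lowering: "k > 0 \<Longrightarrow> degree_lowering (heis i k)"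
  unfolding degree_lowering_def by (auto simp: heis_lin heis_def lookup_pd)

lemma lin_diff: "lin S \<Longrightarrow> lin T \<Longrightarrow> lin (\<lambda>p. S p - T p)"
  by (auto simp: lin_def pscale.scale_right_diff_distrib)

lemma degree_lowering_diff:
  assumes "degree_lowering S" "degree_lowering T"
  shows "degree_lowering (\<lambda>p. S p - T p)"
  unfolding degree_lowering_def
proof (intro conjI allI impI)
  show "lin (\<lambda>p. S p - T p)" using assms by (auto simp: degree_lowering_def intro: lin_diff)
  fix p m assume "Poly_Mapping.lookup (S p - T p) m \<noteq> 0"
  then have "Poly_Mapping.lookup (S p) m \<noteq> 0 \<or> Poly_Mapping.lookup (T p) m \<noteq> 0"
    by (auto simp: lookup_minus)
  then show "\<exists>v. Poly_Mapping.lookup p (m + Poly_Mapping.single v 1) \<noteq> 0"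
    using assms by (auto simp: degree_lowering_def)
qed

lemma map_diff: "lin S \<Longrightarrow> lin T \<Longrightarrow>
   Poly_Mapping.map (\<lambda>p. S p - T p) f = Poly_Mapping.map S f - Poly_Mapping.map T f"
  by (rule poly_mapping_eqI) (simp add: lookup_map_lin lin_diff lookup_minus)

text \<open>
  A vacuum vector has coefficients in \<open>S(H\<^sub>Z)\<close> that are killed by all \<open>\<partial>/\<partial>\<epsilon>\<^sub>i(n)\<close> with \<open>n \<notin> Z\<close>, by the differences
  \<open>\<partial>/\<partial>\<epsilon>\<^sub>i(n) - \<partial>/\<partial>\<epsilon>\<^sub>j(n)\<close>, and for \<open>n \<in> Z\<close> also by \<open>D\<^sub>n\<close> because \<open>S(H\<^sub>Z)\<close> lies in its kernel.  Then all derivatives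
  vanish and the coefficients are constants.
\<close>

lemma Fock_irreducible:
  assumes \<nu>: "\<nu> \<ge> 1" and Z: "\<And>n. n \<in> Z \<Longrightarrow> - n \<in> Z"
    and U: "mscale.subspace U" "U \<subseteq> tensor_space (V_space \<nu> \<gamma>) (Sym (HZ \<nu> Z))" "U \<noteq> {0}"
    and hei: "\<And>i k f. i \<in> {1..\<nu>} \<Longrightarrow> odd k \<Longrightarrow> k \<notin> Z \<Longrightarrow> f \<in> U \<Longrightarrow> Poly_Mapping.map (heis i k) f \<in> U"
    and dif: "\<And>i j k f. i \<in> {1..\<nu>} \<Longrightarrow> j \<in> {1..\<nu>} \<Longrightarrow> i \<noteq> j \<Longrightarrow> odd k \<Longrightarrow> f \<in> U \<Longrightarrow>
        Poly_Mapping.map (heis i k) f - Poly_Mapping.map (heis j k) f \<in> U"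
    and cli: "\<And>i j u. i \<in> {1..\<nu>} \<Longrightarrow> j \<in> {1..\<nu>} \<Longrightarrow> i \<noteq> j \<Longrightarrow> tens u 1 \<in> U \<Longrightarrow>
        tens (tmult (ebar (eps i - eps j)) u) 1 \<in> U"
  shows "U = tensor_space (V_space \<nu> \<gamma>) (Sym (HZ \<nu> Z))"
proof -
  let ?V = "V_space \<nu> \<gamma>"
  let ?\<T> = "{heis i k |i k. i \<in> {1..\<nu>} \<and> odd k \<and> k > 0 \<and> k \<notin> Z}
     \<union> {\<lambda>p. heis i k p - heis j k p |i j k. i \<in> {1..\<nu>} \<and> j \<in> {1..\<nu>} \<and> i \<noteq> j \<and> odd k \<and> k > 0}"
  obtain f where f: "f \<in> U" "f \<noteq> 0" using U mscale.subspace_0 by blast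
  obtain g where g: "g \<in> U" "g \<noteq> 0" and kill: "\<And>T A. T \<in> ?\<T> \<Longrightarrow> T (Poly_Mapping.lookup g A) = 0"
  proof (rule exists_vacuum_vector[OF f, of ?\<T>])
    fix T assume "T \<in> ?\<T>"
    then show "degree_lowering T"
      by (auto intro: heis_degree_lowering degree_lowering_diff)
  next
    fix T h assume "T \<in> ?\<T>" "h \<in> U"
    then show "Poly_Mapping.map T h \<in> U"
      by (auto simp: map_diff heis_lin simp del: One_nat_def atLeastAtMost_iff intro: hei dif)
  qed blast
  \<comment> \<open>Taking constant terms of the coefficients maps \<open>V(\<gamma>) \<otimes> S(H\<^sub>Z)\<close> onto \<open>V(\<gamma>) \<otimes> 1\<close> and will fix \<open>g\<close>.\<close>
  let ?C = "\<lambda>p::sym. Poly_Mapping.single 0 (Poly_Mapping.lookup p 0) :: sym"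
  have linC: "lin ?C" by (simp add: lin_def lookup_add single_add)
  have const: "?C (Poly_Mapping.lookup g A) = Poly_Mapping.lookup g A" for A
  proof -
    let ?p = "Poly_Mapping.lookup g A"
    have p: "?p \<in> Sym (HZ \<nu> Z)"
      using tensor_space_coeff[OF Sym_subspace] g(1) U(2) by blast
    have "pd v ?p = 0" for v
    proof (cases "is_var \<nu> v")
      case False
      then show ?thesis using Sym_HZ_imp_Sym_H_minus[OF p] unfolding Sym_H_minus_eq by blast
    next
      case True
      then obtain i n where v: "v = (i, n)" "i \<in> {1..\<nu>}" "n < 0" "odd n"
        by (cases v) (auto simp: is_var_def)
      show ?thesis
      proof (cases "n \<in> Z")
        case False
        then have "- n \<notin> Z" using Z[of "- n"] by auto
        then have "heis i (- n) \<in> ?\<T>"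
          by (intro UnI1 CollectI exI[of _ i] exI[of _ "- n"]) (use v in auto)
        then have "heis i (- n) ?p = 0" by (rule kill)
        then show ?thesis using v by (simp add: heis_def)
      next
        case True
        have "pd (j, n) ?p = pd (i, n) ?p" if j: "j \<in> {1..\<nu>}" for j
        proof (cases "i = j")
          case False
          have "(\<lambda>p. heis i (- n) p - heis j (- n) p) \<in> ?\<T>"
            by (rule UnI2, rule CollectI, intro exI[of _ i] exI[of _ j] exI[of _ "- n"]) (use v j False in auto)
          from kill[OF this, of A] show ?thesis using v(3)
            by (simp add: heis_def flip: pscale.scale_right_diff_distrib)
        qed simp
        then have "trace_pd \<nu> n ?p = pscale (of_nat \<nu>) (pd (i, n) ?p)"
          by (simp add: trace_pd_def sym_of_nat pscale_mult(2))
        moreover have "trace_pd \<nu> n ?p = 0"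
          by (rule trace_pd_HZ[OF _ p]) (use True v in \<open>simp add: Zneg_def\<close>)
        ultimately show ?thesis using v \<nu> by simp
      qed
    qed
    then show ?thesis using const_of_kernel[of ?p] by simp
  qed
  have "tensor_space ?V (Sym (HZ \<nu> Z)) \<subseteq> {f. Poly_Mapping.map ?C f \<in> (\<lambda>u. tens u 1) ` ?V}"
  proof (intro tensor_space_least mscale_linear_vimage)
    show "mscale.subspace ((\<lambda>u. tens u 1) ` ?V)"
    proof (rule mscale.subspaceI)
      show "0 \<in> (\<lambda>u. tens u 1) ` ?V"
        by (rule image_eqI[of _ _ 0]) (auto simp: V_space_def pscale.span_zero)
    next
      fix x y assume "x \<in> (\<lambda>u. tens u 1) ` ?V" "y \<in> (\<lambda>u. tens u 1) ` ?V"
      then show "x + y \<in> (\<lambda>u. tens u 1) ` ?V"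
        by (auto simp: V_space_def tens_add_left[symmetric] intro!: imageI pscale.span_add)
    next
      fix c x assume "x \<in> (\<lambda>u. tens u 1) ` ?V"
      then show "mscale c x \<in> (\<lambda>u. tens u 1) ` ?V"
        by (auto simp: V_space_def tens_pscale_left[symmetric] intro!: imageI pscale.span_scale)
    qed
    fix u s assume u: "u \<in> ?V" and "s \<in> Sym (HZ \<nu> Z)"
    have "Poly_Mapping.map ?C (tens u s) = tens (pscale (Poly_Mapping.lookup s 0) u) 1"
      unfolding map_lin_tens[OF linC] by (simp only: const_sym tens_pscale_right tens_pscale_left)
    moreover have "pscale (Poly_Mapping.lookup s 0) u \<in> ?V"
      using u by (simp add: V_space_def pscale.span_scale)
    ultimately show "tens u s \<in> {f. Poly_Mapping.map ?C f \<in> (\<lambda>u. tens u 1) ` ?V}" by simp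
  qed (auto simp: map_lin_add[OF linC] map_lin_mscale[OF linC])
  then have "Poly_Mapping.map ?C g \<in> (\<lambda>u. tens u 1) ` ?V" using g(1) U(2) by blast
  moreover have "Poly_Mapping.map ?C g = g"
    by (rule poly_mapping_eqI) (simp only: lookup_map_lin[OF linC] const)
  ultimately obtain u0 where u0: "u0 \<in> ?V" "g = tens u0 1" by auto
  \<comment> \<open>So \<open>U\<close> meets \<open>V(\<gamma>) \<otimes> 1\<close>, and the intersection is stable under the even Clifford elements.\<close>
  let ?V' = "{u \<in> ?V. tens u 1 \<in> U}"
  have "?V' = ?V"
  proof (rule V_space_irreducible)
    show "pscale.subspace ?V'"
      by (rule pscale.subspaceI) (auto simp: V_space_def pscale.span_zero pscale.span_add pscale.span_scale
         tens_add_left tens_pscale_left mscale.subspace_0[OF U(1)]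
         mscale.subspace_add[OF U(1)] mscale.subspace_scale[OF U(1)])
    have "u0 \<in> ?V'" "u0 \<noteq> 0" using u0 g by auto
    then show "?V' \<noteq> {0}" by blast
  qed (auto intro: clifford_pair_V_space cli)
  then have base: "tens u 1 \<in> U" if "u \<in> ?V" for u using that by blast
  let ?P = "{p. \<forall>u\<in>?V. tens u p \<in> U}"
  have "Sym (HZ \<nu> Z) \<subseteq> ?P"
    unfolding HZ_def
  proof (rule Sym_span_least)
    show "pscale.subspace ?P"
      by (rule pscale.subspaceI) (auto simp: tens_add_right tens_pscale_right
         mscale.subspace_0[OF U(1)] mscale.subspace_add[OF U(1)] mscale.subspace_scale[OF U(1)])
    show "1 \<in> ?P" using base by blast
  next
    fix g p assume p: "p \<in> ?P"
    have h: "Poly_Mapping.map (heis i n) (tens u p) = tens u (hvar i n * p)" if "n < 0" for i n u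
      using that by (simp add: map_lin_tens heis_lin heis_def)
    have d: "tens u q - tens u r = tens u (q - r)" for u q r
      by (rule poly_mapping_eqI) (simp add: lookup_tens lookup_minus pscale.scale_right_diff_distrib)
    assume "g \<in> {hvar i m - hvar j m |i j m. i \<in> {1..\<nu>} \<and> j \<in> {1..\<nu>} \<and> i \<noteq> j \<and> m < 0 \<and> odd m}
      \<union> {hvar i n |i n. i \<in> {1..\<nu>} \<and> n < 0 \<and> odd n \<and> n \<notin> Z}"
    then consider i j m where "g = hvar i m - hvar j m" "i \<in> {1..\<nu>}" "j \<in> {1..\<nu>}" "i \<noteq> j" "m < 0" "odd m"
      | i n where "g = hvar i n" "i \<in> {1..\<nu>}" "n < 0" "odd n" "n \<notin> Z" by blast
    then show "g * p \<in> ?P"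
    proof cases
      case 1
      show ?thesis
      proof (intro CollectI ballI)
        fix u assume "u \<in> ?V"
        then have "Poly_Mapping.map (heis i m) (tens u p) - Poly_Mapping.map (heis j m) (tens u p) \<in> U"
          using p by (intro dif 1) blast
        then show "tens u (g * p) \<in> U" by (simp only: h[OF 1(5)] d 1(1) left_diff_distrib)
      qed
    next
      case 2
      show ?thesis
      proof (intro CollectI ballI)
        fix u assume "u \<in> ?V"
        then have "Poly_Mapping.map (heis i n) (tens u p) \<in> U"
          using p by (intro hei 2) blast
        then show "tens u (g * p) \<in> U" by (simp only: h[OF 2(3)] 2(1))
      qed
    qed
  qed
  then have "tensor_space ?V (Sym (HZ \<nu> Z)) \<subseteq> U"
    by (intro tensor_space_least U(1)) blast
  then show ?thesis using U(2) by blast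
qed


section \<open>Operators compatible with the trace variables\<close>

text \<open>
  If \<open>Z = -Z\<close>, the operators \<open>h\<close> include \<open>D\<^sub>n\<close> and \<open>y\<^sub>n\<close> for \<open>n \<in> Z\<close> odd negative, and the derivatives by
  variables outside \<open>H\<^sup>-\<close>.
\<close>

definition adapted :: "nat \<Rightarrow> int set \<Rightarrow> (sym \<Rightarrow> sym) \<Rightarrow> bool" where
  "adapted \<nu> Z T \<longleftrightarrow> lin T \<and>
     (\<forall>h c r. heis_central \<nu> h c r \<longrightarrow> (c \<noteq> 0 \<longrightarrow> r \<in> Z) \<longrightarrow> (\<forall>p. h (T p) = T (h p)))"

lemma adapted_heis: "i \<in> {1..\<nu>} \<Longrightarrow> odd m \<Longrightarrow> m \<notin> Z \<Longrightarrow> adapted \<nu> Z (heis i m)"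
  unfolding adapted_def heis_central_def by (auto simp: heis_lin simp del: atLeastAtMost_iff)

text \<open>
  The two commutators are the same scalar.
\<close>

lemma adapted_heis_diff:
  assumes "i \<in> {1..\<nu>}" "j \<in> {1..\<nu>}" "odd m"
  shows "adapted \<nu> Z (\<lambda>p. heis i m p - heis j m p)"
  unfolding adapted_def
proof (intro conjI allI impI)
  show "lin (\<lambda>p. heis i m p - heis j m p)" by (intro lin_diff heis_lin)
  fix h c r p assume h: "heis_central \<nu> h c r"
  have "h (heis i m p) - heis i m (h p) = h (heis j m p) - heis j m (h p)"
    using h assms unfolding heis_central_def by simp
  moreover have "lin h" using h by (simp add: heis_central_def)
  ultimately show "h (heis i m p - heis j m p) = heis i m (h p) - heis j m (h p)"
    by (simp add: lin_minus algebra_simps)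
qed

lemma adapted_E_prod:
  assumes "i \<in> {1..\<nu>}" "j \<in> {1..\<nu>}" "\<And>r. r \<in> Z \<Longrightarrow> a powi r = 1"
  shows "adapted \<nu> Z (E_prod i j a n)"
  unfolding adapted_def using assms by (auto simp: E_prod_lin simp del: atLeastAtMost_iff intro: E_prod_comm)

lemma adapted_Sym_HZ:
  assumes "\<nu> \<ge> 1" "adapted \<nu> Z T" "p \<in> Sym (HZ \<nu> Z)"
  shows "T p \<in> Sym (HZ \<nu> Z)"
proof -
  have l: "lin T" and c: "\<And>h c r p. heis_central \<nu> h c r \<Longrightarrow> (c \<noteq> 0 \<longrightarrow> r \<in> Z) \<Longrightarrow> h (T p) = T (h p)"
    using assms(2) by (auto simp: adapted_def)
  have "pd v (T p) = 0" if v: "\<not> is_var \<nu> v" for v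
  proof -
    have "pd v p = 0" using Sym_HZ_imp_Sym_H_minus[OF assms(3)] v unfolding Sym_H_minus_eq by blast
    then show ?thesis using c[OF heis_central_pd[OF v]] lin_zero[OF l] by simp
  qed
  moreover have "trace_pd \<nu> n (T p) = 0" if n: "n \<in> Zneg Z" for n
  proof -
    have "heis_central \<nu> (trace_pd \<nu> n) 1 n" using n by (intro heis_central_trace_pd) (auto simp: Zneg_def)
    then have "trace_pd \<nu> n (T p) = T (trace_pd \<nu> n p)" using n by (intro c) (auto simp: Zneg_def)
    then show ?thesis using trace_pd_HZ[OF n assms(3)] lin_zero[OF l] by simp
  qed
  ultimately show ?thesis
    using assms(1) by (subst Sym_HZ_eq) (auto simp: Sym_H_minus_eq)
qed

lemma adapted_trace_var:
  assumes "adapted \<nu> Z T" "n \<in> Zneg Z" "\<And>n. n \<in> Z \<Longrightarrow> - n \<in> Z"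
  shows "trace_var \<nu> n * T p = T (trace_var \<nu> n * p)"
proof -
  have "heis_central \<nu> ((*) (trace_var \<nu> n)) (of_int n / 2) (- n)"
    using assms(2) by (intro heis_central_trace_var) (auto simp: Zneg_def)
  moreover have "- n \<in> Z" using assms by (auto simp: Zneg_def)
  ultimately show ?thesis using assms(1) unfolding adapted_def by blast
qed

text \<open>
  The operators of the Lie algebra will belong to the class \<open>compatible\<close>, which is closed under linear
  combinations; this reduces statements about the whole algebra to its spanning elements.
\<close>

locale fock_setup =
  fixes \<nu> :: nat and Z :: "int set" and \<gamma> :: "nat \<Rightarrow> int"
  assumes \<nu>1: "\<nu> \<ge> 1" and Zsym: "\<And>n. n \<in> Z \<Longrightarrow> - n \<in> Z"
begin

abbreviation "W0 \<equiv> tensor_space (V_space \<nu> \<gamma>) (Sym (HZ \<nu> Z))"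

definition compatible :: "(fock \<Rightarrow> fock) \<Rightarrow> bool" where
  "compatible Op \<longleftrightarrow> (\<forall>f\<in>W0. Op f \<in> W0) \<and>
     (\<forall>f g. Op (f + g) = Op f + Op g) \<and> (\<forall>c f. Op (mscale c f) = mscale c (Op f)) \<and>
     (\<forall>n\<in>Zneg Z. \<forall>f. Op (Poly_Mapping.map ((*) (trace_var \<nu> n)) f)
        = Poly_Mapping.map ((*) (trace_var \<nu> n)) (Op f))"

lemma compatible_add: "compatible S \<Longrightarrow> compatible T \<Longrightarrow> compatible (\<lambda>f. S f + T f)"
  unfolding compatible_def
  by (auto simp: mscale.scale_right_distrib map_lin_add[OF lin_mult]
      intro: mscale.subspace_add[OF tensor_space_subspace])

lemma compatible_scale: "compatible S \<Longrightarrow> compatible (\<lambda>f. mscale c (S f))"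
  unfolding compatible_def
  by (auto simp: mscale.scale_right_distrib map_lin_mscale[OF lin_mult] mult.commute
      intro: mscale.subspace_scale[OF tensor_space_subspace])

lemma compatible_id: "compatible (\<lambda>f. f)"
  by (simp add: compatible_def)

lemma compatible_zero: "compatible (\<lambda>f. 0)"
  by (simp add: compatible_def mscale.subspace_0[OF tensor_space_subspace] pm_map_zero)

lemma compatible_diff: "compatible S \<Longrightarrow> compatible T \<Longrightarrow> compatible (\<lambda>f. S f - T f)"
  using compatible_add[of S "\<lambda>f. mscale (-1) (T f)"] compatible_scale[of T "-1"] by simp

lemma compatible_sum: "(\<And>a. a \<in> A \<Longrightarrow> compatible (F a)) \<Longrightarrow> compatible (\<lambda>f. \<Sum>a\<in>A. F a f)"
  by (induction A rule: infinite_finite_induct) (auto intro: compatible_zero compatible_add)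

lemma compatible_map: "adapted \<nu> Z T \<Longrightarrow> compatible (Poly_Mapping.map T)"
  unfolding compatible_def
proof (intro conjI ballI allI)
  assume T: "adapted \<nu> Z T"
  then have l: "lin T" by (simp add: adapted_def)
  show "Poly_Mapping.map T f \<in> W0" if "f \<in> W0" for f
    by (rule map_tensor_space[OF l _ that]) (rule adapted_Sym_HZ[OF \<nu>1 T])
  show "Poly_Mapping.map T (f + g) = Poly_Mapping.map T f + Poly_Mapping.map T g" for f g
    by (rule map_lin_add[OF l])
  show "Poly_Mapping.map T (mscale c f) = mscale c (Poly_Mapping.map T f)" for c f
    by (rule map_lin_mscale[OF l])
  show "Poly_Mapping.map T (Poly_Mapping.map ((*) (trace_var \<nu> n)) f)
      = Poly_Mapping.map ((*) (trace_var \<nu> n)) (Poly_Mapping.map T f)" if "n \<in> Zneg Z" for n f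
    using adapted_trace_var[OF T that Zsym]
    by (intro poly_mapping_eqI) (simp add: lookup_map_lin l lin_mult)
qed

lemma compatible_left_mult:
  assumes "compatible S" "i \<in> {1..\<nu>}" "j \<in> {1..\<nu>}"
  shows "compatible (\<lambda>f. left_mult (eps i - eps j) (S f))"
  using assms(1) unfolding compatible_def
  by (auto simp: left_mult_add left_mult_mscale left_mult_map[OF lin_mult]
      intro!: left_mult_tensor_space clifford_pair_V_space assms(2,3))

end

section \<open>Central coefficients of the trace\<close>

text \<open>A monomial \<open>t\<^sup>n e\<^sup>\<alpha>\<close> is central in \<open>R\<^sub>\<sigma>\<close> iff \<open>n\<close> is a central exponent and \<open>\<sigma>(\<alpha>) = 1\<close>.\<close>

definition central_exponents :: "('g::ab_group_add \<Rightarrow> complex) \<Rightarrow> int set" where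
  "central_exponents \<sigma> = {n. \<forall>\<alpha>. \<sigma> \<alpha> powi n = 1}"

text \<open>
  The trace runs over the diagonal of all index pairs, not only those up to \<open>\<nu>\<close>, so that its symmetry
  holds without bounds on the matrices.
\<close>

definition mtrace :: "'g rmat \<Rightarrow> 'g rsig" where
  "mtrace X = psum X (\<lambda>(i, j) x. if i = j then x else 0)"

definition central_index :: "('g::ab_group_add \<Rightarrow> complex) \<Rightarrow> int \<times> 'g \<Rightarrow> bool" where
  "central_index \<sigma> k \<longleftrightarrow> fst k \<in> central_exponents \<sigma> \<and> \<sigma> (snd k) = 1"

definition trace_free :: "nat \<Rightarrow> ('g::ab_group_add \<Rightarrow> complex) \<Rightarrow> 'g ghat set" where
  "trace_free \<nu> \<sigma> = {x. fst x \<in> gl_carrier \<nu> \<and>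
     (\<forall>k. central_index \<sigma> k \<longrightarrow> Poly_Mapping.lookup (mtrace (fst x)) k = 0)}"

lemma mtrace_single: "mtrace (Poly_Mapping.single (i, j) x) = (if i = j then x else 0)"
  by (simp add: mtrace_def psum_single)

lemma mtrace_add: "mtrace (X + Y) = mtrace X + mtrace Y"
  unfolding mtrace_def by (rule psum_add) auto

lemma mtrace_minus: "mtrace (X - Y) = mtrace X - mtrace Y"
  using mtrace_add[of "X - Y" Y] by simp

lemma mtrace_mscale: "mtrace (mscale c X) = pscale c (mtrace X)"
proof (induction X rule: pm_induct)
  case (single k a)
  then show ?case by (cases k) (simp add: mtrace_single)
qed (simp add: mtrace_add mscale.scale_right_distrib pscale.scale_right_distrib)

text \<open>
  If \<open>t\<^bsup>m+n\<^esup> e\<^bsup>\<alpha>+\<beta>\<^esup>\<close> is central then \<open>\<sigma>(\<beta>) = \<sigma>(\<alpha>)\<^sup>-\<^sup>1\<close> and \<open>\<sigma>(\<alpha>)\<^bsup>m+n\<^esup> = 1\<close>, so the two structure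
  constants \<open>\<sigma>(\<alpha>)\<^sup>n\<close> and \<open>\<sigma>(\<beta>)\<^sup>m\<close> agree.
\<close>

lemma rmult_central_symmetric:
  assumes \<sigma>: "character \<sigma>" and k: "central_index \<sigma> k"
  shows "Poly_Mapping.lookup (rmult \<sigma> x y) k = Poly_Mapping.lookup (rmult \<sigma> y x) k"
proof (induction x rule: pm_induct)
  case (single k1 a)
  show ?case
  proof (induction y rule: pm_induct)
    case (single k2 b)
    obtain m \<alpha> n \<beta> where kk: "k1 = (m, \<alpha>)" "k2 = (n, \<beta>)" by (cases k1; cases k2)
    have "\<sigma> \<alpha> powi n = \<sigma> \<beta> powi m" if "(m + n, \<alpha> + \<beta>) = k"
    proof -
      have nz: "\<sigma> \<alpha> \<noteq> 0" using \<sigma> by (simp add: character_def)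
      have "\<sigma> \<alpha> * \<sigma> \<beta> = 1" "m + n \<in> central_exponents \<sigma>"
        using k \<sigma> that[symmetric] by (auto simp: central_index_def character_def)
      then have b: "\<sigma> \<beta> = inverse (\<sigma> \<alpha>)" and e: "\<sigma> \<alpha> powi (m + n) = 1"
        by (auto simp: central_exponents_def intro: inverse_unique[symmetric])
      from e have "\<sigma> \<alpha> powi m * \<sigma> \<alpha> powi n = 1" using nz by (simp add: power_int_add)
      then show ?thesis by (simp add: b power_int_inverse inverse_unique)
    qed
    then show ?case
      by (auto simp: kk rmult_single lookup_single when_def add.commute mult.commute)
  qed (simp add: rmult_add_right rmult_add_left lookup_add)
qed (simp add: rmult_add_right rmult_add_left lookup_add)

lemma mtrace_mmult_symmetric:
  assumes \<sigma>: "character \<sigma>" and k: "central_index \<sigma> k"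
  shows "Poly_Mapping.lookup (mtrace (mmult \<sigma> X Y)) k = Poly_Mapping.lookup (mtrace (mmult \<sigma> Y X)) k"
proof (induction X rule: pm_induct)
  case (single p x)
  show ?case
  proof (induction Y rule: pm_induct)
    case (single q y)
    have "mtrace 0 = (0 :: 'a rsig)" by (simp add: mtrace_def)
    then show ?case
      by (cases p; cases q) (auto simp: mmult_single mtrace_single rmult_central_symmetric[OF assms])
  qed (simp add: mmult_add_right mmult_add_left mtrace_add lookup_add)
qed (simp add: mmult_add_right mmult_add_left mtrace_add lookup_add)

text \<open>
  The off-diagonal generators have trace zero, and traces of commutators have no central part.
\<close>

lemma eu_hat_trace_free:
  assumes "character \<sigma>" "x \<in> eu_hat \<nu> \<sigma>"
  shows "x \<in> trace_free \<nu> \<sigma>"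
proof -
  have "fst x \<in> gl_carrier \<nu>" using eu_hat_subset_u_hat[OF assms(1)] assms(2) by (auto simp: u_hat_def)
  moreover have "\<forall>k. central_index \<sigma> k \<longrightarrow> Poly_Mapping.lookup (mtrace (fst x)) k = 0"
    using assms(2)
  proof induction
    case (gen i j m \<alpha>)
    then show ?case by (simp add: e_gen_def mtrace_minus mtrace_single)
  next
    case zero
    show ?case by (simp add: mtrace_def)
  next
    case (add x y)
    then show ?case by (simp add: mtrace_add lookup_add)
  next
    case (scale x c)
    then show ?case by (simp add: hscale_def mtrace_mscale)
  next
    case (bracket x y)
    then show ?case
      by (simp add: hbracket_def mtrace_minus lookup_minus mtrace_mmult_symmetric[OF assms(1), of _ "fst x"])
  qed
  ultimately show ?thesis by (simp add: trace_free_def)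
qed

text \<open>
  For central diagonal indices only the difference with the operator of \<open>e\<^sub>1\<^sub>1\<close> is kept.  By the trace
  condition the subtracted operators add up to zero in the action of the elementary subalgebra.
\<close>

definition e_op_reduced :: "('g::ab_group_add \<Rightarrow> complex) \<Rightarrow> nat \<Rightarrow> nat \<Rightarrow> int \<times> 'g \<Rightarrow> fock \<Rightarrow> fock" where
  "e_op_reduced \<sigma> i j k f = e_op \<sigma> i j (fst k) (snd k) f
     - (if i = j \<and> central_index \<sigma> k then e_op \<sigma> 1 1 (fst k) (snd k) f else 0)"

lemma action_sum_reduced:
  "psum X (\<lambda>(i, j) r. psum r (\<lambda>(m, \<alpha>) a. mscale (a / 2) (e_op \<sigma> i j m \<alpha> f)))
   = psum X (\<lambda>(i, j) r. psum r (\<lambda>k a. mscale (a / 2) (e_op_reduced \<sigma> i j k f)))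
     + psum (mtrace X) (\<lambda>k a. if central_index \<sigma> k then mscale (a / 2) (e_op \<sigma> 1 1 (fst k) (snd k) f) else 0)"
  (is "?L X = ?R X + ?T (mtrace X)")
proof (induction X rule: pm_induct)
  case (single p x)
  obtain i j where p: "p = (i, j)" by (cases p)
  have sc: "mscale ((a + b) / 2) g = mscale (a / 2) g + mscale (b / 2) g" for a b and g :: fock
    by (simp add: add_divide_distrib mscale.scale_left_distrib)
  show ?case
    unfolding p
  proof (induction x rule: pm_induct)
    case (single k a)
    then show ?case
      by (cases k) (auto simp: psum_single mtrace_single e_op_reduced_def mscale.scale_right_diff_distrib)
  next
    case (add x y)
    have "?L (Poly_Mapping.single (i, j) (x + y)) = ?L (Poly_Mapping.single (i, j) x) + ?L (Poly_Mapping.single (i, j) y)"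
      by (simp add: psum_single) (rule psum_add, auto simp: sc)
    moreover have "?R (Poly_Mapping.single (i, j) (x + y)) = ?R (Poly_Mapping.single (i, j) x) + ?R (Poly_Mapping.single (i, j) y)"
      by (simp add: psum_single) (rule psum_add, auto simp: sc)
    moreover have "?T (x + y) = ?T x + ?T y"
      by (rule psum_add) (auto simp: sc)
    ultimately show ?case using add by (simp add: mtrace_single split: if_splits)
  qed
next
  case (add X Y)
  have sc: "mscale ((a + b) / 2) g = mscale (a / 2) g + mscale (b / 2) g" for a b and g :: fock
    by (simp add: add_divide_distrib mscale.scale_left_distrib)
  have "?L (X + Y) = ?L X + ?L Y"
    by (rule psum_add) (auto simp: sc intro!: psum_add)
  moreover have "?R (X + Y) = ?R X + ?R Y"
    by (rule psum_add) (auto simp: sc intro!: psum_add)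
  moreover have "?T (x + y) = ?T x + ?T y" for x y
    by (rule psum_add) (auto simp: sc)
  ultimately show ?case using add by (simp add: mtrace_add)
qed

lemma u_act_reduced:
  assumes "x \<in> trace_free \<nu> \<sigma>"
  shows "u_act \<sigma> x f = psum (fst x) (\<lambda>(i, j) r. psum r (\<lambda>k a. mscale (a / 2) (e_op_reduced \<sigma> i j k f)))
     + mscale (snd x / 2) f"
proof -
  have "psum (mtrace (fst x)) (\<lambda>k a. if central_index \<sigma> k then mscale (a / 2) (e_op \<sigma> 1 1 (fst k) (snd k) f) else 0) = 0"
    unfolding psum_def using assms by (intro sum.neutral) (auto simp: trace_free_def)
  then show ?thesis by (simp add: u_act_def action_sum_reduced)
qed

lemma central_exponents_uminus: "n \<in> central_exponents \<sigma> \<Longrightarrow> - n \<in> central_exponents \<sigma>"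
  by (simp add: central_exponents_def power_int_minus)

context fock_setup begin

text \<open>
  The vertex operators are harmless since \<open>a = \<sigma>(\<alpha>)\<close> satisfies \<open>a\<^sup>n = 1\<close> for \<open>n \<in> Z\<close>.  The only remaining
  critical case is \<open>\<epsilon>\<^sub>i(m)\<close> with \<open>m \<in> Z\<close>, which occurs for central indices and there only in the combination
  \<open>\<epsilon>\<^sub>i(m) - \<epsilon>\<^sub>1(m)\<close>.
\<close>

lemma compatible_e_op_reduced:
  assumes Z: "Z = central_exponents \<sigma>" and ij: "i \<in> {1..\<nu>}" "j \<in> {1..\<nu>}"
  shows "compatible (e_op_reduced \<sigma> i j k)"
proof -
  obtain m \<alpha> where k: "k = (m, \<alpha>)" by (cases k)
  have one: "1 \<in> {1..\<nu>}" using \<nu>1 by auto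
  have E: "compatible (Poly_Mapping.map (E_prod i j (\<sigma> \<alpha>) m))"
    by (intro compatible_map adapted_E_prod ij) (simp add: Z central_exponents_def)
  consider "i \<noteq> j" | "i = j" "\<sigma> \<alpha> \<noteq> 1" | "i = j" "\<sigma> \<alpha> = 1" "even m"
    | "i = j" "\<sigma> \<alpha> = 1" "odd m" "m \<notin> Z" | "i = j" "\<sigma> \<alpha> = 1" "odd m" "m \<in> Z" by blast
  then show ?thesis
  proof cases
    case 1
    have "e_op_reduced \<sigma> i j k = (\<lambda>f. mscale (1/2) (mscale (cocyc (eps i) (eps j))
        (left_mult (eps i - eps j) (Poly_Mapping.map (E_prod i j (\<sigma> \<alpha>) m) f))))"
      using 1 by (simp add: e_op_reduced_def e_op_def x_op_def k fun_eq_iff)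
    then show ?thesis by (simp only:) (intro compatible_scale compatible_left_mult E ij)
  next
    case 2
    have "e_op_reduced \<sigma> i j k = (\<lambda>f. mscale (1/2) (mscale ((1 + \<sigma> \<alpha>) / (1 - \<sigma> \<alpha>))
        (Poly_Mapping.map (E_prod i j (\<sigma> \<alpha>) m) f - mscale (if m = 0 then 1 else 0) f)
         + mscale (if m = 0 then (1 + \<sigma> \<alpha>) / (1 - \<sigma> \<alpha>) else 0) f))"
      using 2 by (simp add: e_op_reduced_def e_op_def x_op_def k fun_eq_iff central_index_def)
    then show ?thesis
      by (simp only:) (intro compatible_scale compatible_add compatible_diff compatible_id E)
  next
    case 3
    then have "e_op_reduced \<sigma> i j k = (\<lambda>f. 0)"
      by (simp add: e_op_reduced_def e_op_def x_op_def k fun_eq_iff)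
    then show ?thesis by (simp only: compatible_zero)
  next
    case 4
    have "e_op_reduced \<sigma> i j k = (\<lambda>f. mscale (1/2) (mscale 4 (Poly_Mapping.map (heis i m) f)))"
      using 4 by (simp add: e_op_reduced_def e_op_def x_op_def k fun_eq_iff central_index_def Z)
    then show ?thesis
      by (simp only:) (intro compatible_scale compatible_map adapted_heis ij 4)
  next
    case 5
    have "e_op_reduced \<sigma> i j k = (\<lambda>f. mscale (1/2) (mscale 4 (Poly_Mapping.map (\<lambda>p. heis i m p - heis 1 m p) f)))"
      using 5 by (simp add: e_op_reduced_def e_op_def x_op_def k fun_eq_iff central_index_def Z
          map_diff heis_lin mscale.scale_right_diff_distrib)
    then show ?thesis
      by (simp only:) (intro compatible_scale compatible_map adapted_heis_diff ij 5 one)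
  qed
qed

lemma compatible_u_act:
  assumes Z: "Z = central_exponents \<sigma>" and x: "x \<in> trace_free \<nu> \<sigma>"
  shows "compatible (u_act \<sigma> x)"
proof -
  have "compatible (\<lambda>f. (\<Sum>p\<in>Poly_Mapping.keys (fst x). \<Sum>k\<in>Poly_Mapping.keys (Poly_Mapping.lookup (fst x) p).
        mscale (Poly_Mapping.lookup (Poly_Mapping.lookup (fst x) p) k / 2) (e_op_reduced \<sigma> (fst p) (snd p) k f))
      + mscale (snd x / 2) f)"
    using x
    by (intro compatible_add compatible_sum compatible_scale compatible_id compatible_e_op_reduced Z)
      (auto simp: trace_free_def gl_carrier_def)
  moreover have "u_act \<sigma> x = (\<lambda>f. (\<Sum>p\<in>Poly_Mapping.keys (fst x). \<Sum>k\<in>Poly_Mapping.keys (Poly_Mapping.lookup (fst x) p).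
        mscale (Poly_Mapping.lookup (Poly_Mapping.lookup (fst x) p) k / 2) (e_op_reduced \<sigma> (fst p) (snd p) k f))
      + mscale (snd x / 2) f)"
    by (simp add: fun_eq_iff u_act_reduced[OF x] psum_def split_def)
  ultimately show ?thesis by simp
qed

end

section \<open>Heisenberg operators in the elementary subalgebra\<close>

lemma gl_cocycle_eq_0:
  assumes "\<And>p m \<alpha>. Poly_Mapping.lookup (Poly_Mapping.lookup X p) (m, \<alpha>) \<noteq> 0 \<Longrightarrow> m = k"
    and "\<And>p m \<alpha>. Poly_Mapping.lookup (Poly_Mapping.lookup Y p) (m, \<alpha>) \<noteq> 0 \<Longrightarrow> m = l"
    and "k + l \<noteq> 0"
  shows "gl_cocycle \<sigma> X Y = 0"
  unfolding gl_cocycle_def psum_def split_def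
proof (intro sum.neutral ballI)
  fix p q r s
  assume "r \<in> Poly_Mapping.keys (Poly_Mapping.lookup X p)" "s \<in> Poly_Mapping.keys (Poly_Mapping.lookup Y q)"
  then have "fst r = k" "fst s = l"
    using assms(1)[of p "fst r" "snd r"] assms(2)[of q "fst s" "snd s"] by (auto simp: in_keys_iff)
  then show "(if fst p = snd q \<and> snd p = fst q \<and> fst r + fst s = 0 \<and> \<sigma> (snd r) * \<sigma> (snd s) = 1
      then Poly_Mapping.lookup (Poly_Mapping.lookup X p) r * Poly_Mapping.lookup (Poly_Mapping.lookup Y q) s
        * of_int (fst r) * \<sigma> (snd r) powi fst s else 0) = 0"
    using assms(3) by simp
qed

lemma e_gen_lookup:
  assumes "Poly_Mapping.lookup (Poly_Mapping.lookup (fst (e_gen \<sigma> i j k \<alpha>)) p) (m, \<beta>) \<noteq> 0"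
  shows "m = k"
  using assms by (auto simp: e_gen_def lookup_minus lookup_single when_def te_def rbar_single split: if_splits)

text \<open>
  For \<open>i \<noteq> j\<close> and arbitrary \<open>A, B\<close>, the bracket of \<open>E\<^sub>i\<^sub>j A - E\<^sub>j\<^sub>i A\<^sup>-\<close> and \<open>E\<^sub>j\<^sub>i B - E\<^sub>i\<^sub>j B\<^sup>-\<close>, with \<open>A\<^sup>-\<close>
  the image under the anti-involution, is \<open>E\<^sub>i\<^sub>i (AB - (AB)\<^sup>-) - E\<^sub>j\<^sub>j (BA - (BA)\<^sup>-)\<close>.  The exponents are chosen
  as \<open>k + 0 \<noteq> 0\<close> to avoid a central term.
\<close>

lemma hbracket_e_gen:
  assumes \<sigma>: "character \<sigma>" and "i \<noteq> j" "k \<noteq> 0"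
  shows "hbracket \<sigma> (e_gen \<sigma> i j k \<alpha>) (e_gen \<sigma> j i 0 (- \<alpha>))
     = e_gen \<sigma> i i k 0 + hscale (- (\<sigma> (- \<alpha>) powi k)) (e_gen \<sigma> j j k 0)"
proof -
  let ?A = "te k \<alpha> :: 'a rsig" and ?B = "te 0 (- \<alpha>) :: 'a rsig"
  have AB: "rmult \<sigma> ?A ?B = te k 0" and BA: "rmult \<sigma> ?B ?A = pscale (\<sigma> (- \<alpha>) powi k) (te k 0)"
    by (simp_all add: rmult_te)
  have "rmult \<sigma> (rbar \<sigma> ?A) (rbar \<sigma> ?B) = rbar \<sigma> (rmult \<sigma> ?B ?A)"
    "rmult \<sigma> (rbar \<sigma> ?B) (rbar \<sigma> ?A) = rbar \<sigma> (rmult \<sigma> ?A ?B)"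
    by (simp_all add: rbar_rmult[OF \<sigma>])
  moreover have "rbar \<sigma> (pscale c (te k 0)) = pscale c (rbar \<sigma> (te k 0 :: 'a rsig))" for c
    by (simp add: te_def rbar_single)
  ultimately have AB': "rmult \<sigma> (rbar \<sigma> ?A) (rbar \<sigma> ?B) = pscale (\<sigma> (- \<alpha>) powi k) (rbar \<sigma> (te k 0))"
    "rmult \<sigma> (rbar \<sigma> ?B) (rbar \<sigma> ?A) = rbar \<sigma> (te k 0)"
    by (simp_all add: AB BA)
  have "gl_cocycle \<sigma> (fst (e_gen \<sigma> i j k \<alpha>)) (fst (e_gen \<sigma> j i 0 (- \<alpha>))) = 0"
    by (rule gl_cocycle_eq_0[of _ k _ 0]) (use assms(3) in \<open>auto dest: e_gen_lookup\<close>)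
  moreover have mm: "mmult \<sigma> (X - Y) W = mmult \<sigma> X W - mmult \<sigma> Y W" "mmult \<sigma> W (X - Y) = mmult \<sigma> W X - mmult \<sigma> W Y" for X Y W
    using mmult_add_left[of \<sigma> "X - Y" Y W] mmult_add_right[of \<sigma> W "X - Y" Y] by simp_all
  ultimately show ?thesis
    using assms(2)
    by (simp add: hbracket_def e_gen_def hscale_def mmult_single AB BA AB' plus_prod_def
        mscale.scale_right_diff_distrib mscale.scale_minus_left single_uminus)
qed

lemma u_act_hscale: "u_act \<sigma> (hscale c x) f = mscale c (u_act \<sigma> x f)"
proof -
  have "psum (mscale c X) (\<lambda>(i, j) r. psum r (\<lambda>(m, \<alpha>) a. mscale (a / 2) (e_op \<sigma> i j m \<alpha> f)))
    = mscale c (psum X (\<lambda>(i, j) r. psum r (\<lambda>(m, \<alpha>) a. mscale (a / 2) (e_op \<sigma> i j m \<alpha> f))))" for X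
  proof (rule psum_superset[THEN trans])
    show "finite (Poly_Mapping.keys X)" by simp
    show "Poly_Mapping.keys (mscale c X) \<subseteq> Poly_Mapping.keys X" by (auto simp: in_keys_iff)
    have "psum (pscale c r) (\<lambda>(m, \<alpha>) a. mscale (a / 2) (e_op \<sigma> i j m \<alpha> f))
       = mscale c (psum r (\<lambda>(m, \<alpha>) a. mscale (a / 2) (e_op \<sigma> i j m \<alpha> f)))" for i j r
      by (rule psum_pscale) (auto simp: mscale.scale_right_distrib)
    then show "(\<Sum>k\<in>Poly_Mapping.keys X. (\<lambda>(i, j) r. psum r (\<lambda>(m, \<alpha>) a. mscale (a / 2) (e_op \<sigma> i j m \<alpha> f))) k
       (Poly_Mapping.lookup (mscale c X) k))
       = mscale c (psum X (\<lambda>(i, j) r. psum r (\<lambda>(m, \<alpha>) a. mscale (a / 2) (e_op \<sigma> i j m \<alpha> f))))"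
      by (simp add: psum_def[of X] mscale.scale_sum_right split_def)
  qed auto
  then show ?thesis
    by (simp add: u_act_def hscale_def mscale.scale_right_distrib)
qed

lemma character_zero: "character \<sigma> \<Longrightarrow> \<sigma> 0 = 1"
proof -
  assume c: "character \<sigma>"
  then have "\<sigma> 0 * \<sigma> 0 = \<sigma> 0" "\<sigma> 0 \<noteq> 0" by (metis add.right_neutral character_def)+
  then show ?thesis by simp
qed

lemma e_op_diag:
  assumes "character \<sigma>" "odd k"
  shows "e_op \<sigma> i i k 0 f = mscale 2 (Poly_Mapping.map (heis i k) f)"
  using assms by (simp add: e_op_def x_op_def character_zero)

lemma submod_heis_combination:
  assumes \<sigma>: "character \<sigma>" and U: "submod (eu_hat \<nu> \<sigma>) (u_act \<sigma>) U"
    and ij: "i \<in> {1..\<nu>}" "j \<in> {1..\<nu>}" "i \<noteq> j" and k: "odd k" and f: "f \<in> U"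
  shows "Poly_Mapping.map (heis i k) f - mscale (\<sigma> \<alpha> powi k) (Poly_Mapping.map (heis j k) f) \<in> U"
proof -
  have sub: "mscale.subspace U" using U by (simp add: submod_def)
  let ?x = "hbracket \<sigma> (e_gen \<sigma> i j k (- \<alpha>)) (e_gen \<sigma> j i 0 (- (- \<alpha>)))"
  have "?x \<in> eu_hat \<nu> \<sigma>" using ij by (intro eu_hat.bracket eu_hat.gen) auto
  then have "u_act \<sigma> ?x f \<in> U" using U f by (simp add: submod_def)
  moreover have k0: "k \<noteq> 0" using k by auto
  have "u_act \<sigma> ?x f = mscale 2 (Poly_Mapping.map (heis i k) f
      - mscale (\<sigma> \<alpha> powi k) (Poly_Mapping.map (heis j k) f))"
    unfolding hbracket_e_gen[OF \<sigma> ij(3) k0]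
    by (simp only: u_act_add u_act_hscale u_act_e_gen[OF \<sigma>] e_op_diag[OF \<sigma> k] minus_minus)
      (simp add: mscale.scale_right_diff_distrib mult.commute)
  ultimately have "mscale (1/2) (mscale 2 (Poly_Mapping.map (heis i k) f
      - mscale (\<sigma> \<alpha> powi k) (Poly_Mapping.map (heis j k) f))) \<in> U"
    by (metis mscale.subspace_scale[OF sub])
  then show ?thesis by simp
qed

lemma submod_heis_diff:
  assumes \<sigma>: "character \<sigma>" and U: "submod (eu_hat \<nu> \<sigma>) (u_act \<sigma>) U"
    and ij: "i \<in> {1..\<nu>}" "j \<in> {1..\<nu>}" "i \<noteq> j" and k: "odd k" and f: "f \<in> U"
  shows "Poly_Mapping.map (heis i k) f - Poly_Mapping.map (heis j k) f \<in> U"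
  using submod_heis_combination[OF assms, of 0] by (simp add: character_zero[OF \<sigma>])

text \<open>
  The combinations \<open>\<epsilon>\<^sub>j(k) - \<sigma>(\<alpha>)\<^sup>k \<epsilon>\<^sub>i(k)\<close> for \<open>\<alpha> = 0\<close> and for some \<open>\<alpha>\<close> with \<open>\<sigma>(\<alpha>)\<^sup>k \<noteq> 1\<close> are linearly
  independent.
\<close>

lemma submod_heis:
  assumes \<sigma>: "character \<sigma>" and U: "submod (eu_hat \<nu> \<sigma>) (u_act \<sigma>) U" and \<nu>: "\<nu> \<ge> 2"
    and i: "i \<in> {1..\<nu>}" and k: "odd k" "k \<notin> central_exponents \<sigma>" and f: "f \<in> U"
  shows "Poly_Mapping.map (heis i k) f \<in> U"
proof -
  have sub: "mscale.subspace U" using U by (simp add: submod_def)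
  obtain j where j: "j \<in> {1..\<nu>}" "j \<noteq> i"
    by (rule that[of "if i = 1 then 2 else 1"]) (use \<nu> in auto)
  obtain \<alpha> where \<alpha>: "\<sigma> \<alpha> powi k \<noteq> 1" using k(2) by (auto simp: central_exponents_def)
  let ?c = "\<sigma> \<alpha> powi k"
  let ?h = "\<lambda>i. Poly_Mapping.map (heis i k) f"
  have "(?h j - ?h i) - (?h j - mscale ?c (?h i)) \<in> U"
    by (intro mscale.subspace_diff[OF sub] submod_heis_diff[OF \<sigma> U] submod_heis_combination[OF \<sigma> U] i j k f)
  moreover have "(?h j - ?h i) - (?h j - mscale ?c (?h i)) = mscale (?c - 1) (?h i)"
    by (simp add: mscale.scale_left_diff_distrib)
  ultimately have "mscale (1 / (?c - 1)) (mscale (?c - 1) (?h i)) \<in> U"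
    by (metis mscale.subspace_scale[OF sub])
  then show ?thesis using \<alpha> by simp
qed

lemma submod_clifford:
  assumes \<sigma>: "character \<sigma>" and U: "submod (eu_hat \<nu> \<sigma>) (u_act \<sigma>) U"
    and ij: "i \<in> {1..\<nu>}" "j \<in> {1..\<nu>}" "i \<noteq> j" and u: "tens u 1 \<in> U"
  shows "tens (tmult (ebar (eps i - eps j)) u) 1 \<in> U"
proof -
  have sub: "mscale.subspace U" using U by (simp add: submod_def)
  have "e_gen \<sigma> i j 0 0 \<in> eu_hat \<nu> \<sigma>" using ij by (intro eu_hat.gen) auto
  then have "u_act \<sigma> (e_gen \<sigma> i j 0 0) (tens u 1) \<in> U" using U u unfolding submod_def by blast
  then have 1: "e_op \<sigma> i j 0 0 (tens u 1) \<in> U" by (simp only: u_act_e_gen[OF \<sigma>])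
  let ?c = "1 / 2 * cocyc (eps i) (eps j)"
  have "E_prod i j 1 0 1 = 1" using E_prod_const[of i j 1 1] by simp
  then have "e_op \<sigma> i j 0 0 (tens u 1) = mscale ?c (tens (tmult (ebar (eps i - eps j)) u) 1)"
    using ij by (simp add: e_op_def x_op_def character_zero[OF \<sigma>] map_lin_tens[OF E_prod_lin] left_mult_tens)
  moreover have "?c \<noteq> 0" by (simp add: cocyc_eps)
  ultimately have "tens (tmult (ebar (eps i - eps j)) u) 1 = mscale (1 / ?c) (e_op \<sigma> i j 0 0 (tens u 1))"
    by simp
  then show ?thesis using mscale.subspace_scale[OF sub 1] by metis
qed


section \<open>Decomposition into irreducible submodules\<close>

lemma irreducible_image:
  assumes irr: "irreducible_mod L act W"
    and add: "\<And>f g. \<phi> (f + g) = \<phi> f + \<phi> g" and scl: "\<And>c f. \<phi> (mscale c f) = mscale c (\<phi> f)"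
    and comm: "\<And>x f. x \<in> L \<Longrightarrow> act x (\<phi> f) = \<phi> (act x f)"
    and inj: "\<And>f. f \<in> W \<Longrightarrow> \<phi> f = 0 \<Longrightarrow> f = 0"
  shows "irreducible_mod L act (\<phi> ` W)"
proof -
  have W: "mscale.subspace W" and act: "\<And>x f. x \<in> L \<Longrightarrow> f \<in> W \<Longrightarrow> act x f \<in> W"
    and W0: "W \<noteq> {0}" and min: "\<And>U. submod L act U \<Longrightarrow> U \<subseteq> W \<Longrightarrow> U = {0} \<or> U = W"
    using irr by (auto simp: irreducible_mod_def submod_def)
  have \<phi>0: "\<phi> 0 = 0" using scl[of 0 0] by simp
  have "mscale.subspace (\<phi> ` W)"
  proof (rule mscale.subspaceI)
    show "0 \<in> \<phi> ` W" using \<phi>0 mscale.subspace_0[OF W] by (metis imageI)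
  next
    fix x y assume "x \<in> \<phi> ` W" "y \<in> \<phi> ` W"
    then show "x + y \<in> \<phi> ` W" by (auto simp: add[symmetric] intro!: imageI mscale.subspace_add[OF W])
  next
    fix c x assume "x \<in> \<phi> ` W"
    then show "mscale c x \<in> \<phi> ` W" by (auto simp: scl[symmetric] intro!: imageI mscale.subspace_scale[OF W])
  qed
  then have sub: "submod L act (\<phi> ` W)" by (auto simp: submod_def comm act)
  obtain w where "w \<in> W" "w \<noteq> 0" using W0 mscale.subspace_0[OF W] by blast
  then have ne: "\<phi> ` W \<noteq> {0}" using inj by blast
  have "U = {0} \<or> U = \<phi> ` W" if U: "submod L act U" "U \<subseteq> \<phi> ` W" for U
  proof -
    let ?U = "{w \<in> W. \<phi> w \<in> U}"
    have sU: "mscale.subspace U" using U by (simp add: submod_def)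
    have "mscale.subspace ?U"
      using mscale.subspace_inter[OF W mscale_linear_vimage[OF add scl sU]] by (simp add: Int_def)
    moreover have "act x w \<in> ?U" if "x \<in> L" "w \<in> ?U" for x w
      using that U(1) act comm[of x w, symmetric] by (auto simp: submod_def)
    ultimately have "submod L act ?U" by (simp add: submod_def)
    then have "?U = {0} \<or> ?U = W" by (rule min) auto
    moreover have "U = \<phi> ` ?U" using U(2) by auto
    ultimately show ?thesis using \<phi>0 by auto
  qed
  with sub ne show ?thesis by (auto simp: irreducible_mod_def)
qed

lemma trace_monom_Sym_H_minus:
  "set_mset M \<subseteq> Zneg Z \<Longrightarrow> s \<in> Sym (H_minus \<nu>) \<Longrightarrow> trace_monom \<nu> M * s \<in> Sym (H_minus \<nu>)"
proof (induction M)
  case (add n M)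
  have "trace_var \<nu> n \<in> H_minus \<nu>"
    unfolding trace_var_def H_minus_def
    by (intro pscale.span_sum pscale.span_base) (use add.prems in \<open>auto simp: Zneg_def\<close>)
  then show ?case
    using add by (auto simp: trace_monom_add mult.assoc intro: Sym_mult)
qed simp

context fock_setup begin

abbreviation "W \<equiv> tensor_space (V_space \<nu> \<gamma>) (Sym (H_minus \<nu>))"
abbreviation "shift M \<equiv> Poly_Mapping.map ((*) (trace_monom \<nu> M))"

lemma shift_add_mset: "shift (add_mset n M) f = Poly_Mapping.map ((*) (trace_var \<nu> n)) (shift M f)"
  by (rule poly_mapping_eqI) (simp add: lookup_map_lin lin_mult trace_monom_add mult.assoc)

lemma compatible_shift:
  "compatible Op \<Longrightarrow> set_mset M \<subseteq> Zneg Z \<Longrightarrow> Op (shift M f) = shift M (Op f)"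
proof (induction M)
  case empty
  have e: "shift {#} g = g" for g :: fock
    by (rule poly_mapping_eqI) (simp add: lookup_map_lin lin_mult)
  show ?case unfolding e by (rule refl)
next
  case (add n M)
  then show ?case by (simp add: shift_add_mset compatible_def)
qed

lemma shift_inj:
  assumes "set_mset M \<subseteq> Zneg Z" "f \<in> W0" "shift M f = 0"
  shows "f = 0"
proof (rule poly_mapping_eqI)
  fix A
  have f: "Poly_Mapping.lookup f A \<in> Sym (HZ \<nu> Z)"
    by (rule tensor_space_coeff[OF Sym_subspace assms(2)])
  have "Poly_Mapping.lookup f A = 0"
  proof (rule trace_monom_mult_inj)
    show "\<nu> > 0" using \<nu>1 by simp
    show "trace_pd \<nu> n (Poly_Mapping.lookup f A) = 0" if "n \<in># M" for n
      by (rule trace_pd_HZ[OF _ f]) (use assms(1) that in blast)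
    show "trace_monom \<nu> M * Poly_Mapping.lookup f A = 0"
      unfolding lookup_map_lin[OF lin_mult, symmetric] assms(3) by simp
  qed
  then show "Poly_Mapping.lookup f A = Poly_Mapping.lookup 0 A" by simp
qed

lemma W_eq_span: "W = mscale.span (\<Union>M\<in>{M. set_mset M \<subseteq> Zneg Z}. shift M ` W0)"
  (is "_ = mscale.span ?G")
proof
  show "W \<subseteq> mscale.span ?G"
  proof (rule tensor_space_least)
    fix u s assume u: "u \<in> V_space \<nu> \<gamma>" and s: "s \<in> Sym (H_minus \<nu>)"
    have "pscale.span (\<Union>M\<in>{M. set_mset M \<subseteq> Zneg Z}. (*) (trace_monom \<nu> M) ` Sym (HZ \<nu> Z))
        \<subseteq> {s. tens u s \<in> mscale.span ?G}"
    proof (rule pscale.span_minimal)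
      show "pscale.subspace {s. tens u s \<in> mscale.span ?G}"
        by (rule pscale.subspaceI) (auto simp: tens_add_right tens_pscale_right mscale.span_zero
           mscale.span_add mscale.span_scale)
      have "tens u (trace_monom \<nu> M * s) \<in> mscale.span ?G" if "set_mset M \<subseteq> Zneg Z" "s \<in> Sym (HZ \<nu> Z)" for M s
      proof -
        have "tens u (trace_monom \<nu> M * s) = shift M (tens u s)" by (simp add: map_lin_tens lin_mult)
        then show ?thesis using that u by (intro mscale.span_base) (auto intro: tens_in_tensor_space)
      qed
      then show "(\<Union>M\<in>{M. set_mset M \<subseteq> Zneg Z}. (*) (trace_monom \<nu> M) ` Sym (HZ \<nu> Z))
        \<subseteq> {s. tens u s \<in> mscale.span ?G}" by auto
    qed
    then show "tens u s \<in> mscale.span ?G" using Sym_H_minus_decompose[of \<nu> Z] s \<nu>1 by auto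
  qed simp
  show "mscale.span ?G \<subseteq> W"
  proof (intro mscale.span_minimal tensor_space_subspace UN_least image_subsetI)
    fix M f assume "M \<in> {M. set_mset M \<subseteq> Zneg Z}" "f \<in> W0"
    then show "shift M f \<in> W"
      by (intro map_tensor_space[of "(*) (trace_monom \<nu> M)" "Sym (HZ \<nu> Z)"] lin_mult)
        (auto intro: trace_monom_Sym_H_minus Sym_HZ_imp_Sym_H_minus)
  qed
qed

lemma shift_image_subspace: "mscale.subspace (shift M ` W0)"
proof (rule mscale.subspaceI)
  show "0 \<in> shift M ` W0"
    by (rule image_eqI[of _ _ 0]) (auto simp: pm_map_zero mscale.subspace_0[OF tensor_space_subspace])
next
  fix x y assume "x \<in> shift M ` W0" "y \<in> shift M ` W0"
  then show "x + y \<in> shift M ` W0"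
    by (auto simp: map_lin_add[OF lin_mult, symmetric] intro!: imageI mscale.subspace_add[OF tensor_space_subspace])
next
  fix c x assume "x \<in> shift M ` W0"
  then show "mscale c x \<in> shift M ` W0"
    by (auto simp: map_lin_mscale[OF lin_mult, symmetric] intro!: imageI mscale.subspace_scale[OF tensor_space_subspace])
qed

lemma shift_euler:
  assumes "f \<in> shift M ` W0" "n \<in> Zneg Z"
  shows "Poly_Mapping.map (\<lambda>p. trace_var \<nu> n * trace_pd \<nu> n p) f = mscale (of_nat (\<nu> * count M n)) f"
proof -
  obtain g where g: "g \<in> W0" "f = shift M g" using assms(1) by blast
  have "trace_pd \<nu> n (Poly_Mapping.lookup g A) = 0" for A
    by (rule trace_pd_HZ[OF assms(2) tensor_space_coeff[OF Sym_subspace g(1)]])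
  then show ?thesis
    unfolding g(2)
    by (intro poly_mapping_eqI)
      (simp add: lookup_map_lin lin_mult lin_comp[OF lin_mult trace_pd_lin] trace_euler del: of_nat_mult)
qed

text \<open>
  The operators \<open>y\<^sub>n D\<^sub>n\<close> act on the summand \<open>y\<^sup>M (V(\<gamma>) \<otimes> S(H\<^sub>Z))\<close> by the multiplicities of \<open>n\<close> in \<open>M\<close>, and
  these determine \<open>M\<close>.
\<close>

lemma shift_independent:
  assumes M: "set_mset M \<subseteq> Zneg Z" and f: "f \<in> shift M ` W0"
    and span: "f \<in> mscale.span (\<Union>M'\<in>{M'. set_mset M' \<subseteq> Zneg Z \<and> M' \<noteq> M}. shift M' ` W0)"
  shows "f = 0"
proof -
  obtain A g where A: "finite A" "A \<subseteq> {M'. set_mset M' \<subseteq> Zneg Z \<and> M' \<noteq> M}"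
     "\<And>M'. M' \<in> A \<Longrightarrow> g M' \<in> shift M' ` W0" "f = sum g A"
    using span by (rule mscale.span_UN_decompose[rotated]) (auto intro: shift_image_subspace)
  \<comment> \<open>Subtracting \<open>f\<close> from its second expression gives a vanishing sum over distinct monomials.\<close>
  let ?g = "\<lambda>M'. if M' = M then - f else g M'"
  let ?T = "\<lambda>n. Poly_Mapping.map (\<lambda>p. trace_var \<nu> n * trace_pd \<nu> n p)"
  have MA: "M \<notin> A" using A(2) by auto
  have l: "lin (\<lambda>p. trace_var \<nu> n * trace_pd \<nu> n p)" for n by (rule lin_comp[OF lin_mult trace_pd_lin])
  have "sum ?g A = sum g A" by (rule sum.cong) (use MA in auto)
  then have "sum ?g (insert M A) \<in> {0}" using A MA by simp
  then have "\<forall>M'\<in>insert M A. ?g M' \<in> {0}"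
  proof (rule mscale.joint_eigen_components[where T = ?T and K = "Zneg Z" and lam = "\<lambda>M n. of_nat (\<nu> * count M n)", rotated -1])
    show "mscale.subspace {0}" by (simp add: mscale.subspace_def)
    show "?T n (x + y) = ?T n x + ?T n y" for n x y by (rule map_lin_add[OF l])
    show "?T n (mscale c x) = mscale c (?T n x)" for n c x by (rule map_lin_mscale[OF l])
    show "finite (insert M A)" using A by simp
    show "\<And>n x. x \<in> {0} \<Longrightarrow> ?T n x \<in> {0}" by (simp add: pm_map_zero)
  next
    fix M' n assume "M' \<in> insert M A" and n: "n \<in> Zneg Z"
    then have "?g M' \<in> shift M' ` W0"
      using A(3) mscale.subspace_neg[OF shift_image_subspace f] by auto
    then show "?T n (?g M') = mscale (of_nat (\<nu> * count M' n)) (?g M')" by (rule shift_euler[OF _ n])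
  next
    fix M1 M2 assume M12: "M1 \<in> insert M A" "M2 \<in> insert M A" "M1 \<noteq> M2"
    then obtain n where n: "count M1 n \<noteq> count M2 n" by (meson multiset_eqI)
    then have "n \<in># M1 \<or> n \<in># M2" by (metis count_eq_zero_iff)
    then have "n \<in> Zneg Z" using M12 A(2) M by auto
    then show "\<exists>n\<in>Zneg Z. (of_nat (\<nu> * count M1 n) :: complex) \<noteq> of_nat (\<nu> * count M2 n)"
      using n \<nu>1 by (intro bexI[of _ n]) (auto simp del: of_nat_mult)
  qed
  then show ?thesis by simp
qed

text \<open>
  The operators in question commute with the \<open>y\<^sub>n\<close>, so every \<open>y\<^sup>M (V(\<gamma>) \<otimes> S(H\<^sub>Z))\<close> is an isomorphic copy of
  the irreducible module \<open>V(\<gamma>) \<otimes> S(H\<^sub>Z)\<close>.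
\<close>

lemma completely_reducible_Fock:
  assumes irr: "irreducible_mod L act W0" and comp: "\<And>x. x \<in> L \<Longrightarrow> compatible (act x)"
  shows "completely_reducible_mod L act W"
proof -
  let ?I = "{M. set_mset M \<subseteq> Zneg Z}"
  let ?F = "(\<lambda>M. shift M ` W0) ` ?I"
  have irrM: "irreducible_mod L act (shift M ` W0)" if M: "M \<in> ?I" for M
    by (rule irreducible_image[OF irr])
      (use M comp in \<open>auto simp: map_lin_add[OF lin_mult] map_lin_mscale[OF lin_mult] compatible_shift intro: shift_inj\<close>)
  have sub: "submod L act W"
    unfolding submod_def
  proof (intro conjI ballI tensor_space_subspace)
    fix x f assume x: "x \<in> L" and f: "f \<in> W"
    have "mscale.span (\<Union>M\<in>?I. shift M ` W0) \<subseteq> {f. act x f \<in> W}"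
    proof (rule mscale.span_minimal)
      show "mscale.subspace {f. act x f \<in> W}"
        by (rule mscale_linear_vimage) (use comp[OF x] in \<open>auto simp: compatible_def tensor_space_subspace\<close>)
      have "act x g \<in> W" if "M \<in> ?I" "g \<in> shift M ` W0" for M g
      proof -
        have "act x g \<in> shift M ` W0"
          using irrM[OF that(1)] x that(2) by (auto simp: irreducible_mod_def submod_def)
        then have "act x g \<in> mscale.span (\<Union>M\<in>?I. shift M ` W0)"
          using that(1) by (intro mscale.span_base) blast
        then show ?thesis by (simp only: W_eq_span)
      qed
      then show "(\<Union>M\<in>?I. shift M ` W0) \<subseteq> {f. act x f \<in> W}" by blast
    qed
    then show "act x f \<in> W" using f unfolding W_eq_span by blast
  qed
  have "U \<inter> mscale.span (\<Union>(?F - {U})) = {0}" if UF: "U \<in> ?F" for U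
  proof -
    obtain M where M: "M \<in> ?I" "U = shift M ` W0" using UF by blast
    have "\<Union>(?F - {U}) \<subseteq> (\<Union>M'\<in>{M'. set_mset M' \<subseteq> Zneg Z \<and> M' \<noteq> M}. shift M' ` W0)"
      using M by auto
    then have "mscale.span (\<Union>(?F - {U})) \<subseteq> mscale.span (\<Union>M'\<in>{M'. set_mset M' \<subseteq> Zneg Z \<and> M' \<noteq> M}. shift M' ` W0)"
      by (rule mscale.span_mono)
    then have "f = 0" if f: "f \<in> U" "f \<in> mscale.span (\<Union>(?F - {U}))" for f
      by (intro shift_independent[of M f]) (use M f in auto)
    moreover have "0 \<in> U" using M mscale.subspace_0[OF shift_image_subspace] by simp
    ultimately show ?thesis using mscale.span_zero by blast
  qed
  then show ?thesis
    unfolding completely_reducible_mod_def using sub irrM W_eq_span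
    by (intro conjI exI[of _ ?F]) auto
qed

end

section \<open>The Fock space as a module of the elementary unitary Lie algebra\<close>

lemma fock_setup_central: "\<nu> \<ge> 1 \<Longrightarrow> fock_setup \<nu> (central_exponents \<sigma>)"
  by unfold_locales (auto intro: central_exponents_uminus)

lemma eu_hat_compatible:
  assumes "\<nu> \<ge> 1" "character \<sigma>" "x \<in> eu_hat \<nu> \<sigma>"
  shows "fock_setup.compatible \<nu> (central_exponents \<sigma>) \<gamma> (u_act \<sigma> x)"
  using fock_setup.compatible_u_act[OF fock_setup_central[OF assms(1)] refl eu_hat_trace_free[OF assms(2,3)]] .

lemma eu_hat_irreducible:
  assumes \<nu>: "\<nu> \<ge> 2" and \<sigma>: "character \<sigma>" and \<gamma>: "\<forall>k\<in>{1..\<nu> div 2 + 1}. \<gamma> k \<in> {1, -1}"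
  shows "irreducible_mod (eu_hat \<nu> \<sigma>) (u_act \<sigma>)
     (tensor_space (V_space \<nu> \<gamma>) (Sym (HZ \<nu> (central_exponents \<sigma>))))" (is "irreducible_mod _ _ ?W")
proof -
  have \<nu>1: "\<nu> \<ge> 1" using \<nu> by simp
  have "u_act \<sigma> x f \<in> ?W" if "x \<in> eu_hat \<nu> \<sigma>" "f \<in> ?W" for x f
    using eu_hat_compatible[OF \<nu>1 \<sigma> that(1)] that(2)
    unfolding fock_setup.compatible_def[OF fock_setup_central[OF \<nu>1]] by blast
  then have sub: "submod (eu_hat \<nu> \<sigma>) (u_act \<sigma>) ?W"
    by (simp add: submod_def tensor_space_subspace)
  obtain \<rho> where \<rho>: "admissible \<nu> \<gamma> \<rho>" using admissible_exists[OF \<nu> \<gamma>] by blast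
  have "tens (w_prod \<rho> \<nu>) 1 \<in> ?W"
    by (intro tens_in_tensor_space Sym_one) (use \<rho> in \<open>auto simp: V_space_def intro: pscale.span_base\<close>)
  moreover have "Poly_Mapping.lookup (tens (w_prod \<rho> \<nu>) 1) 0 \<noteq> 0"
    by (simp add: lookup_tens w_prod_constant_term)
  then have "tens (w_prod \<rho> \<nu>) 1 \<noteq> 0" by auto
  ultimately have ne: "?W \<noteq> {0}" by blast
  have "U = {0} \<or> U = ?W" if U: "submod (eu_hat \<nu> \<sigma>) (u_act \<sigma>) U" "U \<subseteq> ?W" for U
  proof (cases "U = {0}")
    case False
    have "U = ?W"
    proof (rule Fock_irreducible[OF \<nu>1 central_exponents_uminus _ U(2) False])
      show "mscale.subspace U" using U(1) by (simp add: submod_def)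
    qed (auto simp del: atLeastAtMost_iff
        intro: submod_heis[OF \<sigma> U(1) \<nu>] submod_heis_diff[OF \<sigma> U(1)] submod_clifford[OF \<sigma> U(1)])
    then show ?thesis by simp
  qed simp
  with sub ne show ?thesis by (simp add: irreducible_mod_def)
qed

lemma eu_hat_completely_reducible:
  assumes \<nu>: "\<nu> \<ge> 2" and \<sigma>: "character \<sigma>" and \<gamma>: "\<forall>k\<in>{1..\<nu> div 2 + 1}. \<gamma> k \<in> {1, -1}"
  shows "completely_reducible_mod (eu_hat \<nu> \<sigma>) (u_act \<sigma>) (tensor_space (V_space \<nu> \<gamma>) (Sym (H_minus \<nu>)))"
proof -
  have \<nu>1: "\<nu> \<ge> 1" using \<nu> by simp
  show ?thesis
    by (rule fock_setup.completely_reducible_Fock[OF fock_setup_central[OF \<nu>1] eu_hat_irreducible[OF assms]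
          eu_hat_compatible[OF \<nu>1 \<sigma>]])
qed

section \<open>Central exponents and the order of the character\<close>

text \<open>
  Multiplication by \<open>\<sigma>(\<alpha>)\<close> permutes the image of \<open>\<sigma>\<close>; compare the products of all elements.
\<close>

lemma character_power_card:
  assumes \<sigma>: "character \<sigma>" and fin: "finite (range \<sigma>)"
  shows "\<sigma> \<alpha> ^ card (range \<sigma>) = 1"
proof -
  have nz: "\<sigma> \<beta> \<noteq> 0" and mult: "\<sigma> (\<beta> + \<beta>') = \<sigma> \<beta> * \<sigma> \<beta>'" for \<beta> \<beta>'
    using \<sigma> by (auto simp: character_def)
  have "(*) (\<sigma> \<alpha>) ` range \<sigma> = range \<sigma>"
  proof
    show "(*) (\<sigma> \<alpha>) ` range \<sigma> \<subseteq> range \<sigma>" by (auto simp: mult[symmetric])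
    show "range \<sigma> \<subseteq> (*) (\<sigma> \<alpha>) ` range \<sigma>"
    proof
      fix z assume "z \<in> range \<sigma>"
      then obtain \<beta> where "z = \<sigma> \<beta>" by blast
      then have "z = \<sigma> \<alpha> * \<sigma> (\<beta> - \<alpha>)" by (simp flip: mult)
      then show "z \<in> (*) (\<sigma> \<alpha>) ` range \<sigma>" by blast
    qed
  qed
  moreover have "inj_on ((*) (\<sigma> \<alpha>)) (range \<sigma>)" by (rule inj_onI) (use nz in auto)
  ultimately have "prod id (range \<sigma>) = (\<Prod>z\<in>range \<sigma>. \<sigma> \<alpha> * z)"
    using prod.reindex[of "(*) (\<sigma> \<alpha>)" "range \<sigma>" id] by (simp add: comp_def)
  also have "\<dots> = \<sigma> \<alpha> ^ card (range \<sigma>) * prod id (range \<sigma>)"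
    by (simp add: prod.distrib)
  finally show ?thesis using fin nz by (simp add: image_iff)
qed

text \<open>
  If all elements of a group of \<open>N\<close> complex numbers satisfy \<open>z\<^sup>n = 1\<close>, they are roots of unity of order
  \<open>gcd N n\<close>; there are only that many, so \<open>N\<close> divides \<open>n\<close>.
\<close>

lemma central_exponents_finite:
  assumes \<sigma>: "character \<sigma>" and fin: "finite (range \<sigma>)"
  shows "central_exponents \<sigma> = {n. int (card (range \<sigma>)) dvd n}"
proof (intro equalityI subsetI)
  let ?N = "card (range \<sigma>)"
  fix n assume n: "n \<in> central_exponents \<sigma>"
  have nz: "\<sigma> \<alpha> \<noteq> 0" for \<alpha> using \<sigma> by (simp add: character_def)
  have N: "?N > 0" using fin by (simp add: card_gt_0_iff)
  define d where "d = nat (gcd (int ?N) n)"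
  have d: "int d = gcd (int ?N) n" "d > 0" "d dvd ?N"
    using N by (auto simp: d_def) (metis gcd_dvd1 int_dvd_int_iff nat_int_comparison(1) gcd_ge_0_int int_nat_eq)
  obtain u v where uv: "u * int ?N + v * n = gcd (int ?N) n" using bezout_int by blast
  have "\<sigma> \<alpha> ^ d = 1" for \<alpha>
  proof -
    have "\<sigma> \<alpha> ^ d = \<sigma> \<alpha> powi (int ?N * u + n * v)"
      using uv d(1) by (simp add: mult.commute flip: power_int_of_nat)
    also have "\<dots> = (\<sigma> \<alpha> powi int ?N) powi u * (\<sigma> \<alpha> powi n) powi v"
      using nz by (simp add: power_int_add power_int_mult)
    also have "\<dots> = 1"
      using n character_power_card[OF assms] by (simp add: central_exponents_def)
    finally show ?thesis .
  qed
  then have "range \<sigma> \<subseteq> {z. z ^ d = 1}" by auto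
  then have "?N \<le> card {z::complex. z ^ d = 1}"
    using d by (intro card_mono finite_roots_unity) auto
  then have "?N \<le> d" using d by (simp add: card_roots_unity_eq)
  then have "d = ?N" using d N by (simp add: dvd_imp_le le_antisym)
  then show "n \<in> {n. int ?N dvd n}" using d by (metis gcd_dvd2 mem_Collect_eq)
next
  fix n assume "n \<in> {n. int (card (range \<sigma>)) dvd n}"
  then obtain q where "n = int (card (range \<sigma>)) * q" by (auto elim: dvdE)
  then show "n \<in> central_exponents \<sigma>"
    using character_power_card[OF assms] by (simp add: central_exponents_def power_int_mult)
qed

lemma central_exponents_infinite:
  assumes "infinite (range \<sigma>)"
  shows "central_exponents \<sigma> \<subseteq> {0}"
proof
  fix n assume n: "n \<in> central_exponents \<sigma>"
  show "n \<in> {0}"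
  proof (rule ccontr)
    assume "n \<notin> {0}"
    then have d: "nat \<bar>n\<bar> \<ge> 1" by auto
    have "\<sigma> \<alpha> ^ nat \<bar>n\<bar> = 1" for \<alpha>
    proof -
      have "\<sigma> \<alpha> powi n = 1" using n by (simp add: central_exponents_def)
      then show ?thesis by (cases "n \<ge> 0") (auto simp: power_int_def power_inverse)
    qed
    then have "range \<sigma> \<subseteq> {z. z ^ nat \<bar>n\<bar> = 1}" by auto
    then show False using assms finite_roots_unity[OF d] finite_subset by blast
  qed
qed

lemma HZ_even_eq_H_minus:
  assumes "\<And>n. n \<in> Z \<Longrightarrow> even n"
  shows "HZ \<nu> Z = H_minus \<nu>"
proof
  let ?B = "{hvar i n |i n. i \<in> {1..\<nu>} \<and> n < 0 \<and> odd n}"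
  have "hvar i m - hvar j m \<in> pscale.span ?B" if "i \<in> {1..\<nu>}" "j \<in> {1..\<nu>}" "m < 0" "odd m" for i j m
    by (intro pscale.span_diff pscale.span_base) (use that in blast)+
  then show "HZ \<nu> Z \<subseteq> H_minus \<nu>"
    unfolding HZ_def H_minus_def
    by (intro pscale.span_minimal) (auto simp del: atLeastAtMost_iff intro: pscale.span_base)
  show "H_minus \<nu> \<subseteq> HZ \<nu> Z"
    unfolding HZ_def H_minus_def by (rule pscale.span_mono) (use assms in blast)
qed

lemma HZ_multiples: "HZ \<nu> {n. int N dvd n} = H0_minus \<nu> N"
  by (simp add: HZ_def H0_minus_def)

theorem theorem4p4:
  fixes \<nu> :: nat
    and \<sigma> :: "'g::ab_group_add \<Rightarrow> complex"
    and \<gamma> :: "nat \<Rightarrow> int"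
  assumes "\<nu> \<ge> 2"
    and "character \<sigma>"
    and "\<forall>k\<in>{1..\<nu> div 2 + 1}. \<gamma> k \<in> {1, -1}"
  shows "(infinite (range \<sigma>) \<or> finite (range \<sigma>) \<and> even (card (range \<sigma>)) \<longrightarrow>
            irreducible_mod (eu_hat \<nu> \<sigma>) (u_act \<sigma>)
              (tensor_space (V_space \<nu> \<gamma>) (Sym (H_minus \<nu>)))) \<and>
         (\<forall>N. finite (range \<sigma>) \<and> card (range \<sigma>) = N \<and> odd N \<longrightarrow>
            tensor_space (V_space \<nu> \<gamma>) (Sym (H0_minus \<nu> N))
              \<subseteq> tensor_space (V_space \<nu> \<gamma>) (Sym (H_minus \<nu>)) \<and>
            irreducible_mod (eu_hat \<nu> \<sigma>) (u_act \<sigma>)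
              (tensor_space (V_space \<nu> \<gamma>) (Sym (H0_minus \<nu> N))) \<and>
            completely_reducible_mod (eu_hat \<nu> \<sigma>) (u_act \<sigma>)
              (tensor_space (V_space \<nu> \<gamma>) (Sym (H_minus \<nu>))))"
proof (intro conjI impI allI)
  assume "infinite (range \<sigma>) \<or> finite (range \<sigma>) \<and> even (card (range \<sigma>))"
  then have "even n" if "n \<in> central_exponents \<sigma>" for n
  proof
    assume "infinite (range \<sigma>)"
    then show "even n" using central_exponents_infinite that by force
  next
    assume "finite (range \<sigma>) \<and> even (card (range \<sigma>))"
    then show "even n" using central_exponents_finite[OF assms(2)] that by (auto elim: dvd_trans[rotated])
  qed
  then have "HZ \<nu> (central_exponents \<sigma>) = H_minus \<nu>" by (rule HZ_even_eq_H_minus)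
  then show "irreducible_mod (eu_hat \<nu> \<sigma>) (u_act \<sigma>) (tensor_space (V_space \<nu> \<gamma>) (Sym (H_minus \<nu>)))"
    using eu_hat_irreducible[OF assms] by simp
next
  fix N assume "finite (range \<sigma>) \<and> card (range \<sigma>) = N \<and> odd N"
  then have eq: "HZ \<nu> (central_exponents \<sigma>) = H0_minus \<nu> N"
    using central_exponents_finite[OF assms(2)] by (simp add: HZ_multiples)
  show "irreducible_mod (eu_hat \<nu> \<sigma>) (u_act \<sigma>) (tensor_space (V_space \<nu> \<gamma>) (Sym (H0_minus \<nu> N)))"
    using eu_hat_irreducible[OF assms] unfolding eq .
  show "completely_reducible_mod (eu_hat \<nu> \<sigma>) (u_act \<sigma>) (tensor_space (V_space \<nu> \<gamma>) (Sym (H_minus \<nu>)))"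
    by (rule eu_hat_completely_reducible[OF assms])
  show "tensor_space (V_space \<nu> \<gamma>) (Sym (H0_minus \<nu> N)) \<subseteq> tensor_space (V_space \<nu> \<gamma>) (Sym (H_minus \<nu>))"
    by (intro tensor_space_least tensor_space_subspace tens_in_tensor_space)
      (auto simp flip: eq intro: Sym_HZ_imp_Sym_H_minus)
qed

end
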